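(* Fix $\delta,\lambda,A_0\in\mathbb{R}$ with $\lambda>0$. Then the variational problem of minimizing $E_{LM}$ over $$\mathcal{A}=\{(\gamma,\eta)\in H^2_{imm}([0,2\pi];\mathbb{R}^2)\times H^1_{per}([0,2\pi];\mathbb{R}^2)\colon A(\gamma)=A_0,\ S(\eta)=0\}$$ has a solution.
   Context: Let $\langle\cdot,\cdot\rangle$ be the Euclidean inner product on $\mathbb{R}^2$ and $J$ the counterclockwise rotation by $\pi/2$. For $k\in\mathbb{N}=\{1,2,\dots\}$, $H^k_{per}([0,2\pi];\mathbb{R}^m)$ is the set of $f\in H^k([0,2\pi];\mathbb{R}^m)$ with $\partial_x^\ell f(0)=\partial_x^\ell f(2\pi)$ for $\ell=0,\dots,k-1$. $H^2_{imm}([0,2\pi];\mathbb{R}^2)$ is the set of $\gamma\in H^2_{per}([0,2\pi];\mathbb{R}^2)$ with $\partial_x\gamma(x)\neq0$ for all $x$. For $\gamma\in H^2_{imm}$: $\partial_s=|\partial_x\gamma|^{-1}\partial_x$, $\tau=\partial_s\gamma$, $\nu=J\tau$, the curvature $\kappa$ is defined by $\partial_s\tau=\kappa\nu$, $\int_\gamma f\,\mathrm{d}s=\int_0^{2\pi}f|\partial_x\gamma|\,\mathrm{d}x$, $L(\gamma)=\int_\gamma1\,\mathrm{d}s$, and $A(\gamma)=-\frac12\int_0^{2\pi}\langle\gamma,J\partial_x\gamma\rangle\,\mathrm{d}x$ is the signed enclosed area. For $\eta\in H^1_{per}([0,2\pi];\mathbb{R}^2)$: $\operatorname{div}_\gamma\eta=\langle\partial_s\eta,\tau\rangle$,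 $\nabla_\gamma\eta=\partial_s\eta\otimes\tau$ (so $|\nabla_\gamma\eta|=|\partial_s\eta|$), and $S(\eta)=|\eta|^2-1$ (a function on $[0,2\pi]$). The energy is $$E_{LM}(\gamma,\eta)=\frac12\int_\gamma(\kappa+\delta\operatorname{div}_\gamma\eta)^2\,\mathrm{d}s+\frac\lambda2\int_\gamma|\nabla_\gamma\eta|^2\,\mathrm{d}s+L(\gamma).$$ *)

theory Defs
  imports "HOL-Analysis.Analysis"
begin

section \<open>Sobolev spaces on the interval from 0 to 2 pi\<close>

abbreviation I2pi :: "real set" where
  "I2pi \<equiv> {0..2*pi}"

definition test_function :: "(real \<Rightarrow> real) \<Rightarrow> bool" where
  "test_function \<phi> \<longleftrightarrow>
     (\<forall>n x. ((deriv ^^ n) \<phi>) field_differentiable (at x)) \<and>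
     closure {x. \<phi> x \<noteq> 0} \<subseteq> {0<..<2*pi}"

definition L2 :: "(real \<Rightarrow> real ^ 'm) set" where
  "L2 = {f. f \<in> borel_measurable (lebesgue_on I2pi) \<and>
            integrable (lebesgue_on I2pi) (\<lambda>x. (norm (f x))\<^sup>2)}"

definition has_weak_deriv :: "nat \<Rightarrow> (real \<Rightarrow> real ^ 'm) \<Rightarrow> (real \<Rightarrow> real ^ 'm) \<Rightarrow> bool" where
  "has_weak_deriv l f g \<longleftrightarrow> f \<in> L2 \<and> g \<in> L2 \<and>
     (\<forall>\<phi>. test_function \<phi> \<longrightarrow>
        (LINT x|lebesgue_on I2pi. (deriv ^^ l) \<phi> x *\<^sub>R f x) =
        (- 1) ^ l *\<^sub>R (LINT x|lebesgue_on I2pi. \<phi> x *\<^sub>R g x))"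

definition H :: "nat \<Rightarrow> (real \<Rightarrow> real ^ 'm) set" where
  "H k = {f. \<forall>l\<le>k. \<exists>g. has_weak_deriv l f g}"

(* A weak derivative is only determined almost everywhere. If it has a representative that is
   continuous on the closed interval (for f in H k this is the case for all l < k), that
   representative is taken; it is unique on the interval, so pointwise values there, including
   those at the end points, are meaningful. Otherwise the representative is arbitrary, and only
   integrals of it may be formed. Values outside the interval carry no information. *)
definition wderiv :: "nat \<Rightarrow> (real \<Rightarrow> real ^ 'm) \<Rightarrow> real \<Rightarrow> real ^ 'm" where
  "wderiv l f = (SOME g. has_weak_deriv l f g \<and>
     ((\<exists>h. has_weak_deriv l f h \<and> continuous_on I2pi h) \<longrightarrow> continuous_on I2pi g))"

abbreviation dx :: "(real \<Rightarrow> real ^ 'm) \<Rightarrow> real \<Rightarrow> real ^ 'm" where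
  "dx \<equiv> wderiv 1"

(* For k \<ge> 1; elements of H k are identified with their continuous representatives. *)
definition Hper :: "nat \<Rightarrow> (real \<Rightarrow> real ^ 'm) set" where
  "Hper k = {f \<in> H k. continuous_on I2pi f \<and> (\<forall>l<k. wderiv l f 0 = wderiv l f (2*pi))}"

definition H2imm :: "(real \<Rightarrow> real ^ 2) set" where
  "H2imm = {\<gamma> \<in> Hper 2. \<forall>x\<in>I2pi. dx \<gamma> x \<noteq> 0}"

section \<open>Geometry of immersed curves\<close>

definition J :: "real ^ 2 \<Rightarrow> real ^ 2" where
  "J v = vector [- v $ 2, v $ 1]"

definition ds :: "(real \<Rightarrow> real ^ 2) \<Rightarrow> (real \<Rightarrow> real ^ 2) \<Rightarrow> real \<Rightarrow> real ^ 2" where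
  "ds \<gamma> f x = inverse (norm (dx \<gamma> x)) *\<^sub>R dx f x"

definition tangent :: "(real \<Rightarrow> real ^ 2) \<Rightarrow> real \<Rightarrow> real ^ 2" where
  "tangent \<gamma> = ds \<gamma> \<gamma>"

definition normal :: "(real \<Rightarrow> real ^ 2) \<Rightarrow> real \<Rightarrow> real ^ 2" where
  "normal \<gamma> x = J (tangent \<gamma> x)"

(* The equation is solvable for almost every x, since the tangent has unit length; on the
   remaining null set the value is unspecified. *)
definition curvature :: "(real \<Rightarrow> real ^ 2) \<Rightarrow> real \<Rightarrow> real" where
  "curvature \<gamma> x = (THE k. ds \<gamma> (tangent \<gamma>) x = k *\<^sub>R normal \<gamma> x)"

definition curve_integral :: "(real \<Rightarrow> real ^ 2) \<Rightarrow> (real \<Rightarrow> real) \<Rightarrow> real" where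
  "curve_integral \<gamma> f = (LINT x|lebesgue_on I2pi. f x * norm (dx \<gamma> x))"

definition curve_length :: "(real \<Rightarrow> real ^ 2) \<Rightarrow> real" where
  "curve_length \<gamma> = curve_integral \<gamma> (\<lambda>x. 1)"

definition signed_area :: "(real \<Rightarrow> real ^ 2) \<Rightarrow> real" where
  "signed_area \<gamma> = - (1/2) * (LINT x|lebesgue_on I2pi. \<gamma> x \<bullet> J (dx \<gamma> x))"

definition div_along :: "(real \<Rightarrow> real ^ 2) \<Rightarrow> (real \<Rightarrow> real ^ 2) \<Rightarrow> real \<Rightarrow> real" where
  "div_along \<gamma> \<eta> x = ds \<gamma> \<eta> x \<bullet> tangent \<gamma> x"

definition tensor :: "real ^ 2 \<Rightarrow> real ^ 2 \<Rightarrow> real ^ 2 ^ 2" where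
  "tensor v w = (\<chi> i j. v $ i * w $ j)"

(* The library norm on matrices is the Frobenius norm. *)
definition grad_along :: "(real \<Rightarrow> real ^ 2) \<Rightarrow> (real \<Rightarrow> real ^ 2) \<Rightarrow> real \<Rightarrow> real ^ 2 ^ 2" where
  "grad_along \<gamma> \<eta> x = tensor (ds \<gamma> \<eta> x) (tangent \<gamma> x)"

section \<open>The variational problem\<close>

definition S :: "(real \<Rightarrow> real ^ 2) \<Rightarrow> real \<Rightarrow> real" where
  "S \<eta> x = (norm (\<eta> x))\<^sup>2 - 1"

definition E_LM :: "real \<Rightarrow> real \<Rightarrow> (real \<Rightarrow> real ^ 2) \<Rightarrow> (real \<Rightarrow> real ^ 2) \<Rightarrow> real" where
  "E_LM \<delta> lam \<gamma> \<eta> =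
     1/2 * curve_integral \<gamma> (\<lambda>x. (curvature \<gamma> x + \<delta> * div_along \<gamma> \<eta> x)\<^sup>2) +
     lam/2 * curve_integral \<gamma> (\<lambda>x. (norm (grad_along \<gamma> \<eta> x))\<^sup>2) +
     curve_length \<gamma>"

definition admissible :: "real \<Rightarrow> ((real \<Rightarrow> real ^ 2) \<times> (real \<Rightarrow> real ^ 2)) set" where
  "admissible A0 =
     {(\<gamma>, \<eta>) \<in> H2imm \<times> Hper 1. signed_area \<gamma> = A0 \<and> (\<forall>x\<in>I2pi. S \<eta> x = 0)}"

end

theory Submission
  imports Defs "HOL-Computational_Algebra.Polynomial" "HOL-Complex_Analysis.Great_Picard"
begin

text \<open>Direct method. Energy, length and area do not change under reparametrization, so every competitor
  may be taken with constant speed \<open>l\<close>; it is then given by \<open>l\<close>, its unit tangent \<open>T\<close> with mean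
  zero, and \<open>\<eta>\<close>. A bound on the energy bounds \<open>l\<close> from above and \<open>T'\<close>, \<open>\<eta>'\<close> in \<open>L\<^sup>2\<close>; as a closed
  curve has to turn, it also bounds \<open>l\<close> away from zero. By Arzela-Ascoli a minimizing sequence
  converges uniformly, which preserves all constraints. For the derivatives, freeze the coefficients of the
  quadratic energy density at the limit tangent and take almost norm-minimal elements in the convex
  hulls of the tails: they converge strongly, to the derivatives of the limit, and their norms
  stay below the infimum of the energy.\<close>

section \<open>Smooth bump functions\<close>

text \<open>The definitions speak of weak derivatives and chosen representatives, the argument of
  functions that are integrals of their derivatives. \<open>primitive_on\<close> is the bridge: bump
  functions and the fundamental lemma serve to cross it (\<open>Hper_1_iff\<close>,
  \<open>Hper_2_iff\<close>), and its chain rule yields the unit tangent and its orthogonality to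
  its derivative. The obstacle in the limit is missing convexity: unit fields form no convex set,
  and the density is quadratic in \<open>(T', \<eta>')\<close> only while \<open>T\<close> is held
  fixed. Hence only derivatives are combined. The combinations need not belong to unit fields, but
  their integrals stay uniformly close to the limit, since closeness to a fixed function survives
  averaging; this identifies their strong limit. At constant speed \<open>l\<close> the energy is
  \<open>bending / (2 * l) + 2 * pi * l\<close>. A bound on it makes \<open>bending\<close> at most
  of order \<open>l\<close>, while closedness bounds \<open>bending\<close> below; so
  \<open>l\<close> stays away from zero. As \<open>A0\<close> may have either sign or vanish, a
  competitor of prescribed area has to be built.\<close>

definition flat :: "real poly \<Rightarrow> real \<Rightarrow> real" where
  "flat p x = (if x > 0 then poly p (1 / x) / exp (1 / x) else 0)"

lemma poly_div_exp_tendsto_0: "((\<lambda>x::real. poly p x / exp x) \<longlongrightarrow> 0) at_top"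
proof -
  have "((\<lambda>x. \<Sum>i\<le>degree p. coeff p i * (x ^ i / exp x)) \<longlongrightarrow> (\<Sum>i\<le>degree p. coeff p i * 0)) at_top"
    by (intro tendsto_intros tendsto_power_div_exp_0)
  then show ?thesis
    by (simp add: poly_altdef sum_divide_distrib)
qed

text \<open>With y = 1/x the derivative of p(y) exp(-y) in x is y^2 (p(y) - p'(y)) exp(-y), so the
  family \<open>flat\<close>, which starts from the classical exp(-1/x) as \<open>flat 1\<close>, is
  closed under differentiation. At 0 the right difference quotient is y p(y) / exp(y) with y tending
  to infinity; \<open>pCons 0 p\<close> is the polynomial y p(y).\<close>

lemma flat_has_field_derivative:
  "(flat p has_field_derivative flat ([:0, 0, 1:] * (p - pderiv p)) x) (at x)"
proof -
  consider "x < 0" | "x = 0" | "x > 0" by linarith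
  then show ?thesis
  proof cases
    case 1
    have "((\<lambda>_. 0) has_field_derivative 0) (at x)" by simp
    then have "(flat p has_field_derivative 0) (at x)"
      by (rule has_field_derivative_transform_within_open[where S="{..<0}"])
         (use 1 in \<open>auto simp: flat_def\<close>)
    then show ?thesis using 1 by (simp add: flat_def)
  next
    case 2
    have right: "((\<lambda>h. flat p h / h) \<longlongrightarrow> 0) (at_right 0)"
    proof -
      have "((\<lambda>h::real. poly (pCons 0 p) (inverse h) / exp (inverse h)) \<longlongrightarrow> 0) (at_right 0)"
        using filterlim_compose[OF poly_div_exp_tendsto_0 filterlim_inverse_at_top_right] .
      then show ?thesis
        by (rule Lim_transform_eventually)
           (auto simp: eventually_at_filter flat_def field_simps)
    qed
    have left: "((\<lambda>h. flat p h / h) \<longlongrightarrow> 0) (at_left 0)"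
      by (rule Lim_transform_eventually[OF tendsto_const])
         (auto simp: eventually_at_filter flat_def)
    have "((\<lambda>h. (flat p (0 + h) - flat p 0) / h) \<longlongrightarrow> 0) (at 0)"
      using right left by (simp add: filterlim_at_split flat_def)
    then show ?thesis
      using 2 by (simp add: DERIV_def flat_def)
  next
    case 3
    have "((\<lambda>x. poly p (1 / x) / exp (1 / x)) has_field_derivative
        flat ([:0, 0, 1:] * (p - pderiv p)) x) (at x)"
      using 3 by (auto intro!: derivative_eq_intros poly_DERIV[THEN DERIV_chain2]
          simp: flat_def field_simps power2_eq_square)
    then show ?thesis
      by (rule has_field_derivative_transform_within_open[where S="{0<..}"])
         (use 3 in \<open>auto simp: flat_def\<close>)
  qed
qed

text \<open>A class that contains the rescaled flat functions and their products and that
  differentiation maps into itself. Smoothness follows without any formula for higher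
  derivatives.\<close>

inductive_set flat_algebra :: "(real \<Rightarrow> real) set" where
  flat: "(\<lambda>x. flat p (c * x + d)) \<in> flat_algebra"
| add: "f \<in> flat_algebra \<Longrightarrow> g \<in> flat_algebra \<Longrightarrow> (\<lambda>x. f x + g x) \<in> flat_algebra"
| mult: "f \<in> flat_algebra \<Longrightarrow> g \<in> flat_algebra \<Longrightarrow> (\<lambda>x. f x * g x) \<in> flat_algebra"

lemma flat_algebra_has_derivative:
  "f \<in> flat_algebra \<Longrightarrow> \<exists>f'\<in>flat_algebra. \<forall>x. (f has_field_derivative f' x) (at x)"
proof (induction rule: flat_algebra.induct)
  case (flat p c d)
  let ?q = "[:0, 0, 1:] * (p - pderiv p)"
  have "((\<lambda>x. flat p (c * x + d)) has_field_derivative flat (smult c ?q) (c * x + d)) (at x)" for x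
  proof -
    have "((\<lambda>x. flat p (c * x + d)) has_field_derivative flat ?q (c * x + d) * c) (at x)"
      by (rule DERIV_chain2[OF flat_has_field_derivative]) (auto intro!: derivative_eq_intros)
    moreover have "flat ?q (c * x + d) * c = flat (smult c ?q) (c * x + d)"
      by (simp add: flat_def)
    ultimately show ?thesis by simp
  qed
  then show ?case by (intro bexI[OF _ flat_algebra.flat[of "smult c ?q" c d]]) blast
next
  case (add f g)
  then obtain f' g' where "f' \<in> flat_algebra" "g' \<in> flat_algebra"
    "\<And>x. (f has_field_derivative f' x) (at x)" "\<And>x. (g has_field_derivative g' x) (at x)" by blast
  then show ?case
    by (intro bexI[of _ "\<lambda>x. f' x + g' x"]) (auto intro: flat_algebra.intros DERIV_add)
next
  case (mult f g)
  then obtain f' g' where "f' \<in> flat_algebra" "g' \<in> flat_algebra"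
    "\<And>x. (f has_field_derivative f' x) (at x)" "\<And>x. (g has_field_derivative g' x) (at x)" by blast
  with mult show ?case
    by (intro bexI[of _ "\<lambda>x. f' x * g x + g' x * f x"]) (auto intro: flat_algebra.intros DERIV_mult)
qed

lemma flat_algebra_smooth:
  assumes "f \<in> flat_algebra"
  shows "((deriv ^^ n) f) field_differentiable (at x)"
proof -
  have deriv: "deriv f \<in> flat_algebra" if f: "f \<in> flat_algebra" for f
  proof -
    obtain f' where "f' \<in> flat_algebra" "\<And>x. (f has_field_derivative f' x) (at x)"
      using flat_algebra_has_derivative[OF f] by blast
    moreover from this have "deriv f = f'" by (auto intro!: ext DERIV_imp_deriv)
    ultimately show ?thesis by simp
  qed
  have "(deriv ^^ n) f \<in> flat_algebra"
    by (induction n) (auto simp: assms deriv)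
  then show ?thesis
    using flat_algebra_has_derivative field_differentiable_def by blast
qed

lemma test_functionI:
  assumes "\<And>n x. ((deriv ^^ n) \<phi>) field_differentiable (at x)"
    and "0 < a" "b < 2 * pi" "\<And>x. x \<notin> {a..b} \<Longrightarrow> \<phi> x = 0"
  shows "test_function \<phi>"
proof -
  have "closure {x. \<phi> x \<noteq> 0} \<subseteq> {a..b}"
    using assms(4) by (intro closure_minimal) (blast, simp)
  then show ?thesis
    using assms by (auto simp: test_function_def)
qed

lemma test_function_support:
  assumes "test_function \<phi>"
  obtains a b where "0 < a" "a < b" "b < 2 * pi" "\<And>x. x \<notin> {a..b} \<Longrightarrow> \<phi> x = 0"
proof -
  define K where "K = closure {x. \<phi> x \<noteq> 0}"
  have K: "K \<subseteq> {0<..<2*pi}"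
    using assms by (auto simp: test_function_def K_def)
  have "bounded K" by (rule bounded_subset[OF _ K]) simp
  then have "compact K" by (simp add: K_def compact_eq_bounded_closed)
  have outside: "\<phi> x = 0" if "x \<notin> K" for x
    using that closure_subset[of "{x. \<phi> x \<noteq> 0}"] by (auto simp: K_def)
  show thesis
  proof (cases "K = {}")
    case True
    then show thesis using outside pi_gt3 by (intro that[of 1 2]) auto
  next
    case False
    obtain m where m: "m \<in> K" "\<And>x. x \<in> K \<Longrightarrow> m \<le> x"
      using compact_attains_inf[OF \<open>compact K\<close> False] by blast
    obtain M where M: "M \<in> K" "\<And>x. x \<in> K \<Longrightarrow> x \<le> M"
      using compact_attains_sup[OF \<open>compact K\<close> False] by blast
    have mM: "m \<le> M" "0 < m" "M < 2 * pi" using m M K by auto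
    show thesis
    \<comment> \<open>The right end is pushed halfway towards 2*pi, so that the strict inequality
      \<open>a < b\<close> follows from \<open>m \<le> M\<close> alone.\<close>
    proof (intro that[of m "(M + 2 * pi) / 2"])
      fix x assume x: "x \<notin> {m..(M + 2 * pi) / 2}"
      have "x \<notin> K"
      proof
        assume "x \<in> K"
        then have "m \<le> x" "x \<le> M" using m M by auto
        then show False using x \<open>M < 2 * pi\<close> by simp
      qed
      then show "\<phi> x = 0" by (rule outside)
    qed (use mM in auto)
  qed
qed

lemma test_function_deriv:
  assumes "test_function \<phi>"
  shows "test_function (deriv \<phi>)"
proof -
  obtain a b where ab: "0 < a" "b < 2 * pi" "\<And>x. x \<notin> {a..b} \<Longrightarrow> \<phi> x = 0"
    using test_function_support[OF assms] by metis
  have "deriv \<phi> x = 0" if "x \<notin> {a..b}" for x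
  proof (rule DERIV_imp_deriv, rule has_field_derivative_transform_within_open)
    show "((\<lambda>_. 0) has_field_derivative 0) (at x)" by simp
    show "open (- {a..b})" by (simp add: open_Compl)
  qed (use that ab in auto)
  moreover have "((deriv ^^ n) (deriv \<phi>)) field_differentiable (at x)" for n x
    using assms by (metis test_function_def funpow_simps_right(2) o_apply)
  ultimately show ?thesis
    using ab by (intro test_functionI[of _ a b]) auto
qed

lemma test_function_has_derivative:
  assumes "test_function \<phi>"
  shows "(\<phi> has_field_derivative deriv \<phi> x) (at x)"
proof -
  have "((deriv ^^ 0) \<phi>) field_differentiable (at x)"
    using assms unfolding test_function_def by blast
  then show ?thesis by (simp add: DERIV_deriv_iff_field_differentiable)
qed

lemma test_function_continuous: "test_function \<phi> \<Longrightarrow> continuous_on X \<phi>"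
  by (meson DERIV_isCont continuous_at_imp_continuous_on test_function_has_derivative)

text \<open>An antiderivative is constant on either side of the support of \<open>\<psi>\<close>.
  Normalization makes it vanish at 0, and the zero mean makes it vanish at 2*pi as well, so its
  support is compact again.\<close>

lemma test_function_antiderivative:
  assumes "test_function \<psi>" and mean: "integral {0..2*pi} \<psi> = 0"
  obtains \<Psi> where "test_function \<Psi>" "deriv \<Psi> = \<psi>"
proof -
  obtain F where F: "\<And>x. (F has_vector_derivative \<psi> x) (at x)"
    using einterval_antiderivative[of "-\<infinity>" \<infinity> \<psi>]
      DERIV_isCont[OF test_function_has_derivative[OF assms(1)]] by auto
  define \<Psi> where "\<Psi> x = F x - F 0" for x
  have D: "(\<Psi> has_field_derivative \<psi> x) (at x)" for x
    using has_vector_derivative_diff[OF F[of x] has_vector_derivative_const[of "F 0"]]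
    by (simp add: \<Psi>_def[abs_def] has_real_derivative_iff_has_vector_derivative)
  obtain a b where ab: "0 < a" "a < b" "b < 2 * pi" "\<And>x. x \<notin> {a..b} \<Longrightarrow> \<psi> x = 0"
    using test_function_support[OF assms(1)] by metis
  have "(\<psi> has_integral (\<Psi> (2*pi) - \<Psi> 0)) {0..2*pi}"
    by (rule fundamental_theorem_of_calculus)
       (auto intro: has_field_derivative_at_within D simp flip: has_real_derivative_iff_has_vector_derivative)
  then have end0: "\<Psi> (2 * pi) = 0"
    using mean by (simp add: integral_unique \<Psi>_def)
  have const: "\<Psi> x = \<Psi> y" if "convex C" "x \<in> C" "y \<in> C" "\<And>z. z \<in> C \<Longrightarrow> \<psi> z = 0" for C x y
  proof -
    have "\<exists>c. \<forall>x\<in>C. \<Psi> x = c"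
      using that(4) D by (intro has_field_derivative_zero_constant that(1)) (metis has_field_derivative_at_within)
    then show ?thesis using that(2,3) by auto
  qed
  have "\<Psi> x = 0" if "x \<notin> {a..b}" for x
  proof (cases "x < a")
    case True
    then show ?thesis using const[of "{..<a}" x 0] ab by (auto simp: \<Psi>_def)
  next
    case False
    then show ?thesis using const[of "{b<..}" x "2*pi"] that ab end0 by auto
  qed
  moreover have dPsi: "deriv \<Psi> = \<psi>" using D by (auto intro: DERIV_imp_deriv)
  moreover have "((deriv ^^ n) \<Psi>) field_differentiable (at x)" for n x
  proof (cases n)
    case 0
    then show ?thesis using D by (auto simp: field_differentiable_def)
  next
    case (Suc m)
    then have "(deriv ^^ n) \<Psi> = (deriv ^^ m) \<psi>" by (simp only: funpow_Suc_right o_apply dPsi)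
    then show ?thesis using assms(1) by (simp add: test_function_def)
  qed
  ultimately show thesis
    using ab by (intro that[of \<Psi>] test_functionI[of _ a b]) auto
qed

text \<open>\<open>flat 1\<close> is zero on the negative axis and tends to 1 at infinity. A product
  of two rescaled copies therefore switches on ever more steeply after 0 and off before
  \<open>b\<close>.\<close>

lemma test_functions_approximate_indicator:
  assumes "0 < b" "b \<le> 2 * pi"
  obtains \<phi> where "\<And>n. test_function (\<phi> n)" "\<And>n x. 0 \<le> \<phi> n x" "\<And>n x. \<phi> n x \<le> 1"
    "\<And>x. (\<lambda>n. \<phi> n x) \<longlonglongrightarrow> indicator {0<..<b} x"
proof -
  \<comment> \<open>The offsets by 1 confine the support to [1/(n+1), b - 1/(n+1)]. Both arguments
    are written in the shape \<open>c * x + d\<close> of \<open>flat_algebra.flat\<close>.\<close>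
  define \<phi> where "\<phi> n x = flat 1 (real (Suc n) * x + -1) * flat 1 (- real (Suc n) * x + (real (Suc n) * b - 1))" for n x
  have "test_function (\<phi> n)" for n
  proof (rule test_functionI[of _ "1 / real (Suc n)" "b - 1 / real (Suc n)"])
    have "\<phi> n \<in> flat_algebra"
      unfolding \<phi>_def by (intro flat_algebra.intros)
    then show "((deriv ^^ k) (\<phi> n)) field_differentiable (at x)" for k x
      by (rule flat_algebra_smooth)
    show "b - 1 / real (Suc n) < 2 * pi"
      using assms by (smt (verit) divide_pos_pos of_nat_0_less_iff zero_less_Suc)
    show "\<phi> n x = 0" if "x \<notin> {1 / real (Suc n)..b - 1 / real (Suc n)}" for x
      using that by (auto simp: \<phi>_def flat_def field_simps)
  qed simp
  moreover have flat01: "0 \<le> flat 1 y \<and> flat 1 y \<le> 1" for y by (auto simp: flat_def)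
  moreover have "(\<lambda>n. \<phi> n x) \<longlonglongrightarrow> indicator {0<..<b} x" for x
  proof (cases "x \<in> {0<..<b}")
    case True
    have lim: "(\<lambda>n. flat 1 (real (Suc n) * c + -1)) \<longlonglongrightarrow> 1" if "c > 0" for c
    proof -
      have top: "filterlim (\<lambda>n. real (Suc n) * c + -1) at_top sequentially"
      proof -
        have "filterlim (\<lambda>n. real n * c + (c - 1)) at_top sequentially"
          unfolding add.commute[of _ "c - 1"]
          by (rule filterlim_tendsto_add_at_top filterlim_at_top_mult_tendsto_pos tendsto_const that filterlim_real_sequentially)+
        then show ?thesis by (simp add: algebra_simps)
      qed
      have "((\<lambda>y. 1 / exp (inverse y)) \<longlongrightarrow> 1 / exp (0::real)) at_top"
        by (intro tendsto_intros tendsto_inverse_0_at_top filterlim_ident) auto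
      moreover have "eventually (\<lambda>y. 1 / exp (inverse y) = flat 1 y) at_top"
        using eventually_gt_at_top[of 0] by eventually_elim (simp add: flat_def inverse_eq_divide)
      ultimately have "((flat 1) \<longlongrightarrow> 1) at_top"
        using Lim_transform_eventually[of "\<lambda>y. 1 / exp (inverse y)"] by simp
      then show ?thesis using filterlim_compose top by blast
    qed
    have "(\<lambda>n. flat 1 (real (Suc n) * x + -1) * flat 1 (real (Suc n) * (b - x) + -1)) \<longlonglongrightarrow> 1 * 1"
      using True by (intro tendsto_mult lim) auto
    then show ?thesis using True by (simp add: \<phi>_def algebra_simps)
  next
    case False
    have "\<phi> n x = 0" for n
    proof -
      have "real (Suc n) * x + -1 \<le> 0 \<or> - real (Suc n) * x + (real (Suc n) * b - 1) \<le> 0"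
      proof (cases "x \<le> 0")
        case True
        then have "real (Suc n) * x \<le> 0" by (simp add: mult_nonneg_nonpos)
        then show ?thesis by simp
      next
        case 2: False
        then have "real (Suc n) * b \<le> real (Suc n) * x" using False by (intro mult_left_mono) auto
        then have "- real (Suc n) * x + (real (Suc n) * b - 1) \<le> 0" by linarith
        then show ?thesis by blast
      qed
      then show ?thesis unfolding \<phi>_def flat_def by auto
    qed
    moreover have "indicator {0<..<b} x = (0::real)" using False by (simp add: indicator_def)
    ultimately show ?thesis by simp
  qed
  ultimately show thesis
    by (intro that[of \<phi>]) (auto simp: \<phi>_def mult_le_one)
qed

section \<open>The fundamental lemma of the calculus of variations\<close>

lemma integrable_lebesgue_on_iff:
  fixes f :: "real \<Rightarrow> 'a::euclidean_space"
  assumes "X \<in> sets lebesgue"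
  shows "integrable (lebesgue_on X) f \<longleftrightarrow> f absolutely_integrable_on X"
  using assms by (simp add: integrable_restrict_space set_integrable_def)

lemma AE_lebesgue_on_iff:
  "X \<in> sets lebesgue \<Longrightarrow> (AE x in lebesgue_on X. P x) \<longleftrightarrow> (AE x in lebesgue. x \<in> X \<longrightarrow> P x)"
  by (subst AE_restrict_space_iff) auto

text \<open>The positive and the negative part of a Borel version \<open>v\<close> of
  \<open>w\<close> are densities of two finite measures that agree on all half-lines. The measures
  then coincide, so the densities agree a.e.; as at most one of the two parts is nonzero at a point,
  both vanish.\<close>

lemma real_AE_eq_0_if_interval_integrals_eq_0:
  fixes w :: "real \<Rightarrow> real"
  assumes w: "integrable lebesgue w" and zero: "\<And>x. integral {x<..} w = 0"
  shows "AE x in lebesgue. w x = 0"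
proof -
  obtain v where v[measurable]: "v \<in> borel_measurable lborel" and wv: "AE x in lborel. w x = v x"
    using completion_ex_borel_measurable_real[of w lborel] w by auto
  have wv': "AE x in lebesgue. w x = v x" using wv by (rule AE_completion)
  have v': "v \<in> borel_measurable lebesgue" using v by (rule measurable_completion)
  have "integrable lebesgue v"
    using integrable_cong_AE_imp[OF w v'] wv' by (auto elim: AE_mp)
  then have vint[measurable]: "integrable lborel v" by (simp add: integrable_completion)
  define f where "f x = ennreal (v x)" for x
  define g where "g x = ennreal (- v x)" for x
  have [measurable]: "f \<in> borel_measurable lborel" "g \<in> borel_measurable lborel"
    unfolding f_def g_def by measurable
  have split: "ennreal (LINT x|lborel. max 0 (v x) * indicator X x) = (\<integral>\<^sup>+x. f x * indicator X x \<partial>lborel)"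
    "ennreal (LINT x|lborel. max 0 (- v x) * indicator X x) = (\<integral>\<^sup>+x. g x * indicator X x \<partial>lborel)"
    "(LINT x|lborel. max 0 (v x) * indicator X x) - (LINT x|lborel. max 0 (- v x) * indicator X x)
      = (LINT x|lborel. v x * indicator X x)"
    if [measurable]: "X \<in> sets borel" for X
  proof -
    have i1: "integrable lborel (\<lambda>x. max 0 (v x) * indicator X x)"
      by (rule Bochner_Integration.integrable_bound[OF vint]) (auto simp: indicator_def)
    have i2: "integrable lborel (\<lambda>x. max 0 (- v x) * indicator X x)"
      by (rule Bochner_Integration.integrable_bound[OF vint]) (auto simp: indicator_def)
    show "ennreal (LINT x|lborel. max 0 (v x) * indicator X x) = (\<integral>\<^sup>+x. f x * indicator X x \<partial>lborel)"
      by (subst nn_integral_eq_integral[OF i1, symmetric])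
         (auto simp: f_def indicator_def max_def ennreal_neg intro!: nn_integral_cong)
    show "ennreal (LINT x|lborel. max 0 (- v x) * indicator X x) = (\<integral>\<^sup>+x. g x * indicator X x \<partial>lborel)"
      by (subst nn_integral_eq_integral[OF i2, symmetric])
         (auto simp: g_def indicator_def max_def ennreal_neg intro!: nn_integral_cong)
    show "(LINT x|lborel. max 0 (v x) * indicator X x) - (LINT x|lborel. max 0 (- v x) * indicator X x)
      = (LINT x|lborel. v x * indicator X x)"
      by (subst Bochner_Integration.integral_diff[OF i1 i2, symmetric])
         (auto simp: indicator_def max_def intro!: Bochner_Integration.integral_cong)
  qed
  have tail: "(LINT t|lborel. v t * indicator {x<..} t) = 0" for x
  proof -
    have "(LINT t|lborel. v t * indicator {x<..} t) = (LINT t|lebesgue. v t * indicator {x<..} t)"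
      by (rule integral_completion[symmetric]) measurable
    also have "\<dots> = (LINT t|lebesgue. indicator {x<..} t *\<^sub>R w t)"
    proof (rule integral_cong_AE)
      have [measurable]: "w \<in> borel_measurable lebesgue" "v \<in> borel_measurable lebesgue" "{x<..} \<in> sets lebesgue"
        using w v' by auto
      show "(\<lambda>t. v t * indicator {x<..} t) \<in> borel_measurable lebesgue"
        "(\<lambda>t. indicator {x<..} t *\<^sub>R w t) \<in> borel_measurable lebesgue" by measurable
      show "AE t in lebesgue. v t * indicator {x<..} t = indicator {x<..} t *\<^sub>R w t"
        using wv' by eventually_elim auto
    qed
    also have "\<dots> = integral {x<..} w"
    proof -
      have "set_integrable lebesgue {x<..} w"
        using integrable_mult_indicator[of "{x<..}" lebesgue w] w by (auto simp: set_integrable_def)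
      then show ?thesis
        using set_lebesgue_integral_eq_integral(2)[of "{x<..}" w] by (simp add: set_lebesgue_integral_def)
    qed
    finally show ?thesis using zero by simp
  qed
  have "density lborel f = density lborel g"
  proof (rule measure_eqI_lessThan)
    show "emeasure (density lborel f) {x<..} < \<infinity>" for x
      using split(1)[of "{x<..}"] by (simp add: emeasure_density flip: split)
    show "emeasure (density lborel f) {x<..} = emeasure (density lborel g) {x<..}" for x
      using split(3)[of "{x<..}"] tail by (simp add: emeasure_density flip: split)
  qed auto
  moreover have "integral\<^sup>N lborel f \<noteq> \<infinity>"
  proof -
    have "integral\<^sup>N lborel f = ennreal (LINT x|lborel. max 0 (v x))"
      using split(1)[of UNIV] by simp
    then show ?thesis by simp
  qed
  ultimately have "AE x in lborel. f x = g x"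
    by (subst (asm) finite_density_unique) auto
  then have "AE x in lborel. v x = 0"
  proof eventually_elim
    case (elim x)
    then show "v x = 0"
      unfolding f_def g_def by (cases "v x \<ge> 0") (simp_all add: ennreal_neg ennreal_eq_0_iff eq_commute[of 0])
  qed
  then have "AE x in lebesgue. v x = 0" by (rule AE_completion)
  with wv' show ?thesis by eventually_elim auto
qed

lemma AE_eq_0_if_integral_eq_0:
  fixes w :: "real \<Rightarrow> 'a::euclidean_space"
  assumes w: "integrable (lebesgue_on {a..b}) w" and zero: "\<And>x. x \<in> {a..b} \<Longrightarrow> integral {a..x} w = 0"
  shows "AE x in lebesgue_on {a..b}. w x = 0"
proof (cases "a \<le> b")
  case True
  have "AE x in lebesgue. indicator {a..b} x * (w x \<bullet> i) = 0" if i: "i \<in> Basis" for i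
  proof (rule real_AE_eq_0_if_interval_integrals_eq_0)
    have wi: "integrable (lebesgue_on {a..b}) (\<lambda>x. w x \<bullet> i)" using w by simp
    then show int: "integrable lebesgue (\<lambda>x. indicator {a..b} x * (w x \<bullet> i))"
      by (simp add: integrable_restrict_space)
    have wio: "w integrable_on {a..b}" using w by (auto intro: integrable_on_lebesgue_on)
    fix x
    \<comment> \<open>Clamping \<open>x\<close> to the interval turns the half-line integral of the
      component extended by zero into an integral over {y..b}.\<close>
    define y where "y = max a (min x b)"
    have y: "y \<in> {a..b}" using True by (auto simp: y_def)
    have "integral {a..y} w + integral {y..b} w = integral {a..b} w"
      using wio y by (intro Henstock_Kurzweil_Integration.integral_combine) auto
    then have "integral {y..b} w = 0" using zero[OF y] zero[of b] True by simp
    then have "integral {y..b} (\<lambda>x. w x \<bullet> i) = 0"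
      using integral_component_eq[of w "{y..b}" i] integrable_on_subinterval[OF wio, of y b] y by auto
    moreover have "integral {x<..} (\<lambda>x. indicator {a..b} x * (w x \<bullet> i)) = integral {y..b} (\<lambda>x. w x \<bullet> i)"
    proof -
      have "integral {x<..} (\<lambda>x. indicator {a..b} x * (w x \<bullet> i))
         = integral UNIV (\<lambda>t. if t \<in> {x<..} then indicator {a..b} t * (w t \<bullet> i) else 0)"
        by (rule integral_restrict_UNIV[symmetric])
      also have "\<dots> = integral UNIV (\<lambda>t. if t \<in> {y..b} then w t \<bullet> i else 0)"
        by (rule integral_spike[of "{x, a, b}"]) (auto simp: y_def indicator_def)
      also have "\<dots> = integral {y..b} (\<lambda>x. w x \<bullet> i)" by (rule integral_restrict_UNIV)
      finally show ?thesis .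
    qed
    ultimately show "integral {x<..} (\<lambda>x. indicator {a..b} x * (w x \<bullet> i)) = 0" by simp
  qed
  then have "AE x in lebesgue. \<forall>i\<in>Basis. indicator {a..b} x * (w x \<bullet> i) = 0"
    by (intro AE_finite_allI) auto
  then have "AE x in lebesgue. x \<in> {a..b} \<longrightarrow> w x = 0"
    by eventually_elim (auto intro: euclidean_eqI)
  then show ?thesis by (simp add: AE_lebesgue_on_iff)
qed (auto intro: AE_I2)

text \<open>Test functions converging boundedly to the indicator of (0, b) carry the hypothesis over
  to the integrals of \<open>w\<close> over {0..b}, by dominated convergence with majorant
  |w|.\<close>

lemma fundamental_lemma_variations:
  fixes w :: "real \<Rightarrow> 'a::euclidean_space"
  assumes w: "integrable (lebesgue_on I2pi) w"
    and zero: "\<And>\<phi>. test_function \<phi> \<Longrightarrow> (LINT x|lebesgue_on I2pi. \<phi> x *\<^sub>R w x) = 0"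
  shows "AE x in lebesgue_on I2pi. w x = 0"
proof (rule AE_eq_0_if_integral_eq_0[OF w])
  fix b assume b: "b \<in> I2pi"
  show "integral {0..b} w = 0"
  proof (cases "b = 0")
    case False
    then have b': "0 < b" "b \<le> 2 * pi" using b by auto
    obtain \<phi> where \<phi>: "\<And>n. test_function (\<phi> n)" "\<And>n x. 0 \<le> \<phi> n x" "\<And>n x. \<phi> n x \<le> 1"
      "\<And>x. (\<lambda>n. \<phi> n x) \<longlonglongrightarrow> indicator {0<..<b} x"
      by (rule test_functions_approximate_indicator[OF b']) blast
    have [measurable]: "\<phi> n \<in> borel_measurable (lebesgue_on I2pi)" for n
      by (intro continuous_imp_measurable_on_sets_lebesgue test_function_continuous \<phi>) auto
    have [measurable]: "w \<in> borel_measurable (lebesgue_on I2pi)" using w by simp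
    have [measurable]: "{0<..<b} \<in> sets (lebesgue_on I2pi)"
      using b by (auto simp: sets_restrict_space_iff)
    have "(\<lambda>n. LINT x|lebesgue_on I2pi. \<phi> n x *\<^sub>R w x) \<longlonglongrightarrow>
        (LINT x|lebesgue_on I2pi. indicator {0<..<b} x *\<^sub>R w x)"
    proof (rule integral_dominated_convergence[where w="\<lambda>x. norm (w x)"])
      show "AE x in lebesgue_on I2pi. norm (\<phi> n x *\<^sub>R w x) \<le> norm (w x)" for n
        using \<phi>(2,3) by (auto simp: mult_left_le_one_le)
      show "AE x in lebesgue_on I2pi. (\<lambda>n. \<phi> n x *\<^sub>R w x) \<longlonglongrightarrow> indicator {0<..<b} x *\<^sub>R w x"
        by (intro AE_I2 tendsto_intros \<phi>)
    qed (use w in auto)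
    then have "(LINT x|lebesgue_on I2pi. indicator {0<..<b} x *\<^sub>R w x) = 0"
      using zero[OF \<phi>(1)] by (simp add: LIMSEQ_const_iff)
    moreover have "(LINT x|lebesgue_on I2pi. indicator {0<..<b} x *\<^sub>R w x) = integral {0..b} w"
    proof -
      have "integrable (lebesgue_on I2pi) (\<lambda>x. indicator {0<..<b} x *\<^sub>R w x)"
        using w by (intro integrable_mult_indicator) measurable
      then have "(LINT x|lebesgue_on I2pi. indicator {0<..<b} x *\<^sub>R w x)
        = integral I2pi (\<lambda>x. indicator {0<..<b} x *\<^sub>R w x)"
        by (intro lebesgue_integral_eq_integral) auto
      also have "\<dots> = integral UNIV (\<lambda>x. if x \<in> I2pi then indicator {0<..<b} x *\<^sub>R w x else 0)"
        by (rule integral_restrict_UNIV[symmetric])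
      also have "\<dots> = integral UNIV (\<lambda>x. if x \<in> {0..b} then w x else 0)"
        using b by (intro integral_spike[of "{0, b}"]) (auto simp: indicator_def)
      also have "\<dots> = integral {0..b} w" by (rule integral_restrict_UNIV)
      finally show ?thesis .
    qed
    ultimately show ?thesis by simp
  qed simp
qed

section \<open>Primitives of integrable functions\<close>

text \<open>The working form of "\<open>f\<close> is absolutely continuous with derivative
  \<open>g\<close>". Only the integral identity is demanded, nothing about differentiability at
  points, and \<open>g\<close> matters only up to null sets.\<close>

definition primitive_on :: "real \<Rightarrow> real \<Rightarrow> (real \<Rightarrow> 'a::euclidean_space) \<Rightarrow> (real \<Rightarrow> 'a) \<Rightarrow> bool" where
  "primitive_on a b f g \<longleftrightarrow>
     g absolutely_integrable_on {a..b} \<and> (\<forall>x\<in>{a..b}. f x = f a + integral {a..x} g)"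

lemma primitive_onD:
  assumes "primitive_on a b f g"
  shows "g absolutely_integrable_on {a..b}" "g integrable_on {a..b}"
    "\<And>x. x \<in> {a..b} \<Longrightarrow> f x = f a + integral {a..x} g"
  using assms set_lebesgue_integral_eq_integral(1) unfolding primitive_on_def by blast+

lemma primitive_on_diff_eq:
  assumes f: "primitive_on a b f g" and "u \<in> {a..b}" "v \<in> {a..b}" "u \<le> v"
  shows "f v - f u = integral {u..v} g"
proof -
  have "integral {a..u} g + integral {u..v} g = integral {a..v} g"
    using assms integrable_on_subinterval[OF primitive_onD(2)[OF f], of a v]
    by (intro Henstock_Kurzweil_Integration.integral_combine) auto
  moreover have "f u = f a + integral {a..u} g" "f v = f a + integral {a..v} g"
    using assms primitive_onD(3)[OF f] by blast+
  ultimately show ?thesis by (metis add_diff_cancel_left add_diff_cancel_left')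
qed

lemma primitive_on_continuous:
  assumes "primitive_on a b f g"
  shows "continuous_on {a..b} f"
proof -
  have "continuous_on {a..b} (\<lambda>x. f a + integral {a..x} g)"
    by (intro continuous_intros indefinite_integral_continuous_1 primitive_onD[OF assms])
  moreover have "continuous_on {a..b} f \<longleftrightarrow> continuous_on {a..b} (\<lambda>x. f a + integral {a..x} g)"
    by (intro continuous_on_cong refl primitive_onD(3)[OF assms])
  ultimately show ?thesis by blast
qed

lemma primitive_on_vector_derivative:
  assumes "a \<le> b" "continuous_on {a..b} g"
    and "\<And>x. x \<in> {a..b} \<Longrightarrow> (f has_vector_derivative g x) (at x within {a..b})"
  shows "primitive_on a b f g"
proof -
  have "(g has_integral (f x - f a)) {a..x}" if "x \<in> {a..b}" for x
    using that by (intro fundamental_theorem_of_calculus)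
      (auto intro: has_vector_derivative_within_subset[OF assms(3)])
  then show ?thesis
    using assms(2) by (force simp: primitive_on_def dest: integral_unique intro: absolutely_integrable_continuous_real)
qed

lemma primitive_on_AE_unique:
  assumes f: "primitive_on a b f g" and h: "primitive_on a b f h"
  shows "AE x in lebesgue_on {a..b}. g x = h x"
proof -
  have "AE x in lebesgue_on {a..b}. g x - h x = 0"
  proof (rule AE_eq_0_if_integral_eq_0)
    show "integrable (lebesgue_on {a..b}) (\<lambda>x. g x - h x)"
      using primitive_onD(1)[OF f] primitive_onD(1)[OF h] by (simp add: integrable_lebesgue_on_iff)
    fix x assume x: "x \<in> {a..b}"
    have "g integrable_on {a..x}" "h integrable_on {a..x}"
      using integrable_on_subinterval[OF primitive_onD(2)[OF f], of a x]
        integrable_on_subinterval[OF primitive_onD(2)[OF h], of a x] x by auto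
    then have "integral {a..x} (\<lambda>x. g x - h x) = integral {a..x} g - integral {a..x} h"
      by (rule Henstock_Kurzweil_Integration.integral_diff)
    also have "\<dots> = 0" using primitive_onD(3)[OF f x] primitive_onD(3)[OF h x] by simp
    finally show "integral {a..x} (\<lambda>x. g x - h x) = 0" .
  qed
  then show ?thesis by simp
qed

text \<open>The remainder \<open>H\<close> below satisfies \<open>|H v - H u| \<le> \<epsilon> (G v - G u)\<close> for every \<open>\<epsilon> > 0\<close>, first locally
  and then globally by a bisection argument; so no almost everywhere differentiation is needed.\<close>

lemma primitive_on_chain:
  fixes f g :: "real \<Rightarrow> 'a::euclidean_space" and F :: "'a \<Rightarrow> 'b::euclidean_space"
  assumes f: "primitive_on a b f g"
    and F: "\<And>x. x \<in> {a..b} \<Longrightarrow> (F has_derivative D x) (at (f x))"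
    and D: "\<And>i. i \<in> Basis \<Longrightarrow> continuous_on {a..b} (\<lambda>x. D x i)"
  shows "primitive_on a b (\<lambda>x. F (f x)) (\<lambda>x. D x (g x))"
proof -
  note lin = has_derivative_linear[OF F]
  have D_sum: "D x v = (\<Sum>i\<in>Basis. (v \<bullet> i) *\<^sub>R D x i)" if "x \<in> {a..b}" for x v
    using Real_Vector_Spaces.linear_sum[OF lin[OF that], of "\<lambda>i. (v \<bullet> i) *\<^sub>R i" Basis] linear_scale[OF lin[OF that]]
    by (simp add: euclidean_representation)
  note gi = primitive_onD(1,2)[OF f]
  have "(\<lambda>x. \<Sum>i\<in>Basis. (g x \<bullet> i) *\<^sub>R D x i) absolutely_integrable_on {a..b}"
  proof (intro absolutely_integrable_sum finite_Basis)
    fix i :: 'a assume i: "i \<in> Basis"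
    have "(\<lambda>x. D x i) \<in> borel_measurable (lebesgue_on {a..b})"
      by (intro continuous_imp_measurable_on_sets_lebesgue D i) auto
    moreover have "bounded ((\<lambda>x. D x i) ` {a..b})"
      by (intro compact_imp_bounded compact_continuous_image D i) auto
    moreover have "(\<lambda>x. g x \<bullet> i) absolutely_integrable_on {a..b}"
      using gi(1) by (rule absolutely_integrable_component)
    ultimately show "(\<lambda>x. (g x \<bullet> i) *\<^sub>R D x i) absolutely_integrable_on {a..b}"
      using absolutely_integrable_bounded_measurable_product[of "\<lambda>d r. r *\<^sub>R d" "\<lambda>x. D x i" "{a..b}" "\<lambda>x. g x \<bullet> i"]
      by (simp add: bilinear_def linear_iff algebra_simps)
  qed
  then have int: "(\<lambda>x. D x (g x)) absolutely_integrable_on {a..b}"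
    by (rule set_integrable_cong[THEN iffD1, rotated -1]) (use D_sum in auto)
  define H where "H x = F (f x) - integral {a..x} (\<lambda>x. D x (g x))" for x
  \<comment> \<open>Errors are measured by increments of \<open>G\<close> instead of lengths of
    intervals, because \<open>g\<close> may be unbounded; \<open>G\<close> dominates the increments
    of \<open>f\<close>.\<close>
  define G where "G x = integral {a..x} (\<lambda>x. norm (g x))" for x
  have ng: "(\<lambda>x. norm (g x)) integrable_on {a..b}"
    using absolutely_integrable_on_def gi(1) by blast
  have G_diff: "G v - G u = integral {u..v} (\<lambda>x. norm (g x))" if "a \<le> u" "u \<le> v" "v \<le> b" for u v
    using Henstock_Kurzweil_Integration.integral_combine[OF that(1,2) integrable_on_subinterval[OF ng]] that
    by (auto simp: G_def algebra_simps)
  have f_diff: "norm (f v - f u) \<le> G v - G u" if "a \<le> u" "u \<le> v" "v \<le> b" for u v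
  proof -
    have "norm (integral {u..v} g) \<le> integral {u..v} (\<lambda>x. norm (g x))"
      using that by (intro integral_norm_bound_integral integrable_on_subinterval[OF gi(2)] integrable_on_subinterval[OF ng]) auto
    then show ?thesis using primitive_on_diff_eq[OF f] G_diff that by auto
  qed
  have H_diff: "norm (H v - H u) \<le> \<epsilon> * (G v - G u)" if \<epsilon>: "\<epsilon> > 0" and uv: "a \<le> u" "u \<le> v" "v \<le> b" for u v \<epsilon>
  proof -
    \<comment> \<open>The two trivial premises make the bisection predicate remember that its
      subintervals lie between \<open>u\<close> and \<open>v\<close>.\<close>
    have "u \<le> u \<longrightarrow> v \<le> v \<longrightarrow> norm (H v - H u) \<le> \<epsilon> * (G v - G u)"
      using uv(2)
    proof (induction rule: Bolzano[where P="\<lambda>s t. u \<le> s \<longrightarrow> t \<le> v \<longrightarrow> norm (H t - H s) \<le> \<epsilon> * (G t - G s)"])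
      case (trans r s t)
      have "norm (H t - H r) \<le> norm (H t - H s) + norm (H s - H r)"
        by (metis norm_triangle_ineq diff_add_cancel add_diff_eq)
      then show ?case using trans by (auto simp: algebra_simps)
    next
      case (local x)
      then have x: "x \<in> {a..b}" using uv by auto
      obtain d1 where d1: "d1 > 0" and d1': "\<And>y. norm (y - f x) < d1 \<Longrightarrow> norm (F y - F (f x) - D x (y - f x)) \<le> \<epsilon> / 2 * norm (y - f x)"
        using F[OF x] \<epsilon> unfolding has_derivative_at_alt by (meson half_gt_zero)
      obtain d2 where d2: "d2 > 0" and d2': "\<And>y. y \<in> {a..b} \<Longrightarrow> dist y x < d2 \<Longrightarrow> norm (f y - f x) < d1"
        using primitive_on_continuous[OF f] x d1 unfolding continuous_on_iff by (metis dist_norm)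
      \<comment> \<open>Each basis direction gets its share of \<epsilon>/2: by linearity the
        operator \<open>D y - D x\<close> is controlled by its values on the finite basis.\<close>
      define \<epsilon>' where "\<epsilon>' = \<epsilon> / (2 * DIM('a))"
      have "\<epsilon>' > 0" using \<epsilon> by (simp add: \<epsilon>'_def)
      have "\<exists>d>0. \<forall>y\<in>{a..b}. dist y x < d \<longrightarrow> norm (D y i - D x i) < \<epsilon>'" if "i \<in> Basis" for i
        using D[OF that] x \<open>\<epsilon>' > 0\<close> unfolding continuous_on_iff by (metis dist_norm)
      then obtain d where d: "\<And>i. i \<in> Basis \<Longrightarrow> d i > 0"
        "\<And>i y. i \<in> Basis \<Longrightarrow> y \<in> {a..b} \<Longrightarrow> dist y x < d i \<Longrightarrow> norm (D y i - D x i) < \<epsilon>'"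
        by metis
      define d3 where "d3 = Min (d ` Basis)"
      have d3: "d3 > 0" using d(1) by (simp add: d3_def)
      have d3': "norm (D y v - D x v) \<le> \<epsilon> / 2 * norm v" if y: "y \<in> {a..b}" "dist y x < d3" for y v
      proof -
        have "norm (D y v - D x v) = norm (\<Sum>i\<in>Basis. (v \<bullet> i) *\<^sub>R (D y i - D x i))"
          by (simp add: D_sum[OF x, of v] D_sum[OF y(1), of v] sum_subtractf scaleR_diff_right)
        also have "\<dots> \<le> (\<Sum>i\<in>(Basis::'a set). norm v * \<epsilon>')"
        proof (rule sum_norm_le)
          fix i :: 'a assume i: "i \<in> Basis"
          have "dist y x < d i" using y(2) i by (simp add: d3_def)
          then show "norm ((v \<bullet> i) *\<^sub>R (D y i - D x i)) \<le> norm v * \<epsilon>'"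
            unfolding norm_scaleR using d(2)[OF i y(1)] Basis_le_norm[OF i, of v]
            by (intro mult_mono) auto
        qed
        also have "\<dots> = \<epsilon> / 2 * norm v" by (simp add: \<epsilon>'_def)
        finally show ?thesis .
      qed
      have part: "norm (F (f y) - F (f x) - D x (f y - f x)) \<le> \<epsilon> / 2 * norm (f y - f x)" if "y \<in> {a..b}" "dist y x < d2" for y
        using d1' d2' that by blast
      \<comment> \<open>The linearization of \<open>F\<close> at \<open>f x\<close> compares values
        with \<open>F (f x)\<close> only, so \<open>x\<close> has to be an end point here. A general
        small interval around \<open>x\<close> is split at \<open>x\<close> afterwards.\<close>
      have half: "norm (H t - H s) \<le> \<epsilon> * (G t - G s)"
        if st: "s = x \<or> t = x" "a \<le> s" "s \<le> t" "t \<le> b" "t - s < min d2 d3" for s t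
      proof -
        have intD: "(\<lambda>y. D y (g y)) integrable_on {a..b}"
          using int set_lebesgue_integral_eq_integral(1) by blast
        have intDx: "(\<lambda>y. D x (g y)) integrable_on {s..t}"
          using integrable_linear[OF integrable_on_subinterval[OF gi(2), of s t], of "D x"] lin[OF x] st
          by (simp add: o_def linear_conv_bounded_linear)
        have Ds: "(\<lambda>y. D y (g y)) integrable_on {s..t}"
          by (rule integrable_on_subinterval[OF intD]) (use st in auto)
        have "integral {a..s} (\<lambda>y. D y (g y)) + integral {s..t} (\<lambda>y. D y (g y)) = integral {a..t} (\<lambda>y. D y (g y))"
          using st by (intro Henstock_Kurzweil_Integration.integral_combine integrable_on_subinterval[OF intD]) auto
        then have "H t - H s = F (f t) - F (f s) - integral {s..t} (\<lambda>y. D y (g y))"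
          by (simp add: H_def algebra_simps)
        \<comment> \<open>With the coefficient frozen at \<open>x\<close> the integral is exactly
          \<open>D x (f t - f s)\<close>, by linearity. The rest is small since \<open>D y\<close>
          is close to \<open>D x\<close>.\<close>
        also have "integral {s..t} (\<lambda>y. D y (g y)) = integral {s..t} (\<lambda>y. D y (g y) - D x (g y)) + integral {s..t} (\<lambda>y. D x (g y))"
          by (subst Henstock_Kurzweil_Integration.integral_diff[OF Ds intDx]) simp
        also have "integral {s..t} (\<lambda>y. D x (g y)) = D x (f t - f s)"
          using integral_linear[OF integrable_on_subinterval[OF gi(2), of s t], of "D x"] lin[OF x] st primitive_on_diff_eq[OF f, of s t]
          by (simp add: o_def linear_conv_bounded_linear)
        finally have eq: "H t - H s = (F (f t) - F (f s) - D x (f t - f s)) - integral {s..t} (\<lambda>y. D y (g y) - D x (g y))"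
          by simp
        have "norm (F (f t) - F (f s) - D x (f t - f s)) \<le> \<epsilon> / 2 * norm (f t - f s)"
        proof (cases "s = x")
          case True
          then show ?thesis using part[of t] st by (auto simp: dist_real_def)
        next
          case False
          then have t: "t = x" using st by simp
          have "F (f s) - F (f x) - D x (f s - f x) = - (F (f t) - F (f s) - D x (f t - f s))"
            using linear_diff[OF lin[OF x]] by (simp add: t)
          then have "norm (F (f t) - F (f s) - D x (f t - f s)) = norm (F (f s) - F (f x) - D x (f s - f x))"
            by (metis norm_minus_cancel)
          then show ?thesis using part[of s] st t by (auto simp: dist_real_def norm_minus_commute[of "f s"])
        qed
        also have "\<dots> \<le> \<epsilon> / 2 * (G t - G s)"
          using f_diff[of s t] st \<epsilon> by (intro mult_left_mono) auto
        finally have 1: "norm (F (f t) - F (f s) - D x (f t - f s)) \<le> \<epsilon> / 2 * (G t - G s)" .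
        have "norm (integral {s..t} (\<lambda>y. D y (g y) - D x (g y))) \<le> integral {s..t} (\<lambda>y. \<epsilon> / 2 * norm (g y))"
        proof (rule integral_norm_bound_integral)
          show "(\<lambda>y. D y (g y) - D x (g y)) integrable_on {s..t}"
            using Ds intDx by (rule integrable_diff)
          show "(\<lambda>y. \<epsilon> / 2 * norm (g y)) integrable_on {s..t}"
            using st by (intro integrable_on_mult_right integrable_on_subinterval[OF ng]) auto
          show "norm (D y (g y) - D x (g y)) \<le> \<epsilon> / 2 * norm (g y)" if "y \<in> {s..t}" for y
            using that st by (intro d3') (auto simp: dist_real_def)
        qed
        also have "\<dots> = \<epsilon> / 2 * (G t - G s)"
          using G_diff[of s t] st by simp
        finally have 2: "norm (integral {s..t} (\<lambda>y. D y (g y) - D x (g y))) \<le> \<epsilon> / 2 * (G t - G s)" .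
        show ?thesis unfolding eq using 1 2 norm_triangle_ineq4 by (smt (verit) field_sum_of_halves distrib_right)
      qed
      show ?case
      proof (intro exI[of _ "min d2 d3"] conjI allI impI)
        show "0 < min d2 d3" using d2 d3 by simp
        fix s t assume st: "s \<le> x \<and> x \<le> t \<and> t - s < min d2 d3" "u \<le> s" "t \<le> v"
        have "norm (H t - H s) \<le> norm (H t - H x) + norm (H x - H s)"
          by (metis norm_triangle_ineq diff_add_cancel add_diff_eq)
        also have "\<dots> \<le> \<epsilon> * (G t - G x) + \<epsilon> * (G x - G s)"
          using st uv by (intro add_mono half) auto
        finally show "norm (H t - H s) \<le> \<epsilon> * (G t - G s)" by (simp add: algebra_simps)
      qed
    qed
    then show ?thesis by simp
  qed
  have "H x = H a" if x: "x \<in> {a..b}" for x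
  proof (rule ccontr)
    assume ne: "H x \<noteq> H a"
    have "G x \<ge> 0" unfolding G_def by (rule integral_nonneg) (use x in \<open>auto intro: integrable_on_subinterval[OF ng]\<close>)
    \<comment> \<open>This choice makes the bound \<epsilon> * G x at most half of the quantity it
      is supposed to dominate; the added 1 avoids division by zero.\<close>
    define \<epsilon> where "\<epsilon> = norm (H x - H a) / (2 * (G x + 1))"
    have "\<epsilon> > 0" using ne \<open>G x \<ge> 0\<close> by (simp add: \<epsilon>_def)
    have "norm (H x - H a) \<le> \<epsilon> * G x"
      using H_diff[OF \<open>\<epsilon> > 0\<close>, of a x] x by (simp add: G_def)
    also have "\<dots> \<le> \<epsilon> * (G x + 1)" using \<open>\<epsilon> > 0\<close> by simp
    also have "\<epsilon> * (G x + 1) = norm (H x - H a) / 2"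
      using \<open>G x \<ge> 0\<close> by (simp add: \<epsilon>_def field_simps)
    also have "\<dots> < norm (H x - H a)" using ne by simp
    finally show False by simp
  qed
  moreover have "H a = F (f a)" by (simp add: H_def)
  ultimately have "F (f x) - integral {a..x} (\<lambda>x. D x (g x)) = F (f a)" if "x \<in> {a..b}" for x
    using that unfolding H_def by metis
  then show ?thesis using int unfolding primitive_on_def diff_eq_eq by blast
qed

section \<open>Sobolev functions on the interval\<close>

lemma primitive_on_cong:
  assumes "\<And>x. x \<in> {a..b} \<Longrightarrow> f x = F x" "primitive_on a b F g"
  shows "primitive_on a b f g"
  unfolding primitive_on_def
proof (intro conjI ballI)
  show "g absolutely_integrable_on {a..b}" by (rule primitive_onD[OF assms(2)])
  fix x assume x: "x \<in> {a..b}"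
  then have "f a = F a" using assms(1) by auto
  then show "f x = f a + integral {a..x} g" using primitive_onD(3)[OF assms(2) x] assms(1)[OF x] by metis
qed

lemma primitive_on_linear:
  assumes "bounded_linear L" and f: "primitive_on a b f g"
  shows "primitive_on a b (\<lambda>x. L (f x)) (\<lambda>x. L (g x))"
proof -
  have "L (f x) = L (f a) + integral {a..x} (\<lambda>x. L (g x))" if x: "x \<in> {a..b}" for x
  proof -
    have "g integrable_on {a..x}" using integrable_on_subinterval[OF primitive_onD(2)[OF f], of a x] x by auto
    then have "integral {a..x} (\<lambda>x. L (g x)) = L (integral {a..x} g)"
      using integral_linear[OF _ assms(1)] by (simp add: o_def)
    moreover have "L (f x) = L (f a + integral {a..x} g)" using primitive_onD(3)[OF f x] by simp
    ultimately show ?thesis using linear_add[OF bounded_linear.linear[OF assms(1)]] by simp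
  qed
  then show ?thesis
    using absolutely_integrable_linear[OF primitive_onD(1)[OF f] assms(1)] unfolding primitive_on_def o_def by blast
qed

lemma primitive_on_add:
  assumes f: "primitive_on a b f g" and u: "primitive_on a b u v"
  shows "primitive_on a b (\<lambda>x. f x + u x) (\<lambda>x. g x + v x)"
proof -
  have "f x + u x = f a + u a + integral {a..x} (\<lambda>x. g x + v x)" if x: "x \<in> {a..b}" for x
  proof -
    have "g integrable_on {a..x}" "v integrable_on {a..x}"
      using integrable_on_subinterval[OF primitive_onD(2)[OF f], of a x] 
        integrable_on_subinterval[OF primitive_onD(2)[OF u], of a x] x by auto
    then have "integral {a..x} (\<lambda>x. g x + v x) = integral {a..x} g + integral {a..x} v"
      by (rule Henstock_Kurzweil_Integration.integral_add)
    then show ?thesis using primitive_onD(3)[OF f x] primitive_onD(3)[OF u x] by simp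
  qed
  moreover have "(\<lambda>x. g x + v x) absolutely_integrable_on {a..b}"
    using primitive_onD(1)[OF f] primitive_onD(1)[OF u] by (rule set_integral_add)
  ultimately show ?thesis unfolding primitive_on_def by blast
qed

lemma primitive_on_Pair:
  assumes "primitive_on a b f g" and "primitive_on a b u v"
  shows "primitive_on a b (\<lambda>x. (f x, u x)) (\<lambda>x. (g x, v x))"
proof -
  have "bounded_linear (\<lambda>y. (y, 0))" "bounded_linear (\<lambda>y. (0, y))"
    by (auto intro!: bounded_linear_Pair bounded_linear_ident bounded_linear_zero)
  then show ?thesis
    using primitive_on_add[OF primitive_on_linear[OF _ assms(1)] primitive_on_linear[OF _ assms(2)],
        of "\<lambda>y. (y, 0)" "\<lambda>y. (0, y)"] by simp
qed

text \<open>The product rule is the chain rule for the map \<open>B (fst z) (snd z)\<close> along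
  the pair of both functions.\<close>

lemma primitive_on_bilinear:
  assumes B: "bounded_bilinear B" and f: "primitive_on a b f g" and u: "primitive_on a b u v"
  shows "primitive_on a b (\<lambda>x. B (f x) (u x)) (\<lambda>x. B (f x) (v x) + B (g x) (u x))"
proof -
  have "primitive_on a b (\<lambda>x. (\<lambda>z. B (fst z) (snd z)) (f x, u x))
     (\<lambda>x. (\<lambda>h. B (f x) (snd h) + B (fst h) (u x)) (g x, v x))"
  proof (rule primitive_on_chain[OF primitive_on_Pair[OF f u]])
    show "((\<lambda>z. B (fst z) (snd z)) has_derivative (\<lambda>h. B (f x) (snd h) + B (fst h) (u x))) (at (f x, u x))" for x
      using bounded_bilinear.FDERIV[OF B has_derivative_fst[OF has_derivative_ident] has_derivative_snd[OF has_derivative_ident], of "(f x, u x)" UNIV]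
      by simp
    show "continuous_on {a..b} (\<lambda>x. B (f x) (snd i) + B (fst i) (u x))" for i
      by (intro continuous_intros bounded_bilinear.continuous_on[OF B] primitive_on_continuous[OF f] primitive_on_continuous[OF u])
  qed
  then show ?thesis by simp
qed

lemmas primitive_on_inner = primitive_on_bilinear[OF bounded_bilinear_inner]
lemmas primitive_on_scaleR = primitive_on_bilinear[OF bounded_bilinear_scaleR]

section \<open>From equality almost everywhere to pointwise equality\<close>

lemma AE_lebesgue_on_negligible:
  assumes "AE x in lebesgue_on X. P x" "X \<in> sets lebesgue"
  obtains N where "negligible N" "\<And>x. x \<in> X \<Longrightarrow> x \<notin> N \<Longrightarrow> P x"
proof -
  have "AE x in lebesgue. x \<in> X \<longrightarrow> P x" using assms by (simp add: AE_lebesgue_on_iff)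
  then obtain N where "\<And>x. x \<in> space lebesgue - N \<Longrightarrow> x \<in> X \<longrightarrow> P x" "N \<in> null_sets lebesgue"
    by (rule AE_E3) blast
  then show thesis by (intro that[of N]) (auto simp: negligible_iff_null_sets)
qed

text \<open>A continuous \<open>h\<close> is the derivative of its indefinite integral, which is
  identically zero when \<open>h\<close> vanishes off a negligible set. The condition
  \<open>a < b\<close> makes one-sided derivatives at the end points unique.\<close>

lemma continuous_AE_eq_0:
  fixes h :: "real \<Rightarrow> 'a::euclidean_space"
  assumes "a < b" "continuous_on {a..b} h" "AE x in lebesgue_on {a..b}. h x = 0" "x \<in> {a..b}"
  shows "h x = 0"
proof -
  obtain N where N: "negligible N" "\<And>x. x \<in> {a..b} \<Longrightarrow> x \<notin> N \<Longrightarrow> h x = 0"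
    using AE_lebesgue_on_negligible[OF assms(3)] by auto
  have "((\<lambda>x. integral {a..x} h) has_vector_derivative h x) (at x within {a..b})"
    by (rule integral_has_vector_derivative[OF assms(2,4)])
  moreover have "integral {a..y} h = 0" if "y \<in> {a..b}" for y
  proof -
    have "integral {a..y} h = integral {a..y} (\<lambda>_. 0 :: 'a)"
      by (rule integral_spike[OF N(1)]) (use N(2) that in auto)
    then show ?thesis by simp
  qed
  ultimately have "((\<lambda>x. 0) has_vector_derivative h x) (at x within {a..b})"
    using assms(4) by (rule_tac has_vector_derivative_transform[of x "{a..b}" "\<lambda>_. 0"]) auto
  then show ?thesis
    using vector_derivative_unique_within_closed_interval[of a b x "\<lambda>_. 0" "h x" 0] assms by auto
qed

lemma continuous_AE_eq:
  fixes f g :: "real \<Rightarrow> 'a::euclidean_space"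
  assumes "a < b" "continuous_on {a..b} f" "continuous_on {a..b} g" "AE x in lebesgue_on {a..b}. f x = g x" "x \<in> {a..b}"
  shows "f x = g x"
  using continuous_AE_eq_0[of a b "\<lambda>x. f x - g x" x] assms by (auto intro: continuous_on_diff)

abbreviation MI :: "real measure" where "MI \<equiv> lebesgue_on I2pi"

lemma finite_measure_MI: "finite_measure MI"
  by (simp add: finite_measure_lebesgue_on)

lemma continuous_measurable_MI: "continuous_on I2pi f \<Longrightarrow> f \<in> borel_measurable MI"
  by (intro continuous_imp_measurable_on_sets_lebesgue) auto

lemma continuous_integrable_MI:
  fixes f :: "real \<Rightarrow> 'a::euclidean_space"
  shows "continuous_on I2pi f \<Longrightarrow> integrable MI f"
  by (simp add: integrable_lebesgue_on_iff absolutely_integrable_continuous_real)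

lemma L2_integrable: 
  assumes "f \<in> L2" shows "integrable MI f"
proof (rule Bochner_Integration.integrable_bound)
  interpret finite_measure MI by (rule finite_measure_MI)
  show "integrable MI (\<lambda>x. 1 + (norm (f x))\<^sup>2)" using assms by (simp add: L2_def)
  show "f \<in> borel_measurable MI" using assms by (simp add: L2_def)
  have "norm (f x) \<le> 1 + (norm (f x))\<^sup>2" for x
    using zero_le_power2[of "norm (f x) - 1"] by (simp add: power2_diff) (smt (verit) norm_ge_zero zero_le_power2)
  then show "AE x in MI. norm (f x) \<le> norm (1 + (norm (f x))\<^sup>2)" by simp
qed

lemma continuous_L2: "continuous_on I2pi f \<Longrightarrow> f \<in> L2"
  by (simp add: L2_def continuous_measurable_MI continuous_integrable_MI continuous_intros)

lemma primitive_on_L2: "primitive_on 0 (2*pi) f g \<Longrightarrow> f \<in> L2"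
  by (intro continuous_L2 primitive_on_continuous)

section \<open>Weak derivatives and primitives\<close>

lemma test_function_primitive:
  "test_function \<phi> \<Longrightarrow> primitive_on 0 (2*pi) \<phi> (deriv \<phi>)"
  by (intro primitive_on_vector_derivative test_function_continuous test_function_deriv)
     (auto intro: has_field_derivative_at_within test_function_has_derivative simp flip: has_real_derivative_iff_has_vector_derivative)

lemma test_function_lincomb:
  assumes "test_function \<phi>" "test_function \<psi>"
  shows "test_function (\<lambda>x. \<phi> x - r * \<psi> x)"
proof -
  have deriv: "((deriv ^^ n) \<phi> has_field_derivative (deriv ^^ Suc n) \<phi> x) (at x)" if "test_function \<phi>" for \<phi> n x
    using that by (simp add: test_function_def DERIV_deriv_iff_field_differentiable)
  have comb: "((\<lambda>x. (deriv ^^ n) \<phi> x - r * (deriv ^^ n) \<psi> x) has_field_derivative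
      (deriv ^^ Suc n) \<phi> x - r * (deriv ^^ Suc n) \<psi> x) (at x)" for n x
    by (intro DERIV_diff DERIV_cmult deriv assms)
  have iter: "(deriv ^^ n) (\<lambda>x. \<phi> x - r * \<psi> x) = (\<lambda>x. (deriv ^^ n) \<phi> x - r * (deriv ^^ n) \<psi> x)" for n
  proof (induction n)
    case (Suc n)
    then show ?case using DERIV_imp_deriv[OF comb[of n]] by (auto simp del: funpow.simps(2) simp add: funpow.simps(2)[of n deriv])
  qed simp
  have "((deriv ^^ n) (\<lambda>x. \<phi> x - r * \<psi> x)) field_differentiable (at x)" for n x
    using comb[of n x] unfolding iter by (auto simp: field_differentiable_def)
  moreover obtain a b where ab: "0 < a" "a < b" "b < 2 * pi" "\<And>x. x \<notin> {a..b} \<Longrightarrow> \<phi> x = 0"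
    using test_function_support[OF assms(1)] by metis
  moreover obtain c d where cd: "0 < c" "c < d" "d < 2 * pi" "\<And>x. x \<notin> {c..d} \<Longrightarrow> \<psi> x = 0"
    using test_function_support[OF assms(2)] by metis
  moreover have "\<phi> x - r * \<psi> x = 0" if "x \<notin> {min a c..max b d}" for x
  proof -
    have "x \<notin> {a..b}" "x \<notin> {c..d}" using that by auto
    then show ?thesis using ab(4)[of x] cd(4)[of x] by simp
  qed
  ultimately show ?thesis
    by (intro test_functionI[of _ "min a c" "max b d"]) auto
qed

lemma test_function_integrable_scaleR:
  fixes f :: "real \<Rightarrow> 'a::euclidean_space"
  assumes "test_function \<phi>" "integrable MI f"
  shows "integrable MI (\<lambda>x. \<phi> x *\<^sub>R f x)"
proof -
  have "(\<lambda>x. \<phi> x *\<^sub>R f x) absolutely_integrable_on I2pi"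
  proof (rule absolutely_integrable_bounded_measurable_product[where h="(*\<^sub>R)"])
    show "bilinear ((*\<^sub>R) :: real \<Rightarrow> 'a \<Rightarrow> 'a)" by (simp add: bilinear_def linear_iff algebra_simps)
    show "bounded (\<phi> ` I2pi)"
      by (intro compact_imp_bounded compact_continuous_image test_function_continuous assms) auto
  qed (use assms in \<open>auto intro: continuous_measurable_MI test_function_continuous simp: integrable_lebesgue_on_iff\<close>)
  then show ?thesis by (simp add: integrable_lebesgue_on_iff)
qed

lemma integration_by_parts_test_function:
  assumes f: "primitive_on 0 (2*pi) f g" and \<phi>: "test_function \<phi>"
  shows "(LINT x|MI. deriv \<phi> x *\<^sub>R f x) = - (LINT x|MI. \<phi> x *\<^sub>R g x)"
proof -
  have g: "integrable MI g" using primitive_onD(1)[OF f] by (simp add: integrable_lebesgue_on_iff)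
  have i1: "integrable MI (\<lambda>x. \<phi> x *\<^sub>R g x)" by (rule test_function_integrable_scaleR[OF \<phi> g])
  have i2: "integrable MI (\<lambda>x. deriv \<phi> x *\<^sub>R f x)"
    by (intro test_function_integrable_scaleR test_function_deriv \<phi> continuous_integrable_MI primitive_on_continuous[OF f])
  obtain a b where "0 < a" "a < b" "b < 2 * pi" "\<And>x. x \<notin> {a..b} \<Longrightarrow> \<phi> x = 0"
    using test_function_support[OF \<phi>] by metis
  then have ends: "\<phi> 0 = 0" "\<phi> (2 * pi) = 0" by auto
  have p: "primitive_on 0 (2*pi) (\<lambda>x. \<phi> x *\<^sub>R f x) (\<lambda>x. \<phi> x *\<^sub>R g x + deriv \<phi> x *\<^sub>R f x)"
    by (rule primitive_on_scaleR[OF test_function_primitive[OF \<phi>] f])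
  have "integral I2pi (\<lambda>x. \<phi> x *\<^sub>R g x + deriv \<phi> x *\<^sub>R f x) = 0"
    using primitive_onD(3)[OF p, of "2*pi"] ends by simp
  then have "(LINT x|MI. \<phi> x *\<^sub>R g x + deriv \<phi> x *\<^sub>R f x) = 0"
    using lebesgue_integral_eq_integral[OF Bochner_Integration.integrable_add[OF i1 i2]] by simp
  then show ?thesis using i1 i2 by (simp add: add_eq_0_iff)
qed

lemma primitive_on_has_weak_deriv:
  assumes "primitive_on 0 (2*pi) f g" "g \<in> L2"
  shows "has_weak_deriv 1 f g"
  using assms primitive_on_L2 integration_by_parts_test_function
  by (auto simp: has_weak_deriv_def)

lemma has_weak_deriv_unique:
  assumes "has_weak_deriv l f g" "has_weak_deriv l f h"
  shows "AE x in MI. g x = h x"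
proof -
  have gh: "integrable MI g" "integrable MI h" using assms by (auto simp: has_weak_deriv_def L2_integrable)
  have "AE x in MI. g x - h x = 0"
  proof (rule fundamental_lemma_variations)
    fix \<phi> :: "real \<Rightarrow> real" assume \<phi>: "test_function \<phi>"
    have "(- 1) ^ l *\<^sub>R (LINT x|MI. \<phi> x *\<^sub>R g x) = (- 1) ^ l *\<^sub>R (LINT x|MI. \<phi> x *\<^sub>R h x)"
      using assms \<phi> by (simp add: has_weak_deriv_def)
    then have "(LINT x|MI. \<phi> x *\<^sub>R g x) = (LINT x|MI. \<phi> x *\<^sub>R h x)" by simp
    then show "(LINT x|MI. \<phi> x *\<^sub>R (g x - h x)) = 0"
      using Bochner_Integration.integral_diff[OF test_function_integrable_scaleR[OF \<phi> gh(1)] test_function_integrable_scaleR[OF \<phi> gh(2)]]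
      by (simp add: scaleR_diff_right)
  qed (use gh in simp)
  then show ?thesis by simp
qed

lemma has_weak_deriv_0: "f \<in> L2 \<Longrightarrow> has_weak_deriv 0 f f"
  by (simp add: has_weak_deriv_def)

text \<open>Fix a test function \<open>\<psi>0\<close> with nonzero integral. Any test function
  minus the right multiple of \<open>\<psi>0\<close> has mean zero, hence is the derivative of a
  test function and is annihilated by \<open>u\<close>. So \<open>u\<close> acts on test functions
  like the constant \<open>c\<close>, its average weighted by \<open>\<psi>0\<close>.\<close>

lemma du_Bois_Reymond:
  fixes u :: "real \<Rightarrow> 'a::euclidean_space"
  assumes u: "integrable MI u"
    and zero: "\<And>\<phi>. test_function \<phi> \<Longrightarrow> (LINT x|MI. deriv \<phi> x *\<^sub>R u x) = 0"
  obtains c where "AE x in MI. u x = c"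
proof -
  interpret finite_measure MI by (rule finite_measure_MI)
  obtain \<phi> where \<phi>: "\<And>n. test_function (\<phi> n)" "\<And>n x. 0 \<le> \<phi> n x" "\<And>n x. \<phi> n x \<le> 1"
    "\<And>x. (\<lambda>n. \<phi> n x) \<longlonglongrightarrow> indicator {0<..<2*pi} x"
    by (rule test_functions_approximate_indicator[of "2*pi"]) (simp, simp, blast)
  have test_int: "integrable MI \<psi>" if "test_function \<psi>" for \<psi>
    using that by (intro continuous_integrable_MI test_function_continuous)
  \<comment> \<open>The integrals of the approximations tend to 2*pi, so one of them is
    nonzero.\<close>
  obtain n where n: "integral I2pi (\<phi> n) \<noteq> 0"
  proof -
    have [measurable]: "{0<..<2*pi} \<in> sets MI" by (auto simp: sets_restrict_space_iff)
    have [measurable]: "\<phi> n \<in> borel_measurable MI" for n using test_int[OF \<phi>(1)] by simp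
    have "(\<lambda>n. LINT x|MI. \<phi> n x) \<longlonglongrightarrow> (LINT x|MI. indicator {0<..<2*pi} x)"
      by (rule integral_dominated_convergence[where w="\<lambda>_. 1"]) (use \<phi> in auto)
    moreover have "(LINT x|MI. indicator {0<..<2*pi} x :: real) = 2 * pi"
    proof -
      have "{0<..<2*pi} \<inter> I2pi = {0<..<2*pi}" by auto
      moreover have "measure MI {0<..<2*pi} = measure lebesgue {0<..<2*pi}"
        by (rule measure_restrict_space) auto
      ultimately show ?thesis by simp
    qed
    ultimately have "(\<lambda>n. LINT x|MI. \<phi> n x) \<longlonglongrightarrow> 2 * pi" by simp
    then have "\<exists>n. (LINT x|MI. \<phi> n x) \<noteq> 0"
    proof (rule contrapos_pp)
      assume "\<not> (\<exists>n. (LINT x|MI. \<phi> n x) \<noteq> 0)"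
      then have "(\<lambda>n. LINT x|MI. \<phi> n x) = (\<lambda>n. 0)" by simp
      then show "\<not> (\<lambda>n. LINT x|MI. \<phi> n x) \<longlonglongrightarrow> 2 * pi" by (simp add: LIMSEQ_const_iff)
    qed
    then show thesis using that test_int[OF \<phi>(1)] by (auto simp: lebesgue_integral_eq_integral)
  qed
  define \<psi>0 where "\<psi>0 = \<phi> n"
  have \<psi>0: "test_function \<psi>0" "integral I2pi \<psi>0 \<noteq> 0" using \<phi> n by (auto simp: \<psi>0_def)
  define c where "c = (LINT x|MI. \<psi>0 x *\<^sub>R u x) /\<^sub>R integral I2pi \<psi>0"
  have "AE x in MI. u x - c = 0"
  proof (rule fundamental_lemma_variations)
    show "integrable MI (\<lambda>x. u x - c)" using u by simp
    fix \<psi> assume \<psi>: "test_function \<psi>"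
    define r where "r = integral I2pi \<psi> / integral I2pi \<psi>0"
    have I: "\<psi> integrable_on I2pi" "\<psi>0 integrable_on I2pi"
      using test_int[OF \<psi>] test_int[OF \<psi>0(1)] by (auto intro: integrable_on_lebesgue_on)
    have comb: "test_function (\<lambda>x. \<psi> x - r * \<psi>0 x)"
      by (rule test_function_lincomb[OF \<psi> \<psi>0(1)])
    have "integral I2pi (\<lambda>x. \<psi> x - r * \<psi>0 x) = 0"
    proof -
      have "(\<lambda>x. r * \<psi>0 x) integrable_on I2pi" using I(2) by (rule integrable_on_mult_right)
      then have "integral I2pi (\<lambda>x. \<psi> x - r * \<psi>0 x) = integral I2pi \<psi> - r * integral I2pi \<psi>0"
        by (simp add: Henstock_Kurzweil_Integration.integral_diff[OF I(1)])
      then show ?thesis using \<psi>0(2) by (simp add: r_def)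
    qed
    then obtain \<Psi> where "test_function \<Psi>" "deriv \<Psi> = (\<lambda>x. \<psi> x - r * \<psi>0 x)"
      using test_function_antiderivative[OF comb] by metis
    then have "(LINT x|MI. (\<psi> x - r * \<psi>0 x) *\<^sub>R u x) = 0" using zero by metis
    then have "(LINT x|MI. \<psi> x *\<^sub>R u x) = r *\<^sub>R (LINT x|MI. \<psi>0 x *\<^sub>R u x)"
      using test_function_integrable_scaleR[OF \<psi> u] test_function_integrable_scaleR[OF \<psi>0(1) u]
      by (simp add: scaleR_diff_left flip: scaleR_scaleR)
    also have "\<dots> = integral I2pi \<psi> *\<^sub>R c" by (simp add: r_def c_def divide_inverse_commute)
    also have "\<dots> = (LINT x|MI. \<psi> x *\<^sub>R c)"
      using test_int[OF \<psi>] by (simp add: lebesgue_integral_eq_integral)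
    finally show "(LINT x|MI. \<psi> x *\<^sub>R (u x - c)) = 0"
      using test_function_integrable_scaleR[OF \<psi>, of u] test_function_integrable_scaleR[OF \<psi>, of "\<lambda>_. c"] u
      by (simp add: scaleR_diff_right)
  qed
  then show thesis using that by simp
qed

text \<open>The indefinite integral of \<open>g\<close> has weak derivative \<open>g\<close> too, so
  its difference from \<open>f\<close> has weak derivative zero and is a.e. constant.\<close>

lemma has_weak_deriv_1_primitive:
  assumes "has_weak_deriv 1 f g"
  obtains F where "primitive_on 0 (2*pi) F g" "AE x in MI. f x = F x"
proof -
  have fg: "integrable MI f" "integrable MI g" using assms by (auto simp: has_weak_deriv_def L2_integrable)
  define G where "G x = integral {0..x} g" for x
  have G: "primitive_on 0 (2*pi) G g"
    using fg by (simp add: primitive_on_def G_def integrable_lebesgue_on_iff)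
  have "integrable MI (\<lambda>x. f x - G x)"
    using fg primitive_on_continuous[OF G] by (simp add: continuous_integrable_MI)
  moreover have "(LINT x|MI. deriv \<phi> x *\<^sub>R (f x - G x)) = 0" if \<phi>: "test_function \<phi>" for \<phi>
  proof -
    have "(LINT x|MI. deriv \<phi> x *\<^sub>R f x) = - (LINT x|MI. \<phi> x *\<^sub>R g x)"
      using assms \<phi> by (simp add: has_weak_deriv_def)
    also have "\<dots> = (LINT x|MI. deriv \<phi> x *\<^sub>R G x)"
      using integration_by_parts_test_function[OF G \<phi>] by simp
    finally show ?thesis
      using Bochner_Integration.integral_diff[OF test_function_integrable_scaleR[OF test_function_deriv[OF \<phi>] fg(1)]
          test_function_integrable_scaleR[OF test_function_deriv[OF \<phi>]
            continuous_integrable_MI[OF primitive_on_continuous[OF G]]]]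
      by (simp add: scaleR_diff_right)
  qed
  ultimately obtain c where c: "AE x in MI. f x - G x = c" using du_Bois_Reymond by blast
  have "primitive_on 0 (2*pi) (\<lambda>x. G x + c) g"
    using primitive_onD(1)[OF G] by (simp add: primitive_on_def G_def)
  moreover have "AE x in MI. f x = G x + c" using c by eventually_elim (simp add: algebra_simps)
  ultimately show thesis by (rule that)
qed

lemma has_weak_deriv_AE_cong:
  assumes "has_weak_deriv l f g" "f' \<in> L2" "g' \<in> L2" "AE x in MI. f x = f' x" "AE x in MI. g x = g' x"
  shows "has_weak_deriv l f' g'"
proof -
  have "(LINT x|MI. (deriv ^^ l) \<phi> x *\<^sub>R f' x) = (- 1) ^ l *\<^sub>R (LINT x|MI. \<phi> x *\<^sub>R g' x)" if \<phi>: "test_function \<phi>" for \<phi>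
  proof -
    have test: "test_function ((deriv ^^ k) \<phi>)" for k
      by (induction k) (auto simp: \<phi> test_function_deriv)
    have m: "(\<lambda>x. \<psi> x *\<^sub>R h x) \<in> borel_measurable MI" if "test_function \<psi>" "h \<in> L2" for \<psi> and h :: "real \<Rightarrow> real ^ 'a"
      using test_function_integrable_scaleR[OF that(1) L2_integrable[OF that(2)]] by simp
    have "f \<in> L2" "g \<in> L2" using assms(1) by (auto simp: has_weak_deriv_def)
    have "(LINT x|MI. (deriv ^^ l) \<phi> x *\<^sub>R f' x) = (LINT x|MI. (deriv ^^ l) \<phi> x *\<^sub>R f x)"
    proof (intro integral_cong_AE m test assms \<open>f \<in> L2\<close>)
      show "AE x in MI. (deriv ^^ l) \<phi> x *\<^sub>R f' x = (deriv ^^ l) \<phi> x *\<^sub>R f x"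
        using assms(4) by eventually_elim simp
    qed
    also have "\<dots> = (- 1) ^ l *\<^sub>R (LINT x|MI. \<phi> x *\<^sub>R g x)"
      using assms(1) \<phi> by (simp add: has_weak_deriv_def)
    also have "(LINT x|MI. \<phi> x *\<^sub>R g x) = (LINT x|MI. \<phi> x *\<^sub>R g' x)"
    proof (intro integral_cong_AE m \<phi> assms \<open>g \<in> L2\<close>)
      show "AE x in MI. \<phi> x *\<^sub>R g x = \<phi> x *\<^sub>R g' x"
        using assms(5) by eventually_elim simp
    qed
    finally show ?thesis .
  qed
  then show ?thesis using assms by (simp add: has_weak_deriv_def)
qed

text \<open>All dealings with the arbitrary choice in \<open>wderiv\<close> end here. Weak
  derivatives agree a.e., and continuous functions that agree a.e. on the interval agree everywhere
  on it; this turns chosen pointwise values into known ones.\<close>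

lemma wderiv_weak_deriv:
  assumes "has_weak_deriv l f g"
  shows "has_weak_deriv l f (wderiv l f)" "AE x in MI. wderiv l f x = g x"
    and "continuous_on I2pi g \<Longrightarrow> continuous_on I2pi (wderiv l f)"
    and "continuous_on I2pi g \<Longrightarrow> x \<in> I2pi \<Longrightarrow> wderiv l f x = g x"
proof -
  have "\<exists>g. has_weak_deriv l f g \<and> ((\<exists>h. has_weak_deriv l f h \<and> continuous_on I2pi h) \<longrightarrow> continuous_on I2pi g)"
    using assms by blast
  from someI_ex[OF this] have w: "has_weak_deriv l f (wderiv l f)"
    "\<exists>h. has_weak_deriv l f h \<and> continuous_on I2pi h \<Longrightarrow> continuous_on I2pi (wderiv l f)"
    unfolding wderiv_def by blast+
  show "has_weak_deriv l f (wderiv l f)" by fact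
  show ae: "AE x in MI. wderiv l f x = g x" using has_weak_deriv_unique[OF w(1) assms] .
  show c: "continuous_on I2pi (wderiv l f)" if "continuous_on I2pi g" using w(2) assms that by blast
  show "wderiv l f x = g x" if "continuous_on I2pi g" "x \<in> I2pi"
    using continuous_AE_eq[OF _ c that(1) ae that(2)] that by simp
qed

lemma Hper_1_iff:
  "\<eta> \<in> Hper 1 \<longleftrightarrow> (\<exists>g. primitive_on 0 (2*pi) \<eta> g \<and> g \<in> L2) \<and> \<eta> 0 = \<eta> (2*pi)"
proof -
  have end0: "wderiv 0 \<eta> 0 = \<eta> 0" "wderiv 0 \<eta> (2*pi) = \<eta> (2*pi)" if "continuous_on I2pi \<eta>"
    using wderiv_weak_deriv(4)[OF has_weak_deriv_0[OF continuous_L2[OF that]] that] by auto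
  show ?thesis
  proof
    assume H: "\<eta> \<in> Hper 1"
    then have c: "continuous_on I2pi \<eta>" and "wderiv 0 \<eta> 0 = wderiv 0 \<eta> (2*pi)" and "\<eta> \<in> H 1"
      by (auto simp: Hper_def)
    then obtain g where g: "has_weak_deriv 1 \<eta> g" by (auto simp: H_def)
    then obtain F where F: "primitive_on 0 (2*pi) F g" "AE x in MI. \<eta> x = F x"
      by (rule has_weak_deriv_1_primitive)
    have "\<eta> x = F x" if "x \<in> I2pi" for x
      by (rule continuous_AE_eq[OF _ c primitive_on_continuous[OF F(1)] F(2) that]) simp
    then have "primitive_on 0 (2*pi) \<eta> g"
      using F(1) primitive_on_cong by blast
    then show "(\<exists>g. primitive_on 0 (2*pi) \<eta> g \<and> g \<in> L2) \<and> \<eta> 0 = \<eta> (2*pi)"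
      using g end0[OF c] \<open>wderiv 0 \<eta> 0 = _\<close> by (auto simp: has_weak_deriv_def)
  next
    assume "(\<exists>g. primitive_on 0 (2*pi) \<eta> g \<and> g \<in> L2) \<and> \<eta> 0 = \<eta> (2*pi)"
    then obtain g where g: "primitive_on 0 (2*pi) \<eta> g" "g \<in> L2" "\<eta> 0 = \<eta> (2*pi)" by blast
    have c: "continuous_on I2pi \<eta>" by (rule primitive_on_continuous[OF g(1)])
    have "\<exists>g. has_weak_deriv l \<eta> g" if "l \<le> 1" for l
      using that primitive_on_has_weak_deriv[OF g(1,2)] has_weak_deriv_0[OF continuous_L2[OF c]]
      by (cases l) auto
    then show "\<eta> \<in> Hper 1" using c end0[OF c] g(3) by (auto simp: Hper_def H_def)
  qed
qed

lemma Hper_2_iff: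
  "\<gamma> \<in> Hper 2 \<longleftrightarrow> (\<exists>u v. primitive_on 0 (2*pi) \<gamma> u \<and> primitive_on 0 (2*pi) u v \<and> v \<in> L2 \<and>
     u 0 = u (2*pi)) \<and> \<gamma> 0 = \<gamma> (2*pi)"
proof -
  have end0: "wderiv 0 \<gamma> 0 = \<gamma> 0" "wderiv 0 \<gamma> (2*pi) = \<gamma> (2*pi)" if "continuous_on I2pi \<gamma>"
    using wderiv_weak_deriv(4)[OF has_weak_deriv_0[OF continuous_L2[OF that]] that] by auto
  show ?thesis
  proof
    assume H: "\<gamma> \<in> Hper 2"
    then have c: "continuous_on I2pi \<gamma>" and per: "wderiv 0 \<gamma> 0 = wderiv 0 \<gamma> (2*pi)" "wderiv 1 \<gamma> 0 = wderiv 1 \<gamma> (2*pi)"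
      and "\<gamma> \<in> H 2"
      by (auto simp: Hper_def)
    then have "\<forall>l\<le>2. \<exists>g. has_weak_deriv l \<gamma> g" by (auto simp: H_def)
    then obtain g v where g: "has_weak_deriv 1 \<gamma> g" and v: "has_weak_deriv 2 \<gamma> v"
      by (meson one_le_numeral order_refl)
    \<comment> \<open>\<open>H 2\<close> supplies the first and the second weak derivative
      separately. Testing the first with \<open>deriv \<phi>\<close> shows that the second is a weak
      derivative of it.\<close>
    have "has_weak_deriv 1 g v"
      unfolding has_weak_deriv_def
    proof (intro conjI allI impI)
      fix \<phi> assume \<phi>: "test_function \<phi>"
      have "(LINT x|MI. deriv (deriv \<phi>) x *\<^sub>R \<gamma> x) = - (LINT x|MI. deriv \<phi> x *\<^sub>R g x)"
        using g test_function_deriv[OF \<phi>] by (simp add: has_weak_deriv_def)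
      moreover have "(LINT x|MI. deriv (deriv \<phi>) x *\<^sub>R \<gamma> x) = (LINT x|MI. \<phi> x *\<^sub>R v x)"
        using v \<phi> by (simp add: has_weak_deriv_def numeral_2_eq_2)
      ultimately show "(LINT x|MI. (deriv ^^ 1) \<phi> x *\<^sub>R g x) = (- 1) ^ 1 *\<^sub>R (LINT x|MI. \<phi> x *\<^sub>R v x)" by simp
    qed (use g v in \<open>auto simp: has_weak_deriv_def\<close>)
    then obtain u where u: "primitive_on 0 (2*pi) u v" "AE x in MI. g x = u x"
      by (rule has_weak_deriv_1_primitive)
    \<comment> \<open>The continuous representative \<open>u\<close> replaces \<open>g\<close>, so
      that the periodicity imposed on \<open>wderiv 1 \<gamma>\<close> becomes a statement about the
      end values of \<open>u\<close>.\<close>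
    have g_u: "has_weak_deriv 1 \<gamma> u"
      using u g by (intro has_weak_deriv_AE_cong[OF g]) (auto simp: has_weak_deriv_def primitive_on_L2)
    then obtain F where F: "primitive_on 0 (2*pi) F u" "AE x in MI. \<gamma> x = F x"
      by (rule has_weak_deriv_1_primitive)
    have "\<gamma> x = F x" if "x \<in> I2pi" for x
      by (rule continuous_AE_eq[OF _ c primitive_on_continuous[OF F(1)] F(2) that]) simp
    then have "primitive_on 0 (2*pi) \<gamma> u"
      using F(1) primitive_on_cong by blast
    moreover have "u 0 = u (2*pi)"
      using wderiv_weak_deriv(4)[OF g_u primitive_on_continuous[OF u(1)]] per(2) by simp
    ultimately show "(\<exists>u v. primitive_on 0 (2*pi) \<gamma> u \<and> primitive_on 0 (2*pi) u v \<and> v \<in> L2 \<and>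
     u 0 = u (2*pi)) \<and> \<gamma> 0 = \<gamma> (2*pi)"
      using v u(1) end0[OF c] per(1) by (auto simp: has_weak_deriv_def)
  next
    assume "(\<exists>u v. primitive_on 0 (2*pi) \<gamma> u \<and> primitive_on 0 (2*pi) u v \<and> v \<in> L2 \<and>
     u 0 = u (2*pi)) \<and> \<gamma> 0 = \<gamma> (2*pi)"
    then obtain u v where g: "primitive_on 0 (2*pi) \<gamma> u" "primitive_on 0 (2*pi) u v" "v \<in> L2"
      "u 0 = u (2*pi)" "\<gamma> 0 = \<gamma> (2*pi)" by blast
    have c: "continuous_on I2pi \<gamma>" "continuous_on I2pi u" using primitive_on_continuous g by blast+
    have d1: "has_weak_deriv 1 \<gamma> u" by (intro primitive_on_has_weak_deriv g continuous_L2 c)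
    have d2: "has_weak_deriv 2 \<gamma> v"
      using primitive_on_has_weak_deriv[OF g(2,3)] d1 test_function_deriv
      by (auto simp: has_weak_deriv_def numeral_2_eq_2)
    have "\<exists>g. has_weak_deriv l \<gamma> g" if "l \<le> 2" for l
      using that d1 d2 has_weak_deriv_0[OF continuous_L2[OF c(1)]]
      by (metis One_nat_def Suc_1 le_SucE le_zero_eq)
    moreover have "wderiv l \<gamma> 0 = wderiv l \<gamma> (2*pi)" if "l < 2" for l
      using that wderiv_weak_deriv(4)[OF d1 c(2)] g end0[OF c(1)] by (cases l) auto
    ultimately show "\<gamma> \<in> Hper 2" using c by (auto simp: Hper_def H_def)
  qed
qed

lemma dx_eq:
  assumes "primitive_on 0 (2*pi) f g"
  shows "continuous_on I2pi g \<Longrightarrow> x \<in> I2pi \<Longrightarrow> dx f x = g x"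
    and "g \<in> L2 \<Longrightarrow> AE x in MI. dx f x = g x"
  using wderiv_weak_deriv(2,4)[OF primitive_on_has_weak_deriv[OF assms]] continuous_L2[of g] by auto

section \<open>The energy in terms of tangent and speed\<close>

lemma J_nth [simp]: "J v $ 1 = - v $ 2" "J v $ 2 = v $ 1"
  by (simp_all add: J_def)

lemma inner_real2: "(v :: real ^ 2) \<bullet> w = v $ 1 * w $ 1 + v $ 2 * w $ 2"
  by (simp add: inner_vec_def sum_2)

lemma J_linear: "bounded_linear J"
  by (intro linear_linear[THEN iffD2] linearI) (auto simp: vec_eq_iff forall_2)

lemma J_scaleR: "J (c *\<^sub>R v) = c *\<^sub>R J v"
  by (simp add: vec_eq_iff forall_2)

lemma J_inner: "J v \<bullet> J w = v \<bullet> w"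
  by (simp add: inner_real2)

lemma norm_J [simp]: "norm (J v) = norm v"
  by (simp add: norm_eq_sqrt_inner J_inner)

lemma J_orthogonal [simp]: "v \<bullet> J v = 0" "J v \<bullet> v = 0"
  by (simp_all add: inner_real2)

lemma continuous_on_J [continuous_intros]: "continuous_on X f \<Longrightarrow> continuous_on X (\<lambda>x. J (f x))"
  by (rule bounded_linear.continuous_on[OF J_linear])

lemma measurable_J [measurable]: "J \<in> borel_measurable borel"
  by (intro borel_measurable_continuous_onI continuous_intros)

lemma tangent_normal_decomposition:
  assumes "norm t = 1"
  shows "v = (v \<bullet> t) *\<^sub>R t + (v \<bullet> J t) *\<^sub>R J t"
proof -
  have t: "t $ 1 * t $ 1 + t $ 2 * t $ 2 = 1" using assms by (simp add: norm_eq_1 inner_real2)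
  have "(v \<bullet> t) * t $ 1 + (v \<bullet> J t) * - t $ 2 = v $ 1 * (t $ 1 * t $ 1 + t $ 2 * t $ 2)"
    "(v \<bullet> t) * t $ 2 + (v \<bullet> J t) * t $ 1 = v $ 2 * (t $ 1 * t $ 1 + t $ 2 * t $ 2)"
    unfolding inner_real2 J_nth by algebra+
  then show ?thesis unfolding t by (simp add: vec_eq_iff forall_2)
qed

lemma norm_tensor: "norm (tensor v w) = norm v * norm w"
proof -
  have "(norm (tensor v w))\<^sup>2 = (norm v * norm w)\<^sup>2"
    unfolding power_mult_distrib power2_norm_eq_inner
    by (simp add: inner_vec_def sum_2 tensor_def algebra_simps)
  then show ?thesis by (simp add: power2_eq_iff_nonneg)
qed

lemma measurable_AE_cong_MI:
  fixes f g :: "real \<Rightarrow> 'a::euclidean_space"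
  assumes f: "f \<in> borel_measurable MI" and eq: "AE x in MI. f x = g x"
  shows "g \<in> borel_measurable MI"
proof -
  have meas: "(\<lambda>x. if x \<in> I2pi then k x else 0) \<in> borel_measurable lebesgue \<longleftrightarrow> k \<in> borel_measurable MI"
    for k :: "real \<Rightarrow> 'a" by (rule borel_measurable_if) simp
  have "(\<lambda>x. if x \<in> I2pi then f x else 0) \<in> borel_measurable lebesgue"
    using f unfolding meas .
  moreover have "AE x in lebesgue. (if x \<in> I2pi then f x else 0) = (if x \<in> I2pi then g x else 0)"
    using eq by (auto simp: AE_lebesgue_on_iff elim: AE_mp)
  ultimately have "(\<lambda>x. if x \<in> I2pi then g x else 0) \<in> borel_measurable lebesgue"
    by (rule borel_measurable_AE)
  then show ?thesis unfolding meas .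
qed

text \<open>Measurability is asked of one side only, the other side inherits it by completeness of
  Lebesgue measure. This suits the energy integrands, which contain definite descriptions and chosen
  representatives.\<close>

lemma integral_AE_cong_MI:
  fixes f g :: "real \<Rightarrow> 'a::euclidean_space"
  assumes "f \<in> borel_measurable MI" "AE x in MI. g x = f x"
  shows "integral\<^sup>L MI g = integral\<^sup>L MI f"
  using assms by (intro integral_cong_AE measurable_AE_cong_MI[OF assms(1)]) (auto elim: AE_mp)

lemma primitive_on_integrable:
  "primitive_on 0 (2*pi) f g \<Longrightarrow> integrable MI g"
  using primitive_onD(1) by (simp add: integrable_lebesgue_on_iff)

lemma primitive_on_measurable:
  assumes "primitive_on 0 (2*pi) f g"
  shows "f \<in> borel_measurable MI" "g \<in> borel_measurable MI"
  using primitive_on_integrable[OF assms] primitive_on_continuous[OF assms] continuous_measurable_MI by auto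

text \<open>The constant |T|^2 is a primitive of 0 and, by the product rule, of 2 T . T'; the
  integrands of two such representations agree a.e.\<close>

lemma unit_primitive_orthogonal:
  assumes T: "primitive_on 0 (2*pi) T T'" and unit: "\<And>x. x \<in> I2pi \<Longrightarrow> norm (T x) = 1"
  shows "AE x in MI. T x \<bullet> T' x = 0"
proof -
  have "primitive_on 0 (2*pi) (\<lambda>x. T x \<bullet> T x) (\<lambda>x. T x \<bullet> T' x + T' x \<bullet> T x)"
    by (rule primitive_on_inner[OF T T])
  moreover have "primitive_on 0 (2*pi) (\<lambda>x. T x \<bullet> T x) (\<lambda>x. 0)"
    by (rule primitive_on_cong[where F="\<lambda>_. 1"]) (auto simp: primitive_on_def unit simp flip: power2_norm_eq_inner)
  ultimately have "AE x in MI. T x \<bullet> T' x + T' x \<bullet> T x = 0" by (rule primitive_on_AE_unique)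
  then show ?thesis by eventually_elim (simp add: inner_commute)
qed

lemma L2_square_integrable: "f \<in> L2 \<Longrightarrow> integrable MI (\<lambda>x. (norm (f x))\<^sup>2)"
  by (simp add: L2_def)

lemma L2_bounded:
  fixes f :: "real \<Rightarrow> real ^ 'n" and g :: "real \<Rightarrow> 'b::euclidean_space"
  assumes "f \<in> borel_measurable MI" "integrable MI (\<lambda>x. (norm (g x))\<^sup>2)" "\<And>x. x \<in> I2pi \<Longrightarrow> norm (f x) \<le> C * norm (g x)"
  shows "f \<in> L2"
proof -
  have "integrable MI (\<lambda>x. (norm (f x))\<^sup>2)"
  proof (rule Bochner_Integration.integrable_bound)
    show "integrable MI (\<lambda>x. C\<^sup>2 * (norm (g x))\<^sup>2)" using assms(2) by simp
    show "(\<lambda>x. (norm (f x))\<^sup>2) \<in> borel_measurable MI" using assms(1) by measurable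
    have "norm ((norm (f x))\<^sup>2) \<le> norm (C\<^sup>2 * (norm (g x))\<^sup>2)" if "x \<in> I2pi" for x
      using power_mono[OF assms(3)[OF that], of 2] by (simp add: power_mult_distrib)
    then show "AE x in MI. norm ((norm (f x))\<^sup>2) \<le> norm (C\<^sup>2 * (norm (g x))\<^sup>2)" by (auto intro: AE_I2)
  qed
  then show ?thesis using assms(1) by (simp add: L2_def)
qed

text \<open>Here \<open>p\<close> is the speed and \<open>T\<close> the unit tangent, so d/ds is
  (1/p) d/dx: the curvature is a.e. (T' . J T)/p and the divergence (\<eta>' . T)/p. Squaring gives
  p^-2, and the line element returns one factor p. The speed is left general, so that the formula
  serves given curves as well as those of constant speed.\<close>

lemma E_LM_eq:
  assumes \<gamma>: "primitive_on 0 (2*pi) \<gamma> u" and u: "continuous_on I2pi u"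
    and fields: "\<forall>x\<in>I2pi. u x = p x *\<^sub>R T x \<and> p x > 0 \<and> norm (T x) = 1"
    and T: "primitive_on 0 (2*pi) T T'" "T' \<in> L2"
    and \<eta>: "primitive_on 0 (2*pi) \<eta> \<eta>'" "\<eta>' \<in> L2"
  shows "E_LM \<delta> lam \<gamma> \<eta> = 1/2 * (LINT x|MI. (T' x \<bullet> J (T x) + \<delta> * (\<eta>' x \<bullet> T x))\<^sup>2 / p x)
     + lam/2 * (LINT x|MI. (norm (\<eta>' x))\<^sup>2 / p x) + (LINT x|MI. p x)"
    and "signed_area \<gamma> = - (1/2) * (LINT x|MI. \<gamma> x \<bullet> J (u x))"
proof -
  have uT: "u x = p x *\<^sub>R T x" and p: "p x > 0" and unit: "norm (T x) = 1" if "x \<in> I2pi" for x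
    using fields that by blast+
  have dx\<gamma>: "dx \<gamma> x = u x" if "x \<in> I2pi" for x by (rule dx_eq(1)[OF \<gamma> u that])
  have norm_u: "norm (u x) = p x" if "x \<in> I2pi" for x using uT p unit that by (simp add: abs_of_pos)
  have tan: "tangent \<gamma> x = T x" if "x \<in> I2pi" for x
    using dx\<gamma>[OF that] norm_u[OF that] uT[OF that] p[OF that] by (simp add: tangent_def ds_def)
  have "primitive_on 0 (2*pi) (tangent \<gamma>) T'" using tan T(1) by (rule primitive_on_cong)
  then have dT: "AE x in MI. dx (tangent \<gamma>) x = T' x" using T(2) by (rule dx_eq(2))
  have d\<eta>: "AE x in MI. dx \<eta> x = \<eta>' x" using \<eta> by (rule dx_eq(2))
  have inI: "AE x in MI. x \<in> I2pi" by (auto intro: AE_I2)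
  have [measurable]: "T \<in> borel_measurable MI" "T' \<in> borel_measurable MI" "\<eta>' \<in> borel_measurable MI"
    using primitive_on_measurable T \<eta> by blast+
  have "(\<lambda>x. norm (u x)) \<in> borel_measurable MI" using u by (intro continuous_measurable_MI continuous_intros)
  then have [measurable]: "p \<in> borel_measurable MI"
    by (rule measurable_AE_cong_MI) (use norm_u in \<open>auto intro: AE_I2\<close>)
  have orth: "AE x in MI. T x \<bullet> T' x = 0"
    by (rule unit_primitive_orthogonal[OF T(1)]) (rule unit)
  have curv: "AE x in MI. curvature \<gamma> x = (T' x \<bullet> J (T x)) / p x"
    using dT orth inI
  proof eventually_elim
    case (elim x)
    \<comment> \<open>Orthogonality makes the equation defining the curvature solvable at
      \<open>x\<close>, and \<open>J (T x) \<noteq> 0\<close> makes its solution unique, so the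
      description denotes this coefficient.\<close>
    have "T' x = (T' x \<bullet> J (T x)) *\<^sub>R J (T x)"
      using tangent_normal_decomposition[OF unit[OF elim(3)], of "T' x"] elim(2) by (simp add: inner_commute)
    then have "ds \<gamma> (tangent \<gamma>) x = ((T' x \<bullet> J (T x)) / p x) *\<^sub>R J (T x)"
      unfolding ds_def dx\<gamma>[OF elim(3)] norm_u[OF elim(3)] elim(1)
      by (metis divide_inverse_commute scaleR_scaleR)
    moreover have "J (T x) \<noteq> 0" using unit[OF elim(3)] norm_J[of "T x"] by force
    ultimately show ?case
      by (auto simp: curvature_def normal_def tan[OF elim(3)])
  qed
  have "curve_integral \<gamma> (\<lambda>x. (curvature \<gamma> x + \<delta> * div_along \<gamma> \<eta> x)\<^sup>2) =
      (LINT x|MI. (T' x \<bullet> J (T x) + \<delta> * (\<eta>' x \<bullet> T x))\<^sup>2 / p x)"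
    unfolding curve_integral_def
  proof (rule integral_AE_cong_MI)
    show "(\<lambda>x. (T' x \<bullet> J (T x) + \<delta> * (\<eta>' x \<bullet> T x))\<^sup>2 / p x) \<in> borel_measurable MI" by measurable
    show "AE x in MI. (curvature \<gamma> x + \<delta> * div_along \<gamma> \<eta> x)\<^sup>2 * norm (dx \<gamma> x) =
      (T' x \<bullet> J (T x) + \<delta> * (\<eta>' x \<bullet> T x))\<^sup>2 / p x"
      using curv d\<eta> inI
    proof eventually_elim
      case (elim x)
      have n: "norm (dx \<gamma> x) = p x" using dx\<gamma>[OF elim(3)] norm_u[OF elim(3)] by metis
      have "div_along \<gamma> \<eta> x = (\<eta>' x \<bullet> T x) / p x"
        unfolding div_along_def ds_def n elim(2) tan[OF elim(3)] by (simp add: divide_inverse_commute)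
      then have "curvature \<gamma> x + \<delta> * div_along \<gamma> \<eta> x = (T' x \<bullet> J (T x) + \<delta> * (\<eta>' x \<bullet> T x)) / p x"
        unfolding elim(1) by (simp add: add_divide_distrib)
      then show ?case using p[OF elim(3)] unfolding n by (simp add: power_divide power2_eq_square)
    qed
  qed
  moreover have "curve_integral \<gamma> (\<lambda>x. (norm (grad_along \<gamma> \<eta> x))\<^sup>2) = (LINT x|MI. (norm (\<eta>' x))\<^sup>2 / p x)"
    unfolding curve_integral_def
  proof (rule integral_AE_cong_MI)
    show "AE x in MI. (norm (grad_along \<gamma> \<eta> x))\<^sup>2 * norm (dx \<gamma> x) = (norm (\<eta>' x))\<^sup>2 / p x"
      using d\<eta> inI
    proof eventually_elim
      case (elim x)
      have n: "norm (dx \<gamma> x) = p x" using dx\<gamma>[OF elim(2)] norm_u[OF elim(2)] by metis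
      have "norm (grad_along \<gamma> \<eta> x) = norm (\<eta>' x) / p x"
        unfolding grad_along_def norm_tensor ds_def n elim(1) tan[OF elim(2)]
        using p[OF elim(2)] unit[OF elim(2)] by (simp add: divide_inverse_commute)
      then show ?case using p[OF elim(2)] unfolding n by (simp add: power_divide power2_eq_square)
    qed
  qed measurable
  moreover have "curve_length \<gamma> = (LINT x|MI. p x)"
    unfolding curve_length_def curve_integral_def
  proof (rule Bochner_Integration.integral_cong)
    show "1 * norm (dx \<gamma> x) = p x" if "x \<in> space MI" for x
      using that dx\<gamma>[of x] norm_u[of x] unfolding space_lebesgue_on by (metis mult_1)
  qed simp
  ultimately show "E_LM \<delta> lam \<gamma> \<eta> = 1/2 * (LINT x|MI. (T' x \<bullet> J (T x) + \<delta> * (\<eta>' x \<bullet> T x))\<^sup>2 / p x)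
     + lam/2 * (LINT x|MI. (norm (\<eta>' x))\<^sup>2 / p x) + (LINT x|MI. p x)"
    by (simp add: E_LM_def)
  show "signed_area \<gamma> = - (1/2) * (LINT x|MI. \<gamma> x \<bullet> J (u x))"
    unfolding signed_area_def
  proof (intro arg_cong2[where f="(*)"] refl Bochner_Integration.integral_cong)
    show "\<gamma> x \<bullet> J (dx \<gamma> x) = \<gamma> x \<bullet> J (u x)" if "x \<in> space MI" for x
      using that dx\<gamma>[of x] unfolding space_lebesgue_on by metis
  qed
qed

section \<open>Weak limits\<close>

text \<open>Dyadic convex combinations of the members from index \<open>n\<close> on. Midpoints are
  all that the parallelogram law asks for, and properties of the whole hull follow by induction
  without any weights.\<close>

inductive_set midpoint_hull :: "(nat \<Rightarrow> 'b \<Rightarrow> 'a::real_vector) \<Rightarrow> nat \<Rightarrow> ('b \<Rightarrow> 'a) set"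
  for w n where
  base: "n \<le> m \<Longrightarrow> w m \<in> midpoint_hull w n"
| mid: "f \<in> midpoint_hull w n \<Longrightarrow> g \<in> midpoint_hull w n \<Longrightarrow> (\<lambda>x. (1/2) *\<^sub>R (f x + g x)) \<in> midpoint_hull w n"

lemma midpoint_hull_antimono:
  assumes "n \<le> n'" "f \<in> midpoint_hull w n'"
  shows "f \<in> midpoint_hull w n"
  using assms(2) by induction (use assms(1) in \<open>auto intro: midpoint_hull.intros\<close>)

lemma parallelogram_midpoint:
  fixes a b :: "'a::real_inner"
  shows "(norm (a - b))\<^sup>2 = 2 * (norm a)\<^sup>2 + 2 * (norm b)\<^sup>2 - 4 * (norm ((1/2) *\<^sub>R (a + b)))\<^sup>2"
  by (simp add: power2_norm_eq_inner inner_diff inner_add inner_commute algebra_simps)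

text \<open>Termwise integration of the nonnegative series gives a finite value, so its sum is
  finite a.e.\<close>

lemma AE_summable_if_summable_integral:
  fixes f :: "nat \<Rightarrow> 'b \<Rightarrow> real"
  assumes f: "\<And>j. integrable M (f j)" "\<And>j x. 0 \<le> f j x" and sum: "summable (\<lambda>j. LINT x|M. f j x)"
  shows "AE x in M. summable (\<lambda>j. f j x)"
proof -
  have [measurable]: "f j \<in> borel_measurable M" for j using f(1) by simp
  have "(\<integral>\<^sup>+x. (\<Sum>j. ennreal (f j x)) \<partial>M) = (\<Sum>j. \<integral>\<^sup>+x. ennreal (f j x) \<partial>M)"
    by (rule nn_integral_suminf) measurable
  also have "\<dots> = (\<Sum>j. ennreal (LINT x|M. f j x))"
    by (intro suminf_cong nn_integral_eq_integral f AE_I2)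
  also have "\<dots> = ennreal (\<Sum>j. LINT x|M. f j x)"
    by (intro suminf_ennreal2 sum Bochner_Integration.integral_nonneg f)
  finally have "(\<integral>\<^sup>+x. (\<Sum>j. ennreal (f j x)) \<partial>M) \<noteq> \<infinity>" by simp
  then have "AE x in M. (\<Sum>j. ennreal (f j x)) \<noteq> \<infinity>"
    by (intro nn_integral_PInf_AE) measurable
  then show ?thesis
    by eventually_elim (auto intro: summable_suminf_not_top f)
qed

text \<open>A weak limit together with weak lower semicontinuity, obtained as a strong limit: almost
  norm-minimal elements of the midpoint hulls of the tails form a Cauchy sequence by the
  parallelogram law (compare Mazur's lemma).\<close>

lemma midpoint_hull_limit:
  fixes w :: "nat \<Rightarrow> 'b \<Rightarrow> 'a::euclidean_space"
  assumes "finite_measure M"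
    and w: "\<And>n. w n \<in> borel_measurable M" "\<And>n. integrable M (\<lambda>x. (norm (w n x))\<^sup>2)"
    and bound: "\<And>n. (LINT x|M. (norm (w n x))\<^sup>2) \<le> e n" and lim: "e \<longlonglongrightarrow> e'"
  obtains h g D where "\<And>j. h j \<in> midpoint_hull w j" "AE x in M. (\<lambda>j. h j x) \<longlonglongrightarrow> g x"
    "integrable M D" "AE x in M. \<forall>j. norm (h j x) \<le> D x"
    "g \<in> borel_measurable M" "integrable M (\<lambda>x. (norm (g x))\<^sup>2)" "(LINT x|M. (norm (g x))\<^sup>2) \<le> e'"
proof -
  interpret finite_measure M by fact
  define N where "N f = (LINT x|M. (norm (f x))\<^sup>2)" for f :: "'b \<Rightarrow> 'a"
  have hull: "f \<in> borel_measurable M \<and> integrable M (\<lambda>x. (norm (f x))\<^sup>2)" if "f \<in> midpoint_hull w n" for f n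
    using that
  proof induction
    case (mid f g)
    then have [measurable]: "f \<in> borel_measurable M" "g \<in> borel_measurable M" by auto
    have "integrable M (\<lambda>x. (norm ((1/2) *\<^sub>R (f x + g x)))\<^sup>2)"
    proof (rule Bochner_Integration.integrable_bound)
      show "integrable M (\<lambda>x. (norm (f x))\<^sup>2 + (norm (g x))\<^sup>2)" using mid by simp
      have "(norm ((1/2) *\<^sub>R (a + b)))\<^sup>2 \<le> (norm a)\<^sup>2 + (norm b)\<^sup>2" for a b :: 'a
        using parallelogram_midpoint[of a b] zero_le_power2[of "norm (a - b)"] zero_le_power2[of "norm a"] zero_le_power2[of "norm b"]
        by linarith
      then show "AE x in M. norm ((norm ((1/2) *\<^sub>R (f x + g x)))\<^sup>2) \<le> norm ((norm (f x))\<^sup>2 + (norm (g x))\<^sup>2)"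
        by (auto intro!: AE_I2)
    qed measurable
    then show ?case by auto
  qed (use w in auto)
  have N_nonneg: "0 \<le> N f" for f by (simp add: N_def)
  \<comment> \<open>The hulls shrink, so \<open>d\<close> increases. It is bounded by
    \<open>e'\<close>, because every later \<open>w m\<close> belongs to the hull and
    \<open>e\<close> tends to \<open>e'\<close>. The limit \<open>dd\<close> will bound the squared
    norm of the strong limit.\<close>
  define d where "d n = Inf (N ` midpoint_hull w n)" for n
  have bdd: "bdd_below (N ` X)" for X using N_nonneg by (auto intro: bdd_belowI[of _ 0])
  have ne: "N ` midpoint_hull w n \<noteq> {}" for n using midpoint_hull.base[of n n w] by blast
  have d_le: "d n \<le> N f" if "f \<in> midpoint_hull w n" for f n
    unfolding d_def by (intro cInf_lower bdd imageI that)
  have d_le_e': "d n \<le> e'" for n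
  proof (rule LIMSEQ_le_const[OF lim])
    show "\<exists>N. \<forall>m\<ge>N. d n \<le> e m"
      using d_le[OF midpoint_hull.base[of n _ w]] bound unfolding N_def by (meson order_trans)
  qed
  have d_mono: "d m \<le> d n" if "m \<le> n" for m n
    unfolding d_def by (intro cInf_superset_mono ne bdd image_mono) (use midpoint_hull_antimono[OF that] in blast)
  have "incseq d" using d_mono by (auto simp: incseq_def)
  then obtain dd where dd: "d \<longlonglongrightarrow> dd" "\<And>n. d n \<le> dd"
    using incseq_convergent[of d e'] d_le_e' by metis
  have dd_le: "dd \<le> e'" using LIMSEQ_le_const2[OF dd(1)] d_le_e' by blast
  have ex: "\<exists>k\<ge>j. dd - (1/4) ^ j \<le> d k" for j :: nat
  proof -
    have "\<forall>\<^sub>F k in sequentially. dd - (1/4) ^ j < d k"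
      using order_tendstoD(1)[OF dd(1), of "dd - (1/4) ^ j"] by simp
    then obtain K where "\<And>k. k \<ge> K \<Longrightarrow> dd - (1/4) ^ j < d k" by (auto simp: eventually_sequentially)
    then show ?thesis by (intro exI[of _ "max j K"]) (auto intro: less_imp_le)
  qed
  \<comment> \<open>Taking the least such index makes \<open>r\<close> monotone, so
    \<open>h (Suc j)\<close> lies in the same hull as \<open>h j\<close> and their midpoint can be
    compared with the infimum there. The conjunct \<open>j \<le> k\<close> places \<open>h j\<close>
    in the hull of tail \<open>j\<close>.\<close>
  define r where "r j = (LEAST k. j \<le> k \<and> dd - (1/4) ^ j \<le> d k)" for j :: nat
  have r: "j \<le> r j" "dd - (1/4) ^ j \<le> d (r j)" for j
    using LeastI_ex[OF ex[of j]] unfolding r_def by auto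
  have r_mono: "r j \<le> r (Suc j)" for j
  proof -
    have "(1/4) ^ Suc j \<le> ((1/4) ^ j :: real)" by (rule power_decreasing) auto
    then have "dd - (1/4) ^ j \<le> d (r (Suc j))" using r(2)[of "Suc j"] by linarith
    then show ?thesis using r(1)[of "Suc j"] unfolding r_def[of j] by (intro Least_le) auto
  qed
  have "\<exists>h. h \<in> midpoint_hull w (r j) \<and> N h < d (r j) + (1/4) ^ j" for j
    using cInf_lessD[OF ne[of "r j"], of "d (r j) + (1/4) ^ j"] unfolding d_def[symmetric] by auto
  then obtain h where h: "\<And>j. h j \<in> midpoint_hull w (r j)" "\<And>j. N (h j) < d (r j) + (1/4) ^ j" by metis
  have [measurable]: "h j \<in> borel_measurable M" for j using hull[OF h(1)] by blast
  have h_int: "integrable M (\<lambda>x. (norm (h j x))\<^sup>2)" for j using hull[OF h(1)] by blast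
  have h_N: "N (h j) \<le> dd + (1/4) ^ j" for j using h(2)[of j] dd(2)[of "r j"] by linarith
  define \<Delta> where "\<Delta> j x = h (Suc j) x - h j x" for j x
  have [measurable]: "\<Delta> j \<in> borel_measurable M" for j unfolding \<Delta>_def by measurable
  \<comment> \<open>With q = (1/4)^j both squared norms are at most dd + q and that of the midpoint
    is at least dd - q, so the parallelogram law leaves 4 (dd + q) - 4 (dd - q) = 8 q.\<close>
  have \<Delta>2: "integrable M (\<lambda>x. (norm (\<Delta> j x))\<^sup>2)" "N (\<Delta> j) \<le> 8 * (1/4) ^ j" for j
  proof -
    have h': "h (Suc j) \<in> midpoint_hull w (r j)" by (rule midpoint_hull_antimono[OF r_mono h(1)])
    have mid: "(\<lambda>x. (1/2) *\<^sub>R (h (Suc j) x + h j x)) \<in> midpoint_hull w (r j)"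
      by (intro midpoint_hull.mid h' h(1))
    have i: "integrable M (\<lambda>x. (norm ((1/2) *\<^sub>R (h (Suc j) x + h j x)))\<^sup>2)" using hull[OF mid] by blast
    have eq: "(\<lambda>x. (norm (\<Delta> j x))\<^sup>2) = (\<lambda>x. 2 * (norm (h (Suc j) x))\<^sup>2 + 2 * (norm (h j x))\<^sup>2 - 4 * (norm ((1/2) *\<^sub>R (h (Suc j) x + h j x)))\<^sup>2)"
      unfolding \<Delta>_def by (rule ext) (rule parallelogram_midpoint)
    show "integrable M (\<lambda>x. (norm (\<Delta> j x))\<^sup>2)"
      unfolding eq by (intro Bochner_Integration.integrable_diff Bochner_Integration.integrable_add integrable_mult_right h_int i)
    have "N (\<Delta> j) = 2 * N (h (Suc j)) + 2 * N (h j) - 4 * N (\<lambda>x. (1/2) *\<^sub>R (h (Suc j) x + h j x))"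
      unfolding N_def eq
      by (subst Bochner_Integration.integral_diff Bochner_Integration.integral_add,
          (intro Bochner_Integration.integrable_diff Bochner_Integration.integrable_add integrable_mult_right h_int i)+)+
         (simp only: integral_mult_right_zero)
    moreover have "dd - (1/4) ^ j \<le> N (\<lambda>x. (1/2) *\<^sub>R (h (Suc j) x + h j x))"
      using d_le[OF mid] r(2)[of j] by linarith
    moreover have "N (h (Suc j)) \<le> dd + (1/4) ^ j"
    proof -
      have "(1/4) ^ Suc j \<le> ((1/4) ^ j :: real)" by (rule power_decreasing) auto
      then show ?thesis using h_N[of "Suc j"] by linarith
    qed
    ultimately show "N (\<Delta> j) \<le> 8 * (1/4) ^ j" using h_N[of j] by linarith
  qed
  \<comment> \<open>The weight 2^j balances the decay (1/4)^j of the squared norms: on a finite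
    measure space the integrals of |\<Delta> j| then decay like (1/2)^j and are summable.\<close>
  have AM: "norm (v :: 'a) \<le> 2 ^ j * (norm v)\<^sup>2 + (1/2) ^ j" for v j
  proof -
    have "0 \<le> (2 ^ j * norm v - 1)\<^sup>2" by simp
    then have "2 * norm v * 2 ^ j \<le> (2 ^ j * (norm v)\<^sup>2 + (1/2) ^ j) * 2 ^ j"
      by (simp add: power2_eq_square algebra_simps power_one_over)
    then have "2 * norm v \<le> 2 ^ j * (norm v)\<^sup>2 + (1/2) ^ j"
      by (rule mult_right_le_imp_le) simp
    then show ?thesis by (smt (verit) norm_ge_zero)
  qed
  have \<Delta>1: "integrable M (\<lambda>x. norm (\<Delta> j x))" "(LINT x|M. norm (\<Delta> j x)) \<le> (8 + measure M (space M)) * (1/2) ^ j" for j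
  proof -
    have i: "integrable M (\<lambda>x. 2 ^ j * (norm (\<Delta> j x))\<^sup>2 + (1/2) ^ j)" using \<Delta>2(1)[of j] by simp
    show "integrable M (\<lambda>x. norm (\<Delta> j x))"
      by (rule Bochner_Integration.integrable_bound[OF i]) (use AM in \<open>auto intro!: AE_I2\<close>)
    then have "(LINT x|M. norm (\<Delta> j x)) \<le> (LINT x|M. 2 ^ j * (norm (\<Delta> j x))\<^sup>2 + (1/2) ^ j)"
      by (intro integral_mono i AM)
    also have "\<dots> = 2 ^ j * N (\<Delta> j) + measure M (space M) * (1/2) ^ j"
      using \<Delta>2(1)[of j] by (simp add: N_def)
    also have "\<dots> \<le> 2 ^ j * (8 * (1/4) ^ j) + measure M (space M) * (1/2) ^ j"
      using \<Delta>2(2)[of j] by (intro add_mono mult_left_mono) auto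
    also have "2 ^ j * (8 * (1/4) ^ j) = 8 * (1/2 :: real) ^ j"
      by (simp flip: power_mult_distrib)
    finally show "(LINT x|M. norm (\<Delta> j x)) \<le> (8 + measure M (space M)) * (1/2) ^ j" by (simp add: algebra_simps)
  qed
  have sum_int: "summable (\<lambda>j. LINT x|M. norm (\<Delta> j x))"
    by (rule summable_comparison_test'[where N=0 and g="\<lambda>j. (8 + measure M (space M)) * (1/2) ^ j"])
       (use \<Delta>1(2) in \<open>auto intro: summable_mult summable_geometric\<close>)
  have AE_sum: "AE x in M. summable (\<lambda>j. norm (\<Delta> j x))"
    by (rule AE_summable_if_summable_integral[OF \<Delta>1(1) _ sum_int]) simp
  \<comment> \<open>The telescoping sum bounds every \<open>h n\<close> by this one integrable
    function, the majorant for later uses of dominated convergence.\<close>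
  define D where "D x = norm (h 0 x) + (\<Sum>j. norm (\<Delta> j x))" for x
  have "integrable M (\<lambda>x. norm (h 0 x))"
  proof -
    have i: "integrable M (\<lambda>x. 2 ^ 0 * (norm (h 0 x))\<^sup>2 + (1/2) ^ 0)" using h_int[of 0] by simp
    show ?thesis by (rule Bochner_Integration.integrable_bound[OF i]) (use AM[of _ 0] in \<open>auto intro!: AE_I2\<close>)
  qed
  moreover have "integrable M (\<lambda>x. \<Sum>j. norm (\<Delta> j x))"
    using AE_sum sum_int by (intro integrable_suminf \<Delta>1(1)) auto
  ultimately have D: "integrable M D" unfolding D_def by simp
  have tele: "h n x = h 0 x + (\<Sum>j<n. \<Delta> j x)" for n x
    unfolding \<Delta>_def using sum_lessThan_telescope[of "\<lambda>j. h j x" n] by (simp add: algebra_simps)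
  define g where "g x = lim (\<lambda>j. h j x)" for x
  have g_meas[measurable]: "g \<in> borel_measurable M" unfolding g_def by measurable
  have conv: "AE x in M. (\<lambda>j. h j x) \<longlonglongrightarrow> g x"
    using AE_sum
  proof eventually_elim
    case (elim x)
    then have sum: "summable (\<lambda>j. \<Delta> j x)" by (rule summable_norm_cancel)
    have "(\<lambda>n. h 0 x + (\<Sum>j<n. \<Delta> j x)) \<longlonglongrightarrow> h 0 x + (\<Sum>j. \<Delta> j x)"
      by (intro tendsto_add tendsto_const summable_LIMSEQ sum)
    moreover have "(\<lambda>n. h 0 x + (\<Sum>j<n. \<Delta> j x)) = (\<lambda>n. h n x)"
      by (rule ext) (rule tele[symmetric])
    ultimately have "convergent (\<lambda>j. h j x)" unfolding convergent_def by metis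
    then show ?case unfolding g_def convergent_LIMSEQ_iff .
  qed
  have dom: "AE x in M. \<forall>j. norm (h j x) \<le> D x"
    using AE_sum
  proof eventually_elim
    case (elim x)
    show ?case
    proof
      fix n
      have "norm (h n x) \<le> norm (h 0 x) + (\<Sum>j<n. norm (\<Delta> j x))"
        unfolding tele[of n] by (intro order_trans[OF norm_triangle_ineq] add_left_mono norm_sum)
      also have "(\<Sum>j<n. norm (\<Delta> j x)) \<le> (\<Sum>j. norm (\<Delta> j x))"
        by (rule sum_le_suminf[OF elim]) auto
      finally show "norm (h n x) \<le> D x" by (simp add: D_def)
    qed
  qed
  have fatou: "(\<integral>\<^sup>+x. ennreal ((norm (g x))\<^sup>2) \<partial>M) \<le> ennreal dd"
  proof -
    have "(\<integral>\<^sup>+x. ennreal ((norm (g x))\<^sup>2) \<partial>M) = (\<integral>\<^sup>+x. liminf (\<lambda>j. ennreal ((norm (h j x))\<^sup>2)) \<partial>M)"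
    proof (rule nn_integral_cong_AE)
      show "AE x in M. ennreal ((norm (g x))\<^sup>2) = liminf (\<lambda>j. ennreal ((norm (h j x))\<^sup>2))"
        using conv
      proof eventually_elim
        case (elim x)
        then have "(\<lambda>j. ennreal ((norm (h j x))\<^sup>2)) \<longlonglongrightarrow> ennreal ((norm (g x))\<^sup>2)"
          by (intro tendsto_ennrealI tendsto_intros)
        then show ?case by (intro lim_imp_Liminf[symmetric]) auto
      qed
    qed
    also have "\<dots> \<le> liminf (\<lambda>j. \<integral>\<^sup>+x. ennreal ((norm (h j x))\<^sup>2) \<partial>M)"
      by (rule nn_integral_liminf) measurable
    also have "\<dots> \<le> liminf (\<lambda>j. ennreal (dd + (1/4) ^ j))"
    proof (intro Liminf_mono always_eventually allI)
      fix j
      have "(\<integral>\<^sup>+x. ennreal ((norm (h j x))\<^sup>2) \<partial>M) = ennreal (N (h j))"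
        unfolding N_def by (rule nn_integral_eq_integral[OF h_int]) simp
      also have "\<dots> \<le> ennreal (dd + (1/4) ^ j)" by (rule ennreal_leI[OF h_N])
      finally show "(\<integral>\<^sup>+x. ennreal ((norm (h j x))\<^sup>2) \<partial>M) \<le> ennreal (dd + (1/4) ^ j)" .
    qed
    also have "\<dots> = ennreal dd"
    proof (rule lim_imp_Liminf)
      have "(\<lambda>j. dd + (1/4 :: real) ^ j) \<longlonglongrightarrow> dd + 0"
        by (intro tendsto_intros LIMSEQ_realpow_zero) auto
      then show "(\<lambda>j. ennreal (dd + (1/4) ^ j)) \<longlonglongrightarrow> ennreal dd" by (intro tendsto_ennrealI) simp
    qed simp
    finally show ?thesis .
  qed
  have g2: "integrable M (\<lambda>x. (norm (g x))\<^sup>2)"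
    by (rule integrableI_bounded) (use fatou in \<open>auto simp: le_less_trans\<close>)
  \<comment> \<open>\<open>ennreal\<close> truncates negative numbers, so the sign of
    \<open>dd\<close> is needed to read the Fatou bound as a real inequality.\<close>
  have "0 \<le> dd"
    using N_nonneg d_le cInf_greatest[OF ne[of 0], of 0] dd(2)[of 0] unfolding d_def by fastforce
  then have "(LINT x|M. (norm (g x))\<^sup>2) \<le> dd"
    using fatou nn_integral_eq_integral[OF g2] by simp
  then have g3: "(LINT x|M. (norm (g x))\<^sup>2) \<le> e'" using dd_le by linarith
  show thesis
    by (rule that[OF midpoint_hull_antimono[OF r(1) h(1)] conv D dom g_meas g2 g3])
qed

section \<open>Reduction to constant speed\<close>

text \<open>The closed curve of speed \<open>l\<close> that starts at the origin is stored through
  its tangent: it is \<open>l\<close> times the indefinite integral of \<open>T\<close>. The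
  vanishing integral of \<open>T\<close> closes it, and the last equation prescribes its signed
  area.\<close>

definition constant_speed_pair ::
  "real \<Rightarrow> real \<Rightarrow> (real \<Rightarrow> real ^ 2) \<Rightarrow> (real \<Rightarrow> real ^ 2) \<Rightarrow> (real \<Rightarrow> real ^ 2) \<Rightarrow> (real \<Rightarrow> real ^ 2) \<Rightarrow> bool"
  where
  "constant_speed_pair A0 l T T' \<eta> \<eta>' \<longleftrightarrow> l > 0 \<and>
     primitive_on 0 (2*pi) T T' \<and> T' \<in> L2 \<and> (\<forall>x\<in>I2pi. norm (T x) = 1) \<and> T 0 = T (2*pi) \<and>
     integral I2pi T = 0 \<and>
     primitive_on 0 (2*pi) \<eta> \<eta>' \<and> \<eta>' \<in> L2 \<and> (\<forall>x\<in>I2pi. norm (\<eta> x) = 1) \<and> \<eta> 0 = \<eta> (2*pi) \<and>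
     - (1/2) * (l\<^sup>2 * (LINT x|MI. integral {0..x} T \<bullet> J (T x))) = A0"

text \<open>The part of the energy that is quadratic in the derivatives, with the common factor 1/(2
  l) taken out; at constant speed it is free of \<open>l\<close>.\<close>

definition bending ::
  "real \<Rightarrow> real \<Rightarrow> (real \<Rightarrow> real ^ 2) \<Rightarrow> (real \<Rightarrow> real ^ 2) \<Rightarrow> (real \<Rightarrow> real ^ 2) \<Rightarrow> real" where
  "bending \<delta> lam T T' \<eta>' =
     (LINT x|MI. (T' x \<bullet> J (T x) + \<delta> * (\<eta>' x \<bullet> T x))\<^sup>2) + lam * (LINT x|MI. (norm (\<eta>' x))\<^sup>2)"

lemma MI_length [simp]: "measure MI I2pi = 2 * pi"
  by (simp add: measure_restrict_space)

lemma E_LM_constant_speed: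
  assumes "constant_speed_pair A0 l T T' \<eta> \<eta>'"
  defines "\<gamma> \<equiv> \<lambda>x. l *\<^sub>R integral {0..x} T"
  shows "(\<gamma>, \<eta>) \<in> admissible A0"
    and "E_LM \<delta> lam \<gamma> \<eta> = bending \<delta> lam T T' \<eta>' / (2 * l) + 2 * pi * l"
proof -
  note r = assms(1)[unfolded constant_speed_pair_def]
  from r have l: "l > 0" and T: "primitive_on 0 (2*pi) T T'" "T' \<in> L2" and unit: "\<And>x. x \<in> I2pi \<Longrightarrow> norm (T x) = 1"
    and \<eta>: "primitive_on 0 (2*pi) \<eta> \<eta>'" "\<eta>' \<in> L2" by auto
  have Tc: "continuous_on I2pi T" by (rule primitive_on_continuous[OF T(1)])
  define u where "u x = l *\<^sub>R T x" for x
  have u: "continuous_on I2pi u" unfolding u_def by (intro continuous_intros Tc)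
  have lin: "bounded_linear (\<lambda>v :: real ^ 2. l *\<^sub>R v)" by (rule bounded_linear_scaleR_right)
  have "primitive_on 0 (2*pi) (\<lambda>x. integral {0..x} T) T"
    using absolutely_integrable_continuous_real[OF Tc] by (simp add: primitive_on_def)
  then have \<gamma>: "primitive_on 0 (2*pi) \<gamma> u" unfolding \<gamma>_def u_def by (rule primitive_on_linear[OF lin])
  have uv: "primitive_on 0 (2*pi) u (\<lambda>x. l *\<^sub>R T' x)" unfolding u_def by (rule primitive_on_linear[OF lin T(1)])
  have v: "(\<lambda>x. l *\<^sub>R T' x) \<in> L2"
    by (rule L2_bounded[OF primitive_on_measurable(2)[OF uv] L2_square_integrable[OF T(2)], of l]) (use l in auto)
  have \<gamma>_Hper: "\<gamma> \<in> Hper 2"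
    unfolding Hper_2_iff
  proof (intro conjI exI)
    show "u 0 = u (2*pi)" "\<gamma> 0 = \<gamma> (2*pi)" using r by (simp_all add: u_def \<gamma>_def)
  qed (fact \<gamma> uv v)+
  have "dx \<gamma> x \<noteq> 0" if "x \<in> I2pi" for x
    using dx_eq(1)[OF \<gamma> u that] l unit[OF that] by (auto simp: u_def)
  then have "\<gamma> \<in> H2imm" using \<gamma>_Hper by (simp add: H2imm_def)
  moreover have "\<eta> \<in> Hper 1" using r \<eta> unfolding Hper_1_iff by blast
  moreover
  have "\<forall>x\<in>I2pi. u x = l *\<^sub>R T x \<and> l > 0 \<and> norm (T x) = 1" using l unit by (simp add: u_def)
  note E = E_LM_eq[OF \<gamma> u this T \<eta>]
  have "signed_area \<gamma> = - (1/2) * (LINT x|MI. l\<^sup>2 * (integral {0..x} T \<bullet> J (T x)))"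
    unfolding E(2) by (simp add: \<gamma>_def u_def J_scaleR power2_eq_square mult.assoc)
  moreover from this have "signed_area \<gamma> = A0" using r by simp
  ultimately show "(\<gamma>, \<eta>) \<in> admissible A0" using r by (simp add: admissible_def S_def)
  show "E_LM \<delta> lam \<gamma> \<eta> = bending \<delta> lam T T' \<eta>' / (2 * l) + 2 * pi * l"
    unfolding E(1) bending_def by (simp add: add_divide_distrib)
qed

text \<open>The function \<open>s\<close> is the arc length, rescaled to the interval; only its derivative is used,
  never that of its inverse \<open>\<sigma>\<close>.\<close>

locale reparametrization =
  fixes p s \<sigma> :: "real \<Rightarrow> real" and l :: real
  assumes l: "l > 0" and p: "\<And>x. x \<in> I2pi \<Longrightarrow> p x > 0" and p_cont: "continuous_on I2pi p"
    and s: "\<And>x. x \<in> I2pi \<Longrightarrow> (s has_field_derivative p x / l) (at x within I2pi)"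
    and s_ends: "s 0 = 0" "s (2*pi) = 2*pi"
    and \<sigma>: "\<And>y. y \<in> I2pi \<Longrightarrow> \<sigma> y \<in> I2pi" "\<And>y. y \<in> I2pi \<Longrightarrow> s (\<sigma> y) = y"
      "\<And>x. x \<in> I2pi \<Longrightarrow> \<sigma> (s x) = x" "\<And>x. x \<in> I2pi \<Longrightarrow> s ` {0..x} = {0..s x}"
begin

text \<open>The factor is what the derivative of \<open>\<sigma>\<close> would be: the pullback of a
  derivative of \<open>F\<close> serves as derivative of \<open>F\<close> composed with
  \<open>\<sigma>\<close> (\<open>pullback_primitive\<close>).\<close>

definition pullback :: "(real \<Rightarrow> 'a::real_vector) \<Rightarrow> real \<Rightarrow> 'a" where
  "pullback h y = (l / p (\<sigma> y)) *\<^sub>R h (\<sigma> y)"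

lemma s_inj: "inj_on s I2pi"
  by (rule inj_on_inverseI[of _ \<sigma>]) (rule \<sigma>(3))

text \<open>Substitution y = s t. The Jacobian p / l cancels the factor l / p of
  \<open>pullback\<close>, and the image of {0..x} under the injective \<open>s\<close> is {0..s
  x}.\<close>

lemma pullback_real:
  fixes h :: "real \<Rightarrow> real"
  assumes h: "h absolutely_integrable_on I2pi" and x: "x \<in> I2pi"
  shows "pullback h absolutely_integrable_on {0..s x} \<and> integral {0..s x} (pullback h) = integral {0..x} h"
proof -
  have eq: "\<bar>p t / l\<bar> * pullback h (s t) = h t" if "t \<in> {0..x}" for t
  proof -
    have "t \<in> I2pi" using that x by auto
    then show ?thesis using p[of t] l \<sigma>(3)[of t] by (simp add: pullback_def)
  qed
  have hx: "h absolutely_integrable_on {0..x}"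
    by (rule absolutely_integrable_on_subinterval[OF h]) (use x in auto)
  have "(\<lambda>t. \<bar>p t / l\<bar> * pullback h (s t)) absolutely_integrable_on {0..x}"
    by (rule set_integrable_cong[THEN iffD2, OF refl refl _ hx]) (rule eq)
  moreover have "integral {0..x} (\<lambda>t. \<bar>p t / l\<bar> * pullback h (s t)) = integral {0..x} h"
    by (rule integral_cong) (rule eq)
  moreover have "(\<lambda>t. \<bar>p t / l\<bar> * pullback h (s t)) absolutely_integrable_on {0..x} \<and>
      integral {0..x} (\<lambda>t. \<bar>p t / l\<bar> * pullback h (s t)) = integral {0..x} h \<longleftrightarrow>
      pullback h absolutely_integrable_on s ` {0..x} \<and> integral (s ` {0..x}) (pullback h) = integral {0..x} h"
  proof (rule has_absolute_integral_change_of_variables_1')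
    show "(s has_field_derivative p t / l) (at t within {0..x})" if "t \<in> {0..x}" for t
      by (rule has_field_derivative_subset[OF s]) (use that x in auto)
    show "inj_on s {0..x}" by (rule inj_on_subset[OF s_inj]) (use x in auto)
  qed simp
  ultimately show ?thesis unfolding \<sigma>(4)[OF x] by blast
qed

lemma pullback_integral:
  fixes h :: "real \<Rightarrow> 'a::euclidean_space"
  assumes h: "h absolutely_integrable_on I2pi" and x: "x \<in> I2pi"
  shows "pullback h absolutely_integrable_on {0..s x}" "integral {0..s x} (pullback h) = integral {0..x} h"
proof -
  have comp: "(\<lambda>y. pullback h y \<bullet> i) = pullback (\<lambda>t. h t \<bullet> i)" for i by (auto simp: pullback_def)
  have hi: "(\<lambda>t. h t \<bullet> i) absolutely_integrable_on I2pi" for i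
    using h by (rule absolutely_integrable_component)
  note real = pullback_real[OF hi x]
  show 1: "pullback h absolutely_integrable_on {0..s x}"
    by (subst absolutely_integrable_componentwise_iff) (auto simp: comp real)
  have hx: "h integrable_on {0..x}"
    by (rule integrable_on_subinterval[OF set_lebesgue_integral_eq_integral(1)[OF h]]) (use x in auto)
  show "integral {0..s x} (pullback h) = integral {0..x} h"
  proof (rule euclidean_eqI)
    fix i :: 'a assume i: "i \<in> Basis"
    have "integral {0..s x} (pullback h) \<bullet> i = integral {0..s x} (pullback (\<lambda>t. h t \<bullet> i))"
      using integral_component_eq[of "pullback h" "{0..s x}" i] set_lebesgue_integral_eq_integral(1)[OF 1] by (simp add: comp)
    also have "\<dots> = integral {0..x} h \<bullet> i"
      using real integral_component_eq[OF hx] by simp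
    finally show "integral {0..s x} (pullback h) \<bullet> i = integral {0..x} h \<bullet> i" .
  qed
qed

lemma pullback_LINT:
  fixes h :: "real \<Rightarrow> 'a::euclidean_space"
  assumes "integrable MI h"
  shows "integrable MI (pullback h)" "integral\<^sup>L MI (pullback h) = integral\<^sup>L MI h"
proof -
  have h: "h absolutely_integrable_on I2pi" using assms by (simp add: integrable_lebesgue_on_iff)
  note pb = pullback_integral[OF h, of "2*pi", unfolded s_ends]
  show i: "integrable MI (pullback h)" using pb(1) by (simp add: integrable_lebesgue_on_iff)
  show "integral\<^sup>L MI (pullback h) = integral\<^sup>L MI h"
    using pb(2) i assms by (simp add: lebesgue_integral_eq_integral)
qed

lemma pullback_primitive:
  assumes F: "primitive_on 0 (2*pi) F h"
  shows "primitive_on 0 (2*pi) (\<lambda>y. F (\<sigma> y)) (pullback h)"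
  unfolding primitive_on_def
proof (intro conjI ballI)
  note h = primitive_onD(1)[OF F]
  show "pullback h absolutely_integrable_on I2pi" using pullback_integral(1)[OF h, of "2*pi"] s_ends by simp
  fix y assume y: "y \<in> I2pi"
  have "\<sigma> 0 = 0" using \<sigma>(3)[of 0] s_ends by simp
  then show "F (\<sigma> y) = F (\<sigma> 0) + integral {0..y} (pullback h)"
    using pullback_integral(2)[OF h \<sigma>(1)[OF y]] \<sigma>(2)[OF y] primitive_onD(3)[OF F \<sigma>(1)[OF y]] by simp
qed

text \<open>The square carries two factors l / p. One is absorbed by the change of variables, the
  other remains and matches the weight 1 / p of \<open>E_LM_eq\<close>; it is bounded, since
  \<open>p\<close> is continuous and positive on a compact interval.\<close>

lemma pullback_square:
  fixes h :: "real \<Rightarrow> 'a::euclidean_space"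
  assumes h: "integrable MI (\<lambda>x. (norm (h x))\<^sup>2)"
  shows "integrable MI (\<lambda>y. (norm (pullback h y))\<^sup>2)"
    and "(LINT y|MI. (norm (pullback h y))\<^sup>2) = l * (LINT x|MI. (norm (h x))\<^sup>2 / p x)"
proof -
  have I: "I2pi \<in> sets lebesgue" by simp
  have "integrable MI (\<lambda>x. (l / p x) *\<^sub>R (norm (h x))\<^sup>2)"
    unfolding integrable_lebesgue_on_iff[OF I]
  proof (rule absolutely_integrable_bounded_measurable_product[where h="(*\<^sub>R)"])
    have c: "continuous_on I2pi (\<lambda>x. l / p x)"
      using p by (intro continuous_intros p_cont) fastforce
    show "(\<lambda>x. l / p x) \<in> borel_measurable MI" by (rule continuous_measurable_MI[OF c])
    show "bounded ((\<lambda>x. l / p x) ` I2pi)"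
      by (intro compact_imp_bounded compact_continuous_image c) auto
    show "bilinear ((*\<^sub>R) :: real \<Rightarrow> real \<Rightarrow> real)" by (simp add: bilinear_def linear_iff algebra_simps)
    show "(\<lambda>x. (norm (h x))\<^sup>2) absolutely_integrable_on I2pi"
      using h by (simp add: integrable_lebesgue_on_iff)
  qed simp
  then have i: "integrable MI (\<lambda>x. l * ((norm (h x))\<^sup>2 / p x))" by simp
  have eq: "(norm (pullback h y))\<^sup>2 = pullback (\<lambda>x. l * ((norm (h x))\<^sup>2 / p x)) y" for y
    by (simp add: pullback_def power_mult_distrib power_divide power2_eq_square)
  show "integrable MI (\<lambda>y. (norm (pullback h y))\<^sup>2)"
    unfolding eq by (rule pullback_LINT(1)[OF i])
  show "(LINT y|MI. (norm (pullback h y))\<^sup>2) = l * (LINT x|MI. (norm (h x))\<^sup>2 / p x)"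
    unfolding eq pullback_LINT(2)[OF i] by (rule integral_mult_right_zero)
qed

lemma pullback_L2: "h \<in> L2 \<Longrightarrow> pullback h \<in> L2"
  using pullback_square(1)[of h] pullback_LINT(1)[OF L2_integrable[of h]] by (simp add: L2_def)

end

lemma square_integrable_bound:
  assumes "a \<in> borel_measurable MI" "f \<in> L2" "g \<in> L2" "\<And>x. x \<in> I2pi \<Longrightarrow> \<bar>a x\<bar> \<le> norm (f x) + C * norm (g x)"
  shows "integrable MI (\<lambda>x. (a x)\<^sup>2)"
proof (rule Bochner_Integration.integrable_bound)
  show "integrable MI (\<lambda>x. 2 * (norm (f x))\<^sup>2 + 2 * C\<^sup>2 * (norm (g x))\<^sup>2)"
    using assms(2,3) by (simp add: L2_def)
  show "(\<lambda>x. (a x)\<^sup>2) \<in> borel_measurable MI" using assms(1) by measurable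
  have "(a x)\<^sup>2 \<le> 2 * (norm (f x))\<^sup>2 + 2 * C\<^sup>2 * (norm (g x))\<^sup>2" if "x \<in> I2pi" for x
  proof -
    have "(a x)\<^sup>2 \<le> (norm (f x) + C * norm (g x))\<^sup>2"
      using power_mono[OF assms(4)[OF that], of 2] by simp
    also have "\<dots> \<le> 2 * (norm (f x))\<^sup>2 + 2 * C\<^sup>2 * (norm (g x))\<^sup>2"
      using zero_le_power2[of "norm (f x) - C * norm (g x)"]
      by (simp add: power2_eq_square algebra_simps)
    finally show ?thesis .
  qed
  then show "AE x in MI. norm ((a x)\<^sup>2) \<le> norm (2 * (norm (f x))\<^sup>2 + 2 * C\<^sup>2 * (norm (g x))\<^sup>2)"
    by (auto intro!: AE_I2 order_trans[OF _ abs_ge_self])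
qed

lemma bending_density_bound:
  fixes t t' e :: "real ^ 2"
  assumes "norm t = 1"
  shows "\<bar>t' \<bullet> J t + \<delta> * (e \<bullet> t)\<bar> \<le> norm t' + \<bar>\<delta>\<bar> * norm e"
proof -
  have "\<bar>t' \<bullet> J t\<bar> \<le> norm t'" "\<bar>e \<bullet> t\<bar> \<le> norm e"
    using Cauchy_Schwarz_ineq2[of t' "J t"] Cauchy_Schwarz_ineq2[of e t] assms by simp_all
  then have "\<bar>t' \<bullet> J t\<bar> \<le> norm t'" "\<bar>\<delta> * (e \<bullet> t)\<bar> \<le> \<bar>\<delta>\<bar> * norm e"
    by (simp_all add: abs_mult mult_left_mono)
  then show ?thesis by linarith
qed

lemma bending_density_integrable:
  assumes T: "primitive_on 0 (2*pi) T T'" "T' \<in> L2" and unit: "\<And>x. x \<in> I2pi \<Longrightarrow> norm (T x) = 1"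
    and e: "e \<in> L2"
  shows "integrable MI (\<lambda>x. (T' x \<bullet> J (T x) + \<delta> * (e x \<bullet> T x))\<^sup>2)"
proof (rule square_integrable_bound[OF _ T(2) e])
  have [measurable]: "T \<in> borel_measurable MI" "T' \<in> borel_measurable MI" "e \<in> borel_measurable MI"
    using primitive_on_measurable[OF T(1)] e by (auto simp: L2_def)
  show "(\<lambda>x. T' x \<bullet> J (T x) + \<delta> * (e x \<bullet> T x)) \<in> borel_measurable MI" by measurable
qed (rule bending_density_bound[OF unit])

text \<open>Arc length divided by the mean speed maps the interval onto itself. Positivity of
  \<open>p\<close> makes it strictly increasing, and the intermediate value theorem gives the
  images.\<close>

lemma reparametrization_exists:
  assumes p: "\<And>x. x \<in> I2pi \<Longrightarrow> p x > 0" and p_cont: "continuous_on I2pi p"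
  obtains s \<sigma> where "reparametrization p s \<sigma> (integral I2pi p / (2*pi))"
proof -
  define l where "l = integral I2pi p / (2*pi)"
  have pi: "p integrable_on {a..b}" if "a \<ge> 0" "b \<le> 2*pi" for a b
    using p_cont that by (intro integrable_continuous_interval continuous_on_subset[OF p_cont]) auto
  have pos: "integral {a..b} p > 0" if "a \<ge> 0" "b \<le> 2*pi" "a < b" for a b
  proof -
    have "continuous_on {a..b} p" by (rule continuous_on_subset[OF p_cont]) (use that in auto)
    then have "\<exists>x\<in>{a..b}. \<forall>y\<in>{a..b}. p x \<le> p y"
      by (intro continuous_attains_inf) (use that in auto)
    then obtain x0 where x0: "x0 \<in> {a..b}" "\<And>x. x \<in> {a..b} \<Longrightarrow> p x0 \<le> p x" by blast
    have "integral {a..b} (\<lambda>_. p x0) \<le> integral {a..b} p"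
      by (rule integral_le) (use x0 pi that in auto)
    moreover have "p x0 > 0" using x0(1) that by (intro p) auto
    moreover have "integral {a..b} (\<lambda>_. p x0) = (b - a) * p x0" using that by simp
    ultimately show ?thesis using that mult_pos_pos[of "b - a" "p x0"] by linarith
  qed
  have l: "l > 0" using pos[of 0 "2*pi"] by (simp add: l_def)
  define s where "s x = integral {0..x} p / l" for x
  have D: "(s has_field_derivative p x / l) (at x within I2pi)" if "x \<in> I2pi" for x
    unfolding s_def using integral_has_real_derivative[OF p_cont that] by (rule DERIV_cdivide)
  have sc: "continuous_on I2pi s"
    using D by (meson DERIV_continuous continuous_on_eq_continuous_within)
  have mono: "s x < s y" if "0 \<le> x" "x < y" "y \<le> 2*pi" for x y
  proof -
    have "integral {0..x} p + integral {x..y} p = integral {0..y} p"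
      using that by (intro Henstock_Kurzweil_Integration.integral_combine pi) auto
    then have "integral {0..x} p < integral {0..y} p" using pos[of x y] that by auto
    then show ?thesis using l by (simp add: s_def divide_strict_right_mono)
  qed
  have inj: "inj_on s I2pi"
  proof (rule inj_onI)
    fix x y assume "x \<in> I2pi" "y \<in> I2pi" "s x = s y"
    then show "x = y" using mono[of x y] mono[of y x] by (cases x y rule: linorder_cases) auto
  qed
  have s0: "s 0 = 0" by (simp add: s_def)
  have "integral I2pi p \<noteq> 0" using pos[of 0 "2*pi"] by simp
  then have s1: "s (2*pi) = 2*pi" by (simp add: s_def l_def)
  have img: "s ` {0..x} = {0..s x}" if x: "x \<in> I2pi" for x
  proof (intro equalityI subsetI)
    fix y assume "y \<in> s ` {0..x}"
    then obtain t where t: "t \<in> {0..x}" "y = s t" by auto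
    then show "y \<in> {0..s x}"
      using mono[of 0 t] mono[of t x] s0 x by (cases "t = 0"; cases "t = x") (auto intro: less_imp_le)
  next
    fix y assume y: "y \<in> {0..s x}"
    have "continuous_on {0..x} s" by (rule continuous_on_subset[OF sc]) (use x in auto)
    then show "y \<in> s ` {0..x}" using IVT'[of s 0 y x] y s0 x by auto
  qed
  define \<sigma> where "\<sigma> = inv_into I2pi s"
  have img': "s ` I2pi = I2pi" using img[of "2*pi"] s1 by simp
  have \<sigma>: "\<sigma> y \<in> I2pi" "s (\<sigma> y) = y" if "y \<in> I2pi" for y
    unfolding \<sigma>_def using that img' by (intro inv_into_into f_inv_into_f, simp)+
  have "\<sigma> (s x) = x" if "x \<in> I2pi" for x
    unfolding \<sigma>_def using inj that by (rule inv_into_f_f)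
  then have "reparametrization p s \<sigma> l"
    by unfold_locales (use l p p_cont D s0 s1 img \<sigma> in blast)+
  then show thesis using that by (simp add: l_def)
qed

text \<open>\<open>q x\<close> is the derivative of 1/|z| at \<open>u x\<close>, so the chain and
  product rules apply. Both resulting terms are at most |v|/|u|, and 1/|u| is bounded by
  compactness; hence the constant 2 C and a derivative in \<open>L2\<close>.\<close>

lemma unit_normalization_primitive:
  fixes u :: "real \<Rightarrow> real ^ 2"
  assumes u: "primitive_on 0 (2*pi) u v" "v \<in> L2" and nz: "\<And>x. x \<in> I2pi \<Longrightarrow> u x \<noteq> 0"
  obtains T' where "primitive_on 0 (2*pi) (\<lambda>x. u x /\<^sub>R norm (u x)) T'" "T' \<in> L2"
proof -
  have uc: "continuous_on I2pi u" by (rule primitive_on_continuous[OF u(1)])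
  define q where "q x h = - (inverse (norm (u x)) * (h \<bullet> sgn (u x)) * inverse (norm (u x)))" for x and h :: "real ^ 2"
  have q: "primitive_on 0 (2*pi) (\<lambda>x. inverse (norm (u x))) (\<lambda>x. q x (v x))"
  proof (rule primitive_on_chain[where F="\<lambda>z. inverse (norm z)" and D=q, OF u(1)])
    fix x assume x: "x \<in> I2pi"
    show "((\<lambda>z. inverse (norm z)) has_derivative q x) (at (u x))"
      unfolding q_def using nz[OF x] has_derivative_norm[of "u x"]
      by (intro Deriv.has_derivative_inverse) (auto simp: inner_commute)
  next
    show "continuous_on I2pi (\<lambda>x. q x i)" for i
      unfolding q_def using nz by (intro continuous_intros continuous_on_sgn uc) auto
  qed
  have T: "primitive_on 0 (2*pi) (\<lambda>x. inverse (norm (u x)) *\<^sub>R u x)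
     (\<lambda>x. inverse (norm (u x)) *\<^sub>R v x + q x (v x) *\<^sub>R u x)"
    by (rule primitive_on_scaleR[OF q u(1)])
  have "compact ((\<lambda>x. inverse (norm (u x))) ` I2pi)"
    using nz by (intro compact_continuous_image continuous_intros uc) auto
  then obtain C where C: "\<And>x. x \<in> I2pi \<Longrightarrow> inverse (norm (u x)) \<le> C"
    using bounded_real compact_imp_bounded by (metis (no_types, lifting) abs_le_D1 imageI)
  have "(\<lambda>x. inverse (norm (u x)) *\<^sub>R v x + q x (v x) *\<^sub>R u x) \<in> L2"
  proof (rule L2_bounded[OF primitive_on_measurable(2)[OF T] L2_square_integrable[OF u(2)], of "2 * C"])
    fix x assume x: "x \<in> I2pi"
    let ?i = "inverse (norm (u x))"
    have cs: "\<bar>v x \<bullet> sgn (u x)\<bar> \<le> norm (v x)"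
      using Cauchy_Schwarz_ineq2[of "v x" "sgn (u x)"] nz[OF x] by (simp add: norm_sgn)
    have "norm (q x (v x) *\<^sub>R u x) = ?i * \<bar>v x \<bullet> sgn (u x)\<bar> * ?i * norm (u x)"
      by (simp add: q_def abs_mult)
    also have "\<dots> \<le> ?i * norm (v x) * ?i * norm (u x)"
      by (intro mult_right_mono mult_left_mono cs) auto
    also have "\<dots> = ?i * norm (v x)" using nz[OF x] by simp
    finally have "norm (?i *\<^sub>R v x + q x (v x) *\<^sub>R u x) \<le> ?i * norm (v x) + ?i * norm (v x)"
      by (intro order_trans[OF norm_triangle_ineq] add_mono) auto
    also have "\<dots> \<le> 2 * C * norm (v x)"
      using mult_right_mono[OF C[OF x] norm_ge_zero[of "v x"]] by linarith
    finally show "norm (?i *\<^sub>R v x + q x (v x) *\<^sub>R u x) \<le> 2 * C * norm (v x)" .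
  qed
  with T show thesis by (rule that)
qed

text \<open>Only the tangent and \<open>\<eta>\<close> are composed with \<open>\<sigma>\<close> to
  form the new data. The formula for \<gamma> (\<sigma> y) shows that closedness and area can be
  read off from the new tangent.\<close>

lemma admissible_constant_speed:
  assumes "(\<gamma>, \<eta>) \<in> admissible A0"
  obtains l T T' \<eta>1 \<eta>1' where "constant_speed_pair A0 l T T' \<eta>1 \<eta>1'"
    "E_LM \<delta> lam \<gamma> \<eta> = bending \<delta> lam T T' \<eta>1' / (2 * l) + 2 * pi * l"
proof -
  have adm: "\<gamma> \<in> Hper 2" "\<And>x. x \<in> I2pi \<Longrightarrow> dx \<gamma> x \<noteq> 0" "\<eta> \<in> Hper 1" "signed_area \<gamma> = A0"
    "\<And>x. x \<in> I2pi \<Longrightarrow> norm (\<eta> x) = 1"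
    using assms by (auto simp: admissible_def H2imm_def S_def abs_square_eq_1)
  obtain u v where \<gamma>: "primitive_on 0 (2*pi) \<gamma> u" and uv: "primitive_on 0 (2*pi) u v" "v \<in> L2"
    and per: "u 0 = u (2*pi)" "\<gamma> 0 = \<gamma> (2*pi)"
    using adm(1) unfolding Hper_2_iff by blast
  obtain \<eta>' where \<eta>: "primitive_on 0 (2*pi) \<eta> \<eta>'" "\<eta>' \<in> L2" and per\<eta>: "\<eta> 0 = \<eta> (2*pi)"
    using adm(3) unfolding Hper_1_iff by blast
  have uc: "continuous_on I2pi u" by (rule primitive_on_continuous[OF uv(1)])
  have nz: "u x \<noteq> 0" if "x \<in> I2pi" for x using adm(2)[OF that] dx_eq(1)[OF \<gamma> uc that] by simp
  define p where "p x = norm (u x)" for x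
  have p: "p x > 0" if "x \<in> I2pi" for x using nz[OF that] by (simp add: p_def)
  have pc: "continuous_on I2pi p" unfolding p_def by (intro continuous_intros uc)
  define T0 where "T0 x = u x /\<^sub>R norm (u x)" for x
  obtain T0' where T0: "primitive_on 0 (2*pi) T0 T0'" "T0' \<in> L2"
    using unit_normalization_primitive[OF uv nz] unfolding T0_def by blast
  have uT: "u x = p x *\<^sub>R T0 x" if "x \<in> I2pi" for x using p[OF that] by (simp add: p_def T0_def)
  have unit: "norm (T0 x) = 1" if "x \<in> I2pi" for x using nz[OF that] by (simp add: T0_def)
  define l where "l = integral I2pi p / (2*pi)"
  obtain s \<sigma> where "reparametrization p s \<sigma> l"
    using reparametrization_exists[OF p pc] unfolding l_def by blast
  then interpret reparametrization p s \<sigma> l .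
  define T where "T y = T0 (\<sigma> y)" for y
  define \<eta>1 where "\<eta>1 y = \<eta> (\<sigma> y)" for y
  have \<sigma>_ends: "\<sigma> 0 = 0" "\<sigma> (2*pi) = 2*pi" using \<sigma>(3)[of 0] \<sigma>(3)[of "2*pi"] s_ends by simp_all
  have T: "primitive_on 0 (2*pi) T (pullback T0')" unfolding T_def by (rule pullback_primitive[OF T0(1)])
  have pu: "pullback u y = l *\<^sub>R T y" if "y \<in> I2pi" for y
    using uT[OF \<sigma>(1)[OF that]] p[OF \<sigma>(1)[OF that]] by (simp add: pullback_def T_def)
  have \<gamma>\<sigma>: "\<gamma> (\<sigma> y) = \<gamma> 0 + l *\<^sub>R integral {0..y} T" if "y \<in> I2pi" for y
  proof -
    have "\<gamma> (\<sigma> y) = \<gamma> (\<sigma> 0) + integral {0..y} (pullback u)"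
      using primitive_onD(3)[OF pullback_primitive[OF \<gamma>] that] .
    also have "integral {0..y} (pullback u) = integral {0..y} (\<lambda>t. l *\<^sub>R T t)"
      by (rule integral_cong) (use pu that in auto)
    finally show ?thesis by (simp add: \<sigma>_ends)
  qed
  have closed: "integral I2pi T = 0"
    using \<gamma>\<sigma>[of "2*pi"] per l by (simp add: \<sigma>_ends)
  have Tc: "continuous_on I2pi T" by (rule primitive_on_continuous[OF T])
  have "\<forall>x\<in>I2pi. u x = p x *\<^sub>R T0 x \<and> p x > 0 \<and> norm (T0 x) = 1" using uT p unit by blast
  note E = E_LM_eq[OF \<gamma> uc this T0 \<eta>]
  have area: "- (1/2) * (l\<^sup>2 * (LINT x|MI. integral {0..x} T \<bullet> J (T x))) = A0"
  proof -
    have gc: "continuous_on I2pi \<gamma>" by (rule primitive_on_continuous[OF \<gamma>])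
    have i: "integrable MI (\<lambda>x. \<gamma> x \<bullet> J (u x))"
      by (intro continuous_integrable_MI continuous_intros gc uc)
    have "(LINT x|MI. \<gamma> x \<bullet> J (u x)) = (LINT y|MI. pullback (\<lambda>x. \<gamma> x \<bullet> J (u x)) y)"
      using pullback_LINT(2)[OF i] by simp
    also have "\<dots> = (LINT y|MI. l * (\<gamma> 0 \<bullet> J (T y)) + l\<^sup>2 * (integral {0..y} T \<bullet> J (T y)))"
    proof (rule Bochner_Integration.integral_cong)
      fix y assume "y \<in> space MI"
      then have y: "y \<in> I2pi" by simp
      have "pullback (\<lambda>x. \<gamma> x \<bullet> J (u x)) y = \<gamma> (\<sigma> y) \<bullet> J (pullback u y)"
        by (simp add: pullback_def J_scaleR)
      then show "pullback (\<lambda>x. \<gamma> x \<bullet> J (u x)) y = l * (\<gamma> 0 \<bullet> J (T y)) + l\<^sup>2 * (integral {0..y} T \<bullet> J (T y))"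
        unfolding \<gamma>\<sigma>[OF y] pu[OF y] by (simp add: J_scaleR inner_add_left power2_eq_square algebra_simps)
    qed simp
    also have "\<dots> = l * (\<gamma> 0 \<bullet> J (integral I2pi T)) + l\<^sup>2 * (LINT y|MI. integral {0..y} T \<bullet> J (T y))"
    proof -
      have iT: "integrable MI T" by (rule continuous_integrable_MI[OF Tc])
      have i1: "integrable MI (\<lambda>y. \<gamma> 0 \<bullet> J (T y))" by (intro continuous_integrable_MI continuous_intros Tc)
      have i2: "integrable MI (\<lambda>y. integral {0..y} T \<bullet> J (T y))"
        by (intro continuous_integrable_MI continuous_intros Tc indefinite_integral_continuous_1 integrable_continuous_interval)
      have "bounded_linear (\<lambda>v. \<gamma> 0 \<bullet> J v)"
        using bounded_linear_compose[OF bounded_linear_inner_right J_linear] .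
      then have "(LINT y|MI. \<gamma> 0 \<bullet> J (T y)) = \<gamma> 0 \<bullet> J (integral\<^sup>L MI T)"
        using integral_bounded_linear[OF _ iT] by blast
      also have "integral\<^sup>L MI T = integral I2pi T" using iT by (simp add: lebesgue_integral_eq_integral)
      finally show ?thesis using i1 i2 by simp
    qed
    \<comment> \<open>Closedness makes the area independent of the starting point, which the normal
      form places at the origin.\<close>
    also have "\<gamma> 0 \<bullet> J (integral I2pi T) = 0" unfolding closed by (simp add: inner_real2)
    finally show ?thesis using E(2) adm(4) by simp
  qed
  have csp: "constant_speed_pair A0 l T (pullback T0') \<eta>1 (pullback \<eta>')"
    unfolding constant_speed_pair_def
  proof (intro conjI ballI)
    show "T 0 = T (2*pi)" using per by (simp add: T_def T0_def \<sigma>_ends)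
    show "\<eta>1 0 = \<eta>1 (2*pi)" using per\<eta> by (simp add: \<eta>1_def \<sigma>_ends)
    show "norm (T x) = 1" if "x \<in> I2pi" for x using unit[OF \<sigma>(1)[OF that]] by (simp add: T_def)
    show "norm (\<eta>1 x) = 1" if "x \<in> I2pi" for x using adm(5)[OF \<sigma>(1)[OF that]] by (simp add: \<eta>1_def)
    show "primitive_on 0 (2*pi) \<eta>1 (pullback \<eta>')" unfolding \<eta>1_def by (rule pullback_primitive[OF \<eta>(1)])
  qed (fact l T pullback_L2[OF T0(2)] closed pullback_L2[OF \<eta>(2)] area)+
  \<comment> \<open>Before squaring, the integrand is linear in the derivatives, so its pullback is
    the corresponding integrand of the reparametrized data.\<close>
  define a where "a x = T0' x \<bullet> J (T0 x) + \<delta> * (\<eta>' x \<bullet> T0 x)" for x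
  have "(LINT y|MI. (pullback T0' y \<bullet> J (T y) + \<delta> * (pullback \<eta>' y \<bullet> T y))\<^sup>2) = l * (LINT x|MI. (a x)\<^sup>2 / p x)"
  proof -
    have pa: "pullback a y = pullback T0' y \<bullet> J (T y) + \<delta> * (pullback \<eta>' y \<bullet> T y)" for y
      by (simp add: pullback_def a_def T_def algebra_simps)
    have "integrable MI (\<lambda>x. (a x)\<^sup>2)"
      unfolding a_def by (rule bending_density_integrable[OF T0 _ \<eta>(2)]) (rule unit)
    then show ?thesis using pullback_square(2)[of a] by (simp add: pa)
  qed
  moreover have "(LINT y|MI. (norm (pullback \<eta>' y))\<^sup>2) = l * (LINT x|MI. (norm (\<eta>' x))\<^sup>2 / p x)"
    using \<eta>(2) by (intro pullback_square(2)) (simp add: L2_def)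
  ultimately have "bending \<delta> lam T (pullback T0') (pullback \<eta>') = l * (LINT x|MI. (a x)\<^sup>2 / p x) + lam * (l * (LINT x|MI. (norm (\<eta>' x))\<^sup>2 / p x))"
    unfolding bending_def by simp
  moreover have "(LINT x|MI. p x) = 2 * pi * l"
    using continuous_integrable_MI[OF pc] by (simp add: lebesgue_integral_eq_integral l_def)
  ultimately have "E_LM \<delta> lam \<gamma> \<eta> = bending \<delta> lam T (pullback T0') (pullback \<eta>') / (2 * l) + 2 * pi * l"
    unfolding E(1) a_def using l by (simp add: field_simps)
  with csp show thesis by (rule that)
qed

section \<open>Existence of a minimizer\<close>

lemma AM_bound: "t > 0 \<Longrightarrow> (a::real) \<ge> 0 \<Longrightarrow> a \<le> t * a\<^sup>2 + 1 / t"
proof -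
  assume t: "t > 0" and a: "a \<ge> 0"
  have "0 \<le> (t * a - 1)\<^sup>2 / t" using t by simp
  also have "\<dots> = t * a\<^sup>2 - 2 * a + 1 / t" using t by (simp add: power2_eq_square field_simps)
  finally show ?thesis using a by simp
qed

text \<open>Young's inequality |g| \<le> t |g|^2 + 1/t under the integral. The free weight
  \<open>t\<close> takes the place of the Hoelder bound with exponent 1/2; it is chosen once to make
  a curve turn and once for equicontinuity.\<close>

lemma primitive_on_increment_bound:
  assumes f: "primitive_on 0 (2*pi) f g" and g: "g \<in> L2"
    and xy: "0 \<le> x" "x \<le> y" "y \<le> 2*pi" and t: "t > 0"
  shows "norm (f y - f x) \<le> t * (LINT x|MI. (norm (g x))\<^sup>2) + (y - x) / t"
proof -
  have gi: "g integrable_on {x..y}"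
    by (rule integrable_on_subinterval[OF primitive_onD(2)[OF f]]) (use xy in auto)
  have g2: "integrable MI (\<lambda>x. (norm (g x))\<^sup>2)" using g by (simp add: L2_def)
  have g2i: "(\<lambda>x. (norm (g x))\<^sup>2) integrable_on I2pi" using g2 by (auto intro: integrable_on_lebesgue_on)
  have g2s: "(\<lambda>x. (norm (g x))\<^sup>2) integrable_on {x..y}"
    by (rule integrable_on_subinterval[OF g2i]) (use xy in auto)
  have i: "(\<lambda>s. t * (norm (g s))\<^sup>2) integrable_on {x..y}" using g2s by (rule integrable_on_mult_right)
  have "norm (f y - f x) = norm (integral {x..y} g)"
    using primitive_on_diff_eq[OF f, of x y] xy by simp
  also have "\<dots> \<le> integral {x..y} (\<lambda>s. t * (norm (g s))\<^sup>2 + 1 / t)"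
    by (intro integral_norm_bound_integral gi Henstock_Kurzweil_Integration.integrable_add i integrable_const_ivl AM_bound t norm_ge_zero)
  also have "\<dots> = t * integral {x..y} (\<lambda>s. (norm (g s))\<^sup>2) + (y - x) / t"
    using xy by (subst Henstock_Kurzweil_Integration.integral_add[OF i]) auto
  also have "integral {x..y} (\<lambda>s. (norm (g s))\<^sup>2) \<le> integral I2pi (\<lambda>s. (norm (g s))\<^sup>2)"
    by (rule integral_subset_le[OF _ g2s g2i]) (use xy in auto)
  also have "integral I2pi (\<lambda>s. (norm (g s))\<^sup>2) = (LINT x|MI. (norm (g x))\<^sup>2)"
    using g2 by (simp add: lebesgue_integral_eq_integral)
  finally show ?thesis using t by simp
qed

lemma constant_speed_pairD:
  assumes "constant_speed_pair A0 l T T' \<eta> \<eta>'"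
  shows "l > 0" "primitive_on 0 (2*pi) T T'" "T' \<in> L2" "\<And>x. x \<in> I2pi \<Longrightarrow> norm (T x) = 1" "T 0 = T (2*pi)"
    "integral I2pi T = 0" "primitive_on 0 (2*pi) \<eta> \<eta>'" "\<eta>' \<in> L2" "\<And>x. x \<in> I2pi \<Longrightarrow> norm (\<eta> x) = 1"
    "\<eta> 0 = \<eta> (2*pi)" "- (1/2) * (l\<^sup>2 * (LINT x|MI. integral {0..x} T \<bullet> J (T x))) = A0"
  using assms unfolding constant_speed_pair_def by blast+

text \<open>A.e. \<open>T'\<close> is parallel to J T, so |T'| = |a - \<delta> (\<eta>' . T)| with a
  the integrand of the first square. The inequality (x - y)^2 \<le> 2 x^2 + 2 y^2 separates the
  coupling, whose part in \<open>\<eta>'\<close> is paid for by the term with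
  \<open>lam\<close>.\<close>

lemma bending_coercive:
  assumes csp: "constant_speed_pair A0 l T T' \<eta> \<eta>'" and lam: "lam > 0"
  shows "lam * (LINT x|MI. (norm (\<eta>' x))\<^sup>2) \<le> bending \<delta> lam T T' \<eta>'"
    and "(LINT x|MI. (norm (T' x))\<^sup>2) \<le> (2 + 2 * \<delta>\<^sup>2 / lam) * bending \<delta> lam T T' \<eta>'"
    and "0 \<le> bending \<delta> lam T T' \<eta>'"
proof -
  note T = constant_speed_pairD[OF csp]
  let ?a = "\<lambda>x. T' x \<bullet> J (T x) + \<delta> * (\<eta>' x \<bullet> T x)"
  have a: "integrable MI (\<lambda>x. (?a x)\<^sup>2)"
    by (rule bending_density_integrable[OF T(2,3) _ T(8)]) (rule T(4))
  have T'2: "integrable MI (\<lambda>x. (norm (T' x))\<^sup>2)" and e2: "integrable MI (\<lambda>x. (norm (\<eta>' x))\<^sup>2)"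
    using T(3,8) by (auto simp: L2_def)
  have a_pos: "0 \<le> (LINT x|MI. (?a x)\<^sup>2)" and e_pos: "0 \<le> (LINT x|MI. (norm (\<eta>' x))\<^sup>2)" by simp_all
  show e_le: "lam * (LINT x|MI. (norm (\<eta>' x))\<^sup>2) \<le> bending \<delta> lam T T' \<eta>'"
    using a_pos by (simp add: bending_def)
  show b_pos: "0 \<le> bending \<delta> lam T T' \<eta>'" using a_pos e_pos lam by (simp add: bending_def)
  have orth: "AE x in MI. T x \<bullet> T' x = 0"
    by (rule unit_primitive_orthogonal[OF T(2)]) (rule T(4))
  have "(LINT x|MI. (norm (T' x))\<^sup>2) \<le> (LINT x|MI. 2 * (?a x)\<^sup>2 + 2 * \<delta>\<^sup>2 * (norm (\<eta>' x))\<^sup>2)"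
  proof (rule integral_mono_AE)
    show "integrable MI (\<lambda>x. 2 * (?a x)\<^sup>2 + 2 * \<delta>\<^sup>2 * (norm (\<eta>' x))\<^sup>2)" using a e2 by simp
    have "AE x in MI. x \<in> I2pi" by (auto intro: AE_I2)
    with orth show "AE x in MI. (norm (T' x))\<^sup>2 \<le> 2 * (?a x)\<^sup>2 + 2 * \<delta>\<^sup>2 * (norm (\<eta>' x))\<^sup>2"
    proof eventually_elim
      case (elim x)
      have "T' x = (T' x \<bullet> J (T x)) *\<^sub>R J (T x)"
        using tangent_normal_decomposition[OF T(4)[OF elim(2)], of "T' x"] elim(1) by (simp add: inner_commute)
      then have "norm (T' x) = \<bar>T' x \<bullet> J (T x)\<bar>"
        using T(4)[OF elim(2)] by (metis norm_J norm_scaleR mult.right_neutral)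
      then have "(norm (T' x))\<^sup>2 = (?a x - \<delta> * (\<eta>' x \<bullet> T x))\<^sup>2" by simp
      also have "\<dots> \<le> 2 * (?a x)\<^sup>2 + 2 * (\<delta> * (\<eta>' x \<bullet> T x))\<^sup>2"
        using zero_le_power2[of "?a x + \<delta> * (\<eta>' x \<bullet> T x)"] by (simp add: power2_eq_square algebra_simps)
      also have "(\<delta> * (\<eta>' x \<bullet> T x))\<^sup>2 \<le> \<delta>\<^sup>2 * (norm (\<eta>' x))\<^sup>2"
      proof -
        have "\<bar>\<eta>' x \<bullet> T x\<bar> \<le> norm (\<eta>' x)"
          using Cauchy_Schwarz_ineq2[of "\<eta>' x" "T x"] T(4)[OF elim(2)] by simp
        then have "(\<eta>' x \<bullet> T x)\<^sup>2 \<le> (norm (\<eta>' x))\<^sup>2" using power_mono[of "\<bar>\<eta>' x \<bullet> T x\<bar>" _ 2] by simp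
        then show ?thesis by (simp add: power_mult_distrib mult_left_mono)
      qed
      finally show ?case by simp
    qed
  qed (rule T'2)
  also have "\<dots> = 2 * (LINT x|MI. (?a x)\<^sup>2) + 2 * \<delta>\<^sup>2 * (LINT x|MI. (norm (\<eta>' x))\<^sup>2)" using a e2 by simp
  also have "\<dots> \<le> 2 * bending \<delta> lam T T' \<eta>' + 2 * \<delta>\<^sup>2 * (bending \<delta> lam T T' \<eta>' / lam)"
  proof (intro add_mono mult_left_mono)
    show "(LINT x|MI. (?a x)\<^sup>2) \<le> bending \<delta> lam T T' \<eta>'" using e_pos lam by (simp add: bending_def)
    show "(LINT x|MI. (norm (\<eta>' x))\<^sup>2) \<le> bending \<delta> lam T T' \<eta>' / lam"
      using e_le lam by (simp add: pos_le_divide_eq mult.commute)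
  qed auto
  also have "\<dots> = (2 + 2 * \<delta>\<^sup>2 / lam) * bending \<delta> lam T T' \<eta>'" by (simp add: algebra_simps)
  finally show "(LINT x|MI. (norm (T' x))\<^sup>2) \<le> (2 + 2 * \<delta>\<^sup>2 / lam) * bending \<delta> lam T T' \<eta>'" .
qed

text \<open>A unit field \<open>T\<close> with mean zero satisfies \<open>2\<pi> = |\<integral> (T - T 0)|\<close>, so it has to turn.\<close>

lemma closed_curve_bending:
  assumes csp: "constant_speed_pair A0 l T T' \<eta> \<eta>'"
  shows "1 / (8 * pi) \<le> (LINT x|MI. (norm (T' x))\<^sup>2)"
proof -
  note T = constant_speed_pairD[OF csp]
  define M where "M = (LINT x|MI. (norm (T' x))\<^sup>2)"
  have Ti: "T integrable_on I2pi" by (intro integrable_continuous_interval primitive_on_continuous[OF T(2)])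
  have b: "norm (T x - T 0) \<le> 4 * pi * M + 1 / 2" if x: "x \<in> I2pi" for x
  proof -
    \<comment> \<open>The weight t = 4 pi makes the second term at most 1/2 on the whole interval,
      so half of the required mean displacement 1 is left for \<open>M\<close>.\<close>
    have "norm (T x - T 0) \<le> (4 * pi) * M + (x - 0) / (4 * pi)"
      unfolding M_def by (rule primitive_on_increment_bound[OF T(2,3)]) (use x in auto)
    also have "(x - 0) / (4 * pi) \<le> 1 / 2" using x by (simp add: field_simps)
    finally show ?thesis by simp
  qed
  have "integral I2pi (\<lambda>x. T x - T 0) = - (2 * pi) *\<^sub>R T 0"
    using T(6) by (subst Henstock_Kurzweil_Integration.integral_diff[OF Ti]) (auto intro: integrable_const_ivl)
  then have "2 * pi = norm (integral I2pi (\<lambda>x. T x - T 0))" using T(4)[of 0] by simp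
  also have "\<dots> \<le> integral I2pi (\<lambda>x. 4 * pi * M + 1 / 2)"
    by (intro integral_norm_bound_integral b Henstock_Kurzweil_Integration.integrable_diff Ti integrable_const_ivl)
  also have "\<dots> = 2 * pi * (4 * pi * M + 1 / 2)" by simp
  finally have "1 \<le> 4 * pi * M + 1 / 2" by simp
  then show ?thesis by (simp add: M_def field_simps)
qed

text \<open>Over the fixed measure \<open>MI\<close>, integrals on {0..x} become accessible to
  dominated convergence.\<close>

lemma integral_initial_segment:
  fixes f :: "real \<Rightarrow> 'a::euclidean_space"
  assumes f: "integrable MI f" and x: "x \<in> I2pi"
  shows "integral {0..x} f = (LINT t|MI. indicator {0..x} t *\<^sub>R f t)"
    "integrable MI (\<lambda>t. indicator {0..x} t *\<^sub>R f t)"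
proof -
  have "{0..x} \<in> sets MI" using x by (auto simp: sets_restrict_space_iff)
  then show i: "integrable MI (\<lambda>t. indicator {0..x} t *\<^sub>R f t)"
    using f by (intro integrable_mult_indicator)
  then have "(LINT t|MI. indicator {0..x} t *\<^sub>R f t) = integral I2pi (\<lambda>t. indicator {0..x} t *\<^sub>R f t)"
    by (intro lebesgue_integral_eq_integral) auto
  also have "\<dots> = integral UNIV (\<lambda>t. if t \<in> I2pi then indicator {0..x} t *\<^sub>R f t else 0)"
    by (rule integral_restrict_UNIV[symmetric])
  also have "\<dots> = integral UNIV (\<lambda>t. if t \<in> {0..x} then f t else 0)"
    using x by (intro arg_cong[where f="integral UNIV"] ext) (auto simp: indicator_def)
  also have "\<dots> = integral {0..x} f" by (rule integral_restrict_UNIV)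
  finally show "integral {0..x} f = (LINT t|MI. indicator {0..x} t *\<^sub>R f t)" ..
qed


text \<open>With the tangent \<open>t\<close> frozen, the squared norm of \<open>encode\<close> is the bending density plus
  \<open>(t' \<bullet> t)\<^sup>2\<close>. The extra term vanishes for true tangent fields and makes the density a
  positive definite quadratic form, which \<open>decode\<close> inverts.\<close>

definition decode :: "real \<Rightarrow> real \<Rightarrow> real ^ 2 \<Rightarrow> real \<times> real \<times> (real ^ 2) \<Rightarrow> (real ^ 2) \<times> (real ^ 2)" where
  "decode \<delta> lam t c = (fst c *\<^sub>R t + (fst (snd c) - \<delta> / sqrt lam * (snd (snd c) \<bullet> t)) *\<^sub>R J t,
     (1 / sqrt lam) *\<^sub>R snd (snd c))"

definition encode :: "real \<Rightarrow> real \<Rightarrow> real ^ 2 \<Rightarrow> real ^ 2 \<Rightarrow> real ^ 2 \<Rightarrow> real \<times> real \<times> (real ^ 2)" where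
  "encode \<delta> lam t t' e = (t' \<bullet> t, t' \<bullet> J t + \<delta> * (e \<bullet> t), sqrt lam *\<^sub>R e)"

lemma decode_encode:
  assumes "lam > 0" "norm t = 1"
  shows "decode \<delta> lam t (encode \<delta> lam t t' e) = (t', e)"
  using assms tangent_normal_decomposition[OF assms(2), of t']
  by (simp add: decode_def encode_def)

text \<open>For frozen \<open>t\<close> decoding is linear, so midpoints of codes decode to
  midpoints of derivatives, as the induction over the hull requires.\<close>

lemma decode_midpoint:
  "decode \<delta> lam t ((1/2) *\<^sub>R (c + d)) = (1/2) *\<^sub>R (decode \<delta> lam t c + decode \<delta> lam t d)"
proof -
  define r q where "r = \<delta> / sqrt lam" and "q = 1 / sqrt lam"
  have eq: "decode \<delta> lam t c = (fst c *\<^sub>R t + (fst (snd c) - r * (snd (snd c) \<bullet> t)) *\<^sub>R J t, q *\<^sub>R snd (snd c))" for c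
    by (simp add: decode_def r_def q_def)
  show ?thesis unfolding eq by (simp add: prod_eq_iff vec_eq_iff forall_2 inner_real2 field_simps)
qed

text \<open>Lets integrable majorants and square integrability pass from codes to
  derivatives.\<close>

lemma norm_decode_le:
  assumes "lam > 0" "norm t = 1"
  shows "norm (decode \<delta> lam t c) \<le> (2 + \<bar>\<delta>\<bar> / sqrt lam + 1 / sqrt lam) * norm c"
proof -
  obtain a b v where c: "c = (a, b, v)" by (cases c) auto
  have le: "\<bar>a\<bar> \<le> norm c" "\<bar>b\<bar> \<le> norm c" "norm v \<le> norm c"
    unfolding c using norm_fst_le[of a "(b, v)"] norm_snd_le[of "(b, v)" a] norm_fst_le[of b v] norm_snd_le[of v b]
    by auto
  have "\<bar>v \<bullet> t\<bar> \<le> norm v" using Cauchy_Schwarz_ineq2[of v t] assms by simp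
  then have "\<bar>\<delta> / sqrt lam * (v \<bullet> t)\<bar> \<le> \<bar>\<delta>\<bar> / sqrt lam * norm c"
    using assms le unfolding abs_mult by (intro mult_mono) auto
  then have 1: "\<bar>b - \<delta> / sqrt lam * (v \<bullet> t)\<bar> \<le> norm c + \<bar>\<delta>\<bar> / sqrt lam * norm c"
    using le by linarith
  have 2: "norm ((1 / sqrt lam) *\<^sub>R v) \<le> 1 / sqrt lam * norm c"
    using le assms by (simp add: divide_right_mono)
  have "norm (a *\<^sub>R t + (b - \<delta> / sqrt lam * (v \<bullet> t)) *\<^sub>R J t) \<le> norm (a *\<^sub>R t) + norm ((b - \<delta> / sqrt lam * (v \<bullet> t)) *\<^sub>R J t)"
    by (rule norm_triangle_ineq)
  also have "\<dots> \<le> norm c + (norm c + \<bar>\<delta>\<bar> / sqrt lam * norm c)" using le 1 assms by simp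
  finally have 3: "norm (a *\<^sub>R t + (b - \<delta> / sqrt lam * (v \<bullet> t)) *\<^sub>R J t) \<le> norm c + (norm c + \<bar>\<delta>\<bar> / sqrt lam * norm c)" .
  have "decode \<delta> lam t c = (a *\<^sub>R t + (b - \<delta> / sqrt lam * (v \<bullet> t)) *\<^sub>R J t, (1 / sqrt lam) *\<^sub>R v)"
    by (simp add: decode_def c)
  then have "norm (decode \<delta> lam t c) \<le> norm c + (norm c + \<bar>\<delta>\<bar> / sqrt lam * norm c) + 1 / sqrt lam * norm c"
    using order_trans[OF norm_Pair_le add_mono[OF 3 2]] by simp
  then show ?thesis by (simp add: algebra_simps)
qed

text \<open>Freezing the coefficients at the limit tangent \<open>t\<close> costs an error proportional to
  \<open>\<epsilon> = |s - t|\<close>; the tangential component of \<open>t'\<close> is small because \<open>t'\<close> is orthogonal to \<open>s\<close>.\<close>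

lemma norm_encode_le:
  assumes lam: "lam > 0" and unit: "norm t = 1" "norm s = 1" and \<epsilon>: "norm (s - t) \<le> \<epsilon>" "\<epsilon> \<le> 1" and orth: "s \<bullet> t' = 0"
  shows "(norm (encode \<delta> lam t t' e))\<^sup>2 \<le>
    (t' \<bullet> J s + \<delta> * (e \<bullet> s))\<^sup>2 + lam * (norm e)\<^sup>2 + \<epsilon> * (5 * (norm t')\<^sup>2 + 4 * \<delta>\<^sup>2 * (norm e)\<^sup>2)"
proof -
  have \<epsilon>0: "0 \<le> \<epsilon>" using \<epsilon>(1) norm_ge_zero order_trans by blast
  define a where "a = t' \<bullet> J s + \<delta> * (e \<bullet> s)"
  define b where "b = t' \<bullet> J t + \<delta> * (e \<bullet> t)"
  \<comment> \<open>\<open>q\<close> bounds both \<open>a\<close> and \<open>b\<close>. With |b - a|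
    \<le> \<epsilon> q this gives b^2 - a^2 \<le> 2 \<epsilon> q^2, where 2 q^2 \<le> 4 |t'|^2 + 4
    \<delta>^2 |e|^2. The fifth |t'|^2 of the claim pays for the tangential component.\<close>
  define q where "q = norm t' + \<bar>\<delta>\<bar> * norm e"
  have q0: "0 \<le> q" by (simp add: q_def)
  have ab: "\<bar>a\<bar> \<le> q" "\<bar>b\<bar> \<le> q"
    unfolding a_def b_def q_def by (intro bending_density_bound unit)+
  have diff: "\<bar>b - a\<bar> \<le> \<epsilon> * q"
  proof -
    have "b - a = t' \<bullet> J (t - s) + \<delta> * (e \<bullet> (t - s))"
      by (simp add: a_def b_def inner_real2 algebra_simps)
    moreover have "\<bar>t' \<bullet> J (t - s)\<bar> \<le> norm t' * \<epsilon>"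
      using Cauchy_Schwarz_ineq2[of t' "J (t - s)"] mult_left_mono[OF \<epsilon>(1) norm_ge_zero[of t']]
      by (simp add: norm_minus_commute)
    moreover have "\<bar>\<delta> * (e \<bullet> (t - s))\<bar> \<le> \<bar>\<delta>\<bar> * (norm e * \<epsilon>)"
      unfolding abs_mult
      using Cauchy_Schwarz_ineq2[of e "t - s"] mult_left_mono[OF \<epsilon>(1) norm_ge_zero[of e]]
      by (intro mult_left_mono) (auto simp: norm_minus_commute)
    ultimately show ?thesis unfolding q_def by (simp add: algebra_simps)
  qed
  have "b\<^sup>2 - a\<^sup>2 \<le> \<bar>b - a\<bar> * \<bar>b + a\<bar>"
    by (simp add: power2_eq_square algebra_simps flip: abs_mult)
  also have "\<dots> \<le> (\<epsilon> * q) * (2 * q)"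
    using diff ab q0 \<epsilon>0 by (intro mult_mono) auto
  also have "\<dots> = \<epsilon> * (2 * q\<^sup>2)" by (simp add: power2_eq_square)
  also have "2 * q\<^sup>2 \<le> 4 * (norm t')\<^sup>2 + 4 * \<delta>\<^sup>2 * (norm e)\<^sup>2"
    using zero_le_power2[of "norm t' - \<bar>\<delta>\<bar> * norm e"]
    by (simp add: q_def power2_eq_square algebra_simps)
  finally have b2: "b\<^sup>2 \<le> a\<^sup>2 + \<epsilon> * (4 * (norm t')\<^sup>2 + 4 * \<delta>\<^sup>2 * (norm e)\<^sup>2)"
    using \<epsilon>0 by (simp add: mult_left_mono)
  have t2: "(t' \<bullet> t)\<^sup>2 \<le> \<epsilon> * (norm t')\<^sup>2"
  proof -
    have "t' \<bullet> t = t' \<bullet> (t - s)" using orth by (simp add: inner_diff_right inner_commute)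
    then have "\<bar>t' \<bullet> t\<bar> \<le> norm t' * \<epsilon>"
      using Cauchy_Schwarz_ineq2[of t' "t - s"] mult_left_mono[OF \<epsilon>(1) norm_ge_zero[of t']]
      by (simp add: norm_minus_commute)
    then have "(t' \<bullet> t)\<^sup>2 \<le> (norm t' * \<epsilon>)\<^sup>2" using power_mono[of "\<bar>t' \<bullet> t\<bar>" _ 2] by simp
    also have "\<dots> = \<epsilon> * (\<epsilon> * (norm t')\<^sup>2)" by (simp add: power2_eq_square)
    also have "\<dots> \<le> \<epsilon> * (1 * (norm t')\<^sup>2)" using \<epsilon> \<epsilon>0 by (intro mult_left_mono mult_right_mono) auto
    finally show ?thesis by simp
  qed
  have "(norm (encode \<delta> lam t t' e))\<^sup>2 = (t' \<bullet> t)\<^sup>2 + b\<^sup>2 + lam * (norm e)\<^sup>2"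
    using lam by (simp add: encode_def b_def norm_Pair power_mult_distrib)
  then show ?thesis using b2 t2 unfolding a_def by (simp add: algebra_simps)
qed

lemma constant_speed_minimizer:
  assumes lam: "lam > 0" and ex: "constant_speed_pair A0 l0 T0 T0' \<eta>0 \<eta>0'"
  obtains l T T' \<eta> \<eta>' where "constant_speed_pair A0 l T T' \<eta> \<eta>'"
    "\<And>k U U' \<xi> \<xi>'. constant_speed_pair A0 k U U' \<xi> \<xi>' \<Longrightarrow>
       bending \<delta> lam T T' \<eta>' / (2 * l) + 2 * pi * l \<le> bending \<delta> lam U U' \<xi>' / (2 * k) + 2 * pi * k"
proof -

  \<comment> \<open>Minimizing sequence\<close>
  define en where "en k U U' \<xi>' = bending \<delta> lam U U' \<xi>' / (2 * k) + 2 * pi * k" for k U U' \<xi>'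
  define V where "V = {en k U U' \<xi>' | k U U' \<xi> \<xi>'. constant_speed_pair A0 k U U' \<xi> \<xi>'}"
  define m where "m = Inf V"
  have ne: "V \<noteq> {}" using ex unfolding V_def by blast
  have en_nonneg: "0 \<le> en k U U' \<xi>'" if "constant_speed_pair A0 k U U' \<xi> \<xi>'" for k U U' \<xi> \<xi>'
    using bending_coercive(3)[OF that lam, of \<delta>] constant_speed_pairD(1)[OF that] by (simp add: en_def)
  then have "bdd_below V" unfolding V_def by (auto intro!: bdd_belowI[of _ 0])
  then have m_le: "m \<le> en k U U' \<xi>'" if "constant_speed_pair A0 k U U' \<xi> \<xi>'" for k U U' \<xi> \<xi>'
  proof -
    have "en k U U' \<xi>' \<in> V" unfolding V_def using that by blast
    then show ?thesis unfolding m_def using \<open>bdd_below V\<close> by (rule cInf_lower)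
  qed
  have m0: "0 \<le> m" unfolding m_def by (rule cInf_greatest[OF ne]) (use en_nonneg in \<open>auto simp: V_def\<close>)
  have "\<exists>k U U' \<xi> \<xi>'. constant_speed_pair A0 k U U' \<xi> \<xi>' \<and> en k U U' \<xi>' < m + 1 / real (Suc n)" for n
  proof -
    have "\<exists>x\<in>V. x < m + 1 / real (Suc n)" by (rule cInf_lessD[OF ne]) (simp flip: m_def)
    then show ?thesis unfolding V_def by blast
  qed
  then obtain k U U' \<xi> \<xi>' where csp: "\<And>n. constant_speed_pair A0 (k n) (U n) (U' n) (\<xi> n) (\<xi>' n)"
    and en: "\<And>n. en (k n) (U n) (U' n) (\<xi>' n) < m + 1 / real (Suc n)" by metis
  note P = constant_speed_pairD[OF csp]
  define b where "b n = bending \<delta> lam (U n) (U' n) (\<xi>' n)" for n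
  have b0: "0 \<le> b n" for n unfolding b_def by (rule bending_coercive(3)[OF csp lam])
  have enC: "b n / (2 * k n) + 2 * pi * k n \<le> m + 1" for n
  proof -
    have "1 / real (Suc n) \<le> 1" by simp
    then show ?thesis using en[of n] unfolding en_def b_def by linarith
  qed

  \<comment> \<open>Uniform bounds on speed and derivatives\<close>
  define kM where "kM = (m + 1) / (2 * pi)"
  have k_le: "k n \<le> kM" for n
  proof -
    have "0 \<le> b n / (2 * k n)" using b0[of n] P(1)[of n] by simp
    then have "2 * pi * k n \<le> m + 1" using enC[of n] by linarith
    then show ?thesis by (simp add: kM_def field_simps)
  qed
  have b_le: "b n \<le> 2 * (m + 1) * k n" for n
  proof -
    have "0 \<le> 2 * pi * k n" using P(1)[of n] by simp
    then have "b n / (2 * k n) \<le> m + 1" using enC[of n] by linarith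
    then show ?thesis using P(1)[of n] by (simp add: field_simps)
  qed
  define B where "B = 2 * (m + 1) * kM"
  have b_B: "b n \<le> B" for n
  proof -
    have "2 * (m + 1) * k n \<le> 2 * (m + 1) * kM" using k_le[of n] m0 by (intro mult_left_mono) auto
    then show ?thesis using b_le[of n] unfolding B_def by linarith
  qed
  define K where "K = 2 + 2 * \<delta>\<^sup>2 / lam"
  have K: "K > 0" using lam by (simp add: K_def add_pos_nonneg)
  have U'_le: "(LINT x|MI. (norm (U' n x))\<^sup>2) \<le> K * b n" for n
    unfolding K_def b_def by (rule bending_coercive(2)[OF csp lam])
  \<comment> \<open>The sum of the bounds for \<open>U'\<close> and \<open>\<xi>'\<close>, so that
    one constant serves both.\<close>
  define M where "M = K * B + B / lam"
  have B0: "0 \<le> B" using b0[of 0] b_B[of 0] by linarith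
  have U'_M: "(LINT x|MI. (norm (U' n x))\<^sup>2) \<le> M" for n
  proof -
    have "K * b n \<le> K * B" using K b_B[of n] by simp
    then show ?thesis using U'_le[of n] B0 lam unfolding M_def by (smt (verit) divide_nonneg_pos)
  qed
  have \<xi>'_M: "(LINT x|MI. (norm (\<xi>' n x))\<^sup>2) \<le> M" for n
  proof -
    have "lam * (LINT x|MI. (norm (\<xi>' n x))\<^sup>2) \<le> B"
      using bending_coercive(1)[OF csp lam, of n \<delta>] b_B[of n] unfolding b_def by linarith
    then have "(LINT x|MI. (norm (\<xi>' n x))\<^sup>2) \<le> B / lam" using lam by (simp add: field_simps)
    then show ?thesis using K B0 unfolding M_def by (smt (verit) mult_nonneg_nonneg)
  qed
  have M0: "0 \<le> M" using K B0 lam unfolding M_def by simp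
  \<comment> \<open>Obtained by solving 1/(8 pi) \<le> K b \<le> K * 2 (m + 1) * k for the speed
    \<open>k\<close>: closed curves need bending, and the energy bound allows bending only in
    proportion to \<open>k\<close>.\<close>
  define c where "c = 1 / (8 * pi * K * (2 * (m + 1)))"
  have c: "c > 0" using K m0 by (simp add: c_def)
  have k_ge: "c \<le> k n" for n
  proof -
    have "1 / (8 * pi) \<le> K * b n" using closed_curve_bending[OF csp[of n]] U'_le[of n] by linarith
    also have "\<dots> \<le> K * (2 * (m + 1) * k n)" using K b_le[of n] by simp
    finally have "1 / (8 * pi) \<le> (K * (2 * (m + 1))) * k n" by (simp add: mult.assoc)
    then have "1 / (8 * pi) / (K * (2 * (m + 1))) \<le> k n"
      using K m0 by (subst pos_divide_le_eq) (auto simp: mult.commute)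
    then show ?thesis by (simp add: c_def mult.assoc)
  qed

  \<comment> \<open>Equicontinuity and the uniform limit\<close>
  define F where "F n x = (k n, U n x, \<xi> n x)" for n x
  have incr: "norm (F n x - F n y) \<le> 2 * (t * M + \<bar>x - y\<bar> / t)"
    if "x \<in> I2pi" "y \<in> I2pi" "t > 0" for n x y t
  proof -
    have *: "norm (F n x - F n y) \<le> 2 * (t * M + \<bar>x - y\<bar> / t)" if "x \<le> y" "x \<in> I2pi" "y \<in> I2pi" for x y
    proof -
      have U: "norm (U n y - U n x) \<le> t * (LINT x|MI. (norm (U' n x))\<^sup>2) + (y - x) / t"
        by (rule primitive_on_increment_bound[OF P(2,3)]) (use that \<open>t > 0\<close> in auto)
      have \<xi>: "norm (\<xi> n y - \<xi> n x) \<le> t * (LINT x|MI. (norm (\<xi>' n x))\<^sup>2) + (y - x) / t"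
        by (rule primitive_on_increment_bound[OF P(7,8)]) (use that \<open>t > 0\<close> in auto)
      have tM: "t * (LINT x|MI. (norm (U' n x))\<^sup>2) \<le> t * M" "t * (LINT x|MI. (norm (\<xi>' n x))\<^sup>2) \<le> t * M"
        using \<open>t > 0\<close> U'_M \<xi>'_M by simp_all
      have "norm (F n x - F n y) \<le> norm (U n y - U n x) + norm (\<xi> n y - \<xi> n x)"
        unfolding F_def diff_Pair using norm_Pair_le[of 0 "(U n x - U n y, \<xi> n x - \<xi> n y)"] norm_Pair_le[of "U n x - U n y" "\<xi> n x - \<xi> n y"]
        by (simp add: norm_minus_commute)
      also have "\<dots> \<le> (t * M + (y - x) / t) + (t * M + (y - x) / t)"
        using order_trans[OF U add_right_mono[OF tM(1)]] order_trans[OF \<xi> add_right_mono[OF tM(2)]]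
        by (rule add_mono)
      finally have le: "norm (F n x - F n y) \<le> 2 * (t * M + (y - x) / t)" by (simp only: mult_2)
      have "\<bar>x - y\<bar> = y - x" using that by simp
      then show ?thesis using le by metis
    qed
    show ?thesis
      using *[of x y] *[of y x] that by (cases "x \<le> y") (auto simp: norm_minus_commute abs_minus_commute)
  qed
  \<comment> \<open>The speed travels along as a constant component of \<open>F\<close>, so one
    extraction makes speeds, tangents and \<open>\<xi>\<close> converge together.\<close>
  obtain G r where G: "continuous_on I2pi G" and r: "strict_mono (r :: nat \<Rightarrow> nat)"
    and FG: "\<And>e. 0 < e \<Longrightarrow> \<exists>N. \<forall>n x. n \<ge> N \<and> x \<in> I2pi \<longrightarrow> norm (F (r n) x - G x) < e"
  proof (rule Arzela_Ascoli[of I2pi F "kM + 2"])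
    show "norm (F n x) \<le> kM + 2" if "x \<in> I2pi" for n x
    proof -
      have "norm (F n x) \<le> norm (k n) + (norm (U n x) + norm (\<xi> n x))"
        unfolding F_def by (intro order_trans[OF norm_Pair_le] add_left_mono norm_Pair_le)
      then show ?thesis using P(1)[of n] P(4)[OF that, of n] P(9)[OF that, of n] k_le[of n] by simp
    qed
    show "\<exists>d>0. \<forall>n y. y \<in> I2pi \<and> norm (x - y) < d \<longrightarrow> norm (F n x - F n y) < e"
      if "x \<in> I2pi" "0 < e" for x e
    proof -
      \<comment> \<open>The energy term 2 t M is then below e/2, and the radius t e / 4 keeps the
        length term 2 |x - y| / t below e/2 too.\<close>
      define t where "t = e / (4 * (M + 1))"
      have t: "t > 0" using that M0 by (simp add: t_def)
      have tM: "2 * (t * M) < e / 2" using that M0 by (simp add: t_def field_simps)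
      show ?thesis
      proof (intro exI[of _ "t * e / 4"] conjI allI impI)
        show "0 < t * e / 4" using t that by simp
        fix n y assume y: "y \<in> I2pi \<and> norm (x - y) < t * e / 4"
        then have xy: "\<bar>x - y\<bar> / t < e / 4" using t by (simp add: pos_divide_less_eq mult.commute)
        have "norm (F n x - F n y) \<le> 2 * (t * M + \<bar>x - y\<bar> / t)"
          by (rule incr) (use y t \<open>x \<in> I2pi\<close> in auto)
        also have "\<dots> = 2 * (t * M) + 2 * (\<bar>x - y\<bar> / t)" by (rule distrib_left)
        finally show "norm (F n x - F n y) < e" using xy tM by linarith
      qed
    qed
  qed auto
  define \<epsilon> where "\<epsilon> n = 1 / real (Suc n)" for n
  have \<epsilon>: "0 < \<epsilon> n" "\<epsilon> n \<le> 1" for n by (simp_all add: \<epsilon>_def)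
  have \<epsilon>_anti: "\<epsilon> n \<le> \<epsilon> n'" if "n' \<le> n" for n n' using that by (simp add: \<epsilon>_def field_simps)
  have \<epsilon>_lim: "\<epsilon> \<longlonglongrightarrow> 0" unfolding \<epsilon>_def by (rule LIMSEQ_Suc[OF lim_1_over_n])
  \<comment> \<open>A further selection prescribes the rate: uniform distance below
    \<open>\<epsilon> n\<close>, and, thanks to \<open>i n \<ge> n\<close>, an energy excess below
    \<open>\<epsilon> n\<close> as well.\<close>
  have "\<exists>i\<ge>n. \<forall>x\<in>I2pi. norm (F i x - G x) < \<epsilon> n" for n
  proof -
    obtain N where N: "\<And>n' x. n' \<ge> N \<Longrightarrow> x \<in> I2pi \<Longrightarrow> norm (F (r n') x - G x) < \<epsilon> n"
      using FG[OF \<epsilon>(1)[of n]] by blast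
    have "r (max N n) \<ge> n" using seq_suble[OF r, of "max N n"] by simp
    then show ?thesis using N by (intro exI[of _ "r (max N n)"]) auto
  qed
  then obtain i where i: "\<And>n. i n \<ge> n" "\<And>n x. x \<in> I2pi \<Longrightarrow> norm (F (i n) x - G x) < \<epsilon> n" by metis
  \<comment> \<open>The first components of all \<open>F n\<close> are constant in x, so the value
    at 0 gives the limit speed.\<close>
  define l where "l = fst (G 0)"
  define T where "T x = fst (snd (G x))" for x
  define \<eta> where "\<eta> x = snd (snd (G x))" for x
  have close: "\<bar>k (i n) - fst (G x)\<bar> \<le> \<epsilon> n" "norm (U (i n) x - T x) \<le> \<epsilon> n" "norm (\<xi> (i n) x - \<eta> x) \<le> \<epsilon> n"
    if "x \<in> I2pi" for n x
  proof -
    have eq: "F (i n) x - G x = (k (i n) - fst (G x), U (i n) x - T x, \<xi> (i n) x - \<eta> x)"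
      by (simp add: F_def T_def \<eta>_def prod_eq_iff)
    have lt: "norm (k (i n) - fst (G x), U (i n) x - T x, \<xi> (i n) x - \<eta> x) < \<epsilon> n"
      using i(2)[OF that, of n] unfolding eq .
    show "\<bar>k (i n) - fst (G x)\<bar> \<le> \<epsilon> n"
      using order_le_less_trans[OF norm_fst_le lt] by simp
    have lt2: "norm (U (i n) x - T x, \<xi> (i n) x - \<eta> x) < \<epsilon> n" using order_le_less_trans[OF norm_snd_le lt] .
    show "norm (U (i n) x - T x) \<le> \<epsilon> n" using order_le_less_trans[OF norm_fst_le lt2] by simp
    show "norm (\<xi> (i n) x - \<eta> x) \<le> \<epsilon> n" using order_le_less_trans[OF norm_snd_le lt2] by simp
  qed
  have to: "f \<longlonglongrightarrow> z" if "\<And>n. norm (f n - z) \<le> \<epsilon> n" for f and z :: "'z::real_normed_vector"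
    by (rule LIM_zero_cancel, rule Lim_null_comparison[OF always_eventually[OF allI] \<epsilon>_lim]) (rule that)
  have k_lim: "(\<lambda>n. k (i n)) \<longlonglongrightarrow> l" unfolding l_def by (rule to) (use close(1)[of 0] in auto)
  have U_lim: "(\<lambda>n. U (i n) x) \<longlonglongrightarrow> T x" if "x \<in> I2pi" for x by (rule to) (rule close(2)[OF that])
  have \<xi>_lim: "(\<lambda>n. \<xi> (i n) x) \<longlonglongrightarrow> \<eta> x" if "x \<in> I2pi" for x by (rule to) (rule close(3)[OF that])

  \<comment> \<open>The constraints pass to the limit\<close>
  have "c \<le> l" by (rule LIMSEQ_le_const[OF k_lim]) (use k_ge in auto)
  then have l: "l > 0" using c by linarith
  have T_unit: "norm (T x) = 1" if "x \<in> I2pi" for x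
    using tendsto_norm[OF U_lim[OF that]] P(4)[OF that] by (simp add: LIMSEQ_const_iff)
  have \<eta>_unit: "norm (\<eta> x) = 1" if "x \<in> I2pi" for x
    using tendsto_norm[OF \<xi>_lim[OF that]] P(9)[OF that] by (simp add: LIMSEQ_const_iff)
  have T_per: "T 0 = T (2*pi)"
    using LIMSEQ_unique[OF U_lim[of 0]] U_lim[of "2*pi"] P(5) by simp
  have \<eta>_per: "\<eta> 0 = \<eta> (2*pi)"
    using LIMSEQ_unique[OF \<xi>_lim[of 0]] \<xi>_lim[of "2*pi"] P(10) by simp
  have Tc: "continuous_on I2pi T" unfolding T_def by (intro continuous_intros G)
  have Uc: "continuous_on I2pi (U n)" for n by (rule primitive_on_continuous[OF P(2)])
  have intU_lim: "(\<lambda>n. integral {0..x} (U (i n))) \<longlonglongrightarrow> integral {0..x} T" if x: "x \<in> I2pi" for x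
  proof -
    have int: "U n integrable_on {0..x}" "T integrable_on {0..x}" for n
      using x by (auto intro!: integrable_continuous_interval continuous_on_subset[OF Uc] continuous_on_subset[OF Tc])
    have "norm (integral {0..x} (U (i n)) - integral {0..x} T) \<le> 2 * pi * \<epsilon> n" for n
    proof -
      have "norm (integral {0..x} (\<lambda>t. U (i n) t - T t)) \<le> integral {0..x} (\<lambda>t. \<epsilon> n)"
        by (intro integral_norm_bound_integral Henstock_Kurzweil_Integration.integrable_diff int integrable_const_ivl close(2))
           (use x in auto)
      also have "\<dots> = x * \<epsilon> n" using x by simp
      also have "\<dots> \<le> 2 * pi * \<epsilon> n" using x \<epsilon>(1)[of n] by (intro mult_right_mono) auto
      finally show ?thesis by (simp add: Henstock_Kurzweil_Integration.integral_diff int)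
    qed
    then have "\<forall>\<^sub>F n in sequentially. norm (integral {0..x} (U (i n)) - integral {0..x} T) \<le> 2 * pi * \<epsilon> n"
      by (rule always_eventually[OF allI])
    then have "(\<lambda>n. integral {0..x} (U (i n)) - integral {0..x} T) \<longlonglongrightarrow> 0"
      by (rule Lim_null_comparison) (rule tendsto_mult_right_zero[OF \<epsilon>_lim])
    then show ?thesis by (rule LIM_zero_cancel)
  qed
  have T_closed: "integral I2pi T = 0"
    using intU_lim[of "2*pi"] P(6) by (simp add: LIMSEQ_const_iff)
  have area: "- (1/2) * (l\<^sup>2 * (LINT x|MI. integral {0..x} T \<bullet> J (T x))) = A0"
  proof -
    have "(\<lambda>n. LINT x|MI. integral {0..x} (U (i n)) \<bullet> J (U (i n) x)) \<longlonglongrightarrow> (LINT x|MI. integral {0..x} T \<bullet> J (T x))"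
    proof (rule integral_dominated_convergence[where w="\<lambda>_. 2 * pi"])
      interpret finite_measure MI by (rule finite_measure_MI)
      show "integrable MI (\<lambda>_. 2 * pi)" by simp
      show "(\<lambda>x. integral {0..x} T \<bullet> J (T x)) \<in> borel_measurable MI"
        by (intro continuous_measurable_MI continuous_intros Tc indefinite_integral_continuous_1 integrable_continuous_interval)
      show "(\<lambda>x. integral {0..x} (U (i n)) \<bullet> J (U (i n) x)) \<in> borel_measurable MI" for n
        by (intro continuous_measurable_MI continuous_intros Uc indefinite_integral_continuous_1 integrable_continuous_interval)
      show "AE x in MI. (\<lambda>n. integral {0..x} (U (i n)) \<bullet> J (U (i n) x)) \<longlonglongrightarrow> integral {0..x} T \<bullet> J (T x)"
        by (intro AE_I2 tendsto_inner intU_lim bounded_linear.tendsto[OF J_linear] U_lim) auto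
      have "norm (integral {0..x} (U (i n)) \<bullet> J (U (i n) x)) \<le> 2 * pi" if x: "x \<in> I2pi" for n x
      proof -
        have "norm (integral {0..x} (U (i n))) \<le> integral {0..x} (\<lambda>_. 1)"
          using x P(4) by (intro integral_norm_bound_integral integrable_continuous_interval continuous_on_subset[OF Uc]) auto
        then have "norm (integral {0..x} (U (i n))) \<le> 2 * pi" using x by simp
        moreover have "\<bar>integral {0..x} (U (i n)) \<bullet> J (U (i n) x)\<bar> \<le> norm (integral {0..x} (U (i n))) * norm (J (U (i n) x))"
          by (rule Cauchy_Schwarz_ineq2)
        ultimately show ?thesis using P(4)[OF x] by simp
      qed
      then show "AE x in MI. norm (integral {0..x} (U (i n)) \<bullet> J (U (i n) x)) \<le> 2 * pi" for n
        by (intro AE_I2) auto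
    qed
    then have "(\<lambda>n. - (1/2) * ((k (i n))\<^sup>2 * (LINT x|MI. integral {0..x} (U (i n)) \<bullet> J (U (i n) x)))) \<longlonglongrightarrow>
       - (1/2) * (l\<^sup>2 * (LINT x|MI. integral {0..x} T \<bullet> J (T x)))"
      by (intro tendsto_mult tendsto_const tendsto_power k_lim)
    then show ?thesis unfolding P(11) by (simp add: LIMSEQ_const_iff)
  qed

  \<comment> \<open>Derivatives encoded with the limit tangent\<close>
  define w where "w n x = encode \<delta> lam (T x) (U' (i n) x) (\<xi>' (i n) x)" for n x
  have [measurable]: "T \<in> borel_measurable MI" "U n \<in> borel_measurable MI" "U' n \<in> borel_measurable MI" "\<xi>' n \<in> borel_measurable MI" for n
    using continuous_measurable_MI[OF Tc] primitive_on_measurable[OF P(2)] primitive_on_measurable[OF P(7)] by auto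
  have w_meas [measurable]: "w n \<in> borel_measurable MI" for n
    unfolding w_def encode_def by measurable
  have sq: "integrable MI (\<lambda>x. (norm (U' n x))\<^sup>2)" "integrable MI (\<lambda>x. (norm (\<xi>' n x))\<^sup>2)" for n
    using P(3,8) by (auto simp: L2_def)
  let ?a = "\<lambda>n x. U' n x \<bullet> J (U n x) + \<delta> * (\<xi>' n x \<bullet> U n x)"
  have a_int: "integrable MI (\<lambda>x. (?a n x)\<^sup>2)" for n
    by (rule bending_density_integrable[OF P(2,3) _ P(8)]) (rule P(4))
  define W where "W n x = (?a (i n) x)\<^sup>2 + lam * (norm (\<xi>' (i n) x))\<^sup>2
      + \<epsilon> n * (5 * (norm (U' (i n) x))\<^sup>2 + 4 * \<delta>\<^sup>2 * (norm (\<xi>' (i n) x))\<^sup>2)" for n x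
  have W_int: "integrable MI (W n)" for n
    unfolding W_def using a_int sq by (intro Bochner_Integration.integrable_add integrable_mult_right) auto
  have w_W: "AE x in MI. (norm (w n x))\<^sup>2 \<le> W n x" for n
  proof -
    have "AE x in MI. x \<in> I2pi" by (auto intro: AE_I2)
    moreover have "AE x in MI. U (i n) x \<bullet> U' (i n) x = 0"
      by (rule unit_primitive_orthogonal[OF P(2)]) (rule P(4))
    ultimately show ?thesis
    proof eventually_elim
      case (elim x)
      then show ?case unfolding w_def W_def
        by (intro norm_encode_le lam T_unit P(4) close(2) \<epsilon>) auto
    qed
  qed
  have w_int: "integrable MI (\<lambda>x. (norm (w n x))\<^sup>2)" for n
  proof (rule Bochner_Integration.integrable_bound[OF W_int[of n]])
    show "AE x in MI. norm ((norm (w n x))\<^sup>2) \<le> norm (W n x)"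
      using w_W[of n] by eventually_elim auto
  qed measurable
  \<comment> \<open>The first term is the energy bound m + \<epsilon> n solved for the bending at
    speed \<open>k (i n)\<close>, the second the error of freezing the tangent. Its limit 2 l (m - 2
    pi l) is exactly the bending that gives energy \<open>m\<close> at speed
    \<open>l\<close>.\<close>
  define e where "e n = 2 * k (i n) * (m + \<epsilon> n - 2 * pi * k (i n)) + \<epsilon> n * (5 * M + 4 * \<delta>\<^sup>2 * M)" for n
  have w_e: "(LINT x|MI. (norm (w n x))\<^sup>2) \<le> e n" for n
  proof -
    have "(LINT x|MI. (norm (w n x))\<^sup>2) \<le> (LINT x|MI. W n x)"
      by (rule integral_mono_AE[OF w_int W_int w_W])
    also have "\<dots> = b (i n) + \<epsilon> n * (5 * (LINT x|MI. (norm (U' (i n) x))\<^sup>2) + 4 * \<delta>\<^sup>2 * (LINT x|MI. (norm (\<xi>' (i n) x))\<^sup>2))"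
      unfolding W_def b_def bending_def using a_int sq by simp
    also have "b (i n) \<le> 2 * k (i n) * (m + \<epsilon> n - 2 * pi * k (i n))"
    proof -
      have "b (i n) / (2 * k (i n)) + 2 * pi * k (i n) < m + \<epsilon> (i n)"
        using en[of "i n"] unfolding en_def b_def \<epsilon>_def .
      then have "b (i n) / (2 * k (i n)) \<le> m + \<epsilon> n - 2 * pi * k (i n)" using \<epsilon>_anti[OF i(1)[of n]] by linarith
      then show ?thesis using P(1)[of "i n"] by (simp add: pos_divide_le_eq mult.commute)
    qed
    also have "\<epsilon> n * (5 * (LINT x|MI. (norm (U' (i n) x))\<^sup>2) + 4 * \<delta>\<^sup>2 * (LINT x|MI. (norm (\<xi>' (i n) x))\<^sup>2))
        \<le> \<epsilon> n * (5 * M + 4 * \<delta>\<^sup>2 * M)"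
      using \<epsilon>(1)[of n] U'_M[of "i n"] \<xi>'_M[of "i n"] by (intro mult_left_mono add_mono) auto
    finally show ?thesis by (simp add: e_def)
  qed
  have e_lim: "e \<longlonglongrightarrow> 2 * l * (m - 2 * pi * l)"
  proof -
    have "e \<longlonglongrightarrow> 2 * l * (m + 0 - 2 * pi * l) + 0 * (5 * M + 4 * \<delta>\<^sup>2 * M)"
      unfolding e_def by (intro tendsto_intros k_lim \<epsilon>_lim)
    then show ?thesis by simp
  qed
  obtain h g D where h: "\<And>j. h j \<in> midpoint_hull w j" and hg: "AE x in MI. (\<lambda>j. h j x) \<longlonglongrightarrow> g x"
    and D: "integrable MI D" "AE x in MI. \<forall>j. norm (h j x) \<le> D x"
    and g: "g \<in> borel_measurable MI" "integrable MI (\<lambda>x. (norm (g x))\<^sup>2)"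
      "(LINT x|MI. (norm (g x))\<^sup>2) \<le> 2 * l * (m - 2 * pi * l)"
    using midpoint_hull_limit[OF finite_measure_MI w_meas w_int w_e e_lim] by blast

  \<comment> \<open>Identification of the limit derivatives\<close>
  let ?dec = "\<lambda>f t. decode \<delta> lam (T t) (f t)"
  define Q where "Q x = (T x, \<eta> x)" for x
  \<comment> \<open>For a single \<open>w n'\<close> the integral differs from the increment of
    \<open>Q\<close> by four errors: two fields, each at x and at 0. The bound concerns the distance
    to one fixed function, hence passes to midpoints.\<close>
  have hull: "integrable MI (?dec f) \<and> (\<forall>x\<in>I2pi. norm (integral {0..x} (?dec f) - (Q x - Q 0)) \<le> 4 * \<epsilon> n)"
    if "f \<in> midpoint_hull w n" for f n
    using that
  proof induction
    case (base n')
    have pr: "primitive_on 0 (2*pi) (\<lambda>x. (U (i n') x, \<xi> (i n') x)) (\<lambda>x. (U' (i n') x, \<xi>' (i n') x))"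
      by (rule primitive_on_Pair[OF P(2,7)])
    have dec: "?dec (w n') t = (U' (i n') t, \<xi>' (i n') t)" if "t \<in> I2pi" for t
      unfolding w_def by (rule decode_encode[OF lam T_unit[OF that]])
    show ?case
    proof (intro conjI ballI)
      have "integrable MI (\<lambda>x. (U' (i n') x, \<xi>' (i n') x))" by (rule primitive_on_integrable[OF pr])
      then show "integrable MI (?dec (w n'))"
        by (subst Bochner_Integration.integrable_cong[OF refl]) (use dec in auto)
      fix x assume x: "x \<in> I2pi"
      have "integral {0..x} (?dec (w n')) = integral {0..x} (\<lambda>x. (U' (i n') x, \<xi>' (i n') x))"
        by (rule integral_cong) (use x dec in auto)
      also have "\<dots> = (U (i n') x, \<xi> (i n') x) - (U (i n') 0, \<xi> (i n') 0)"
        using primitive_onD(3)[OF pr x] by simp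
      finally have "integral {0..x} (?dec (w n')) - (Q x - Q 0)
         = ((U (i n') x - T x) - (U (i n') 0 - T 0), (\<xi> (i n') x - \<eta> x) - (\<xi> (i n') 0 - \<eta> 0))"
        by (simp add: Q_def algebra_simps)
      also have "norm \<dots> \<le> (norm (U (i n') x - T x) + norm (U (i n') 0 - T 0)) + (norm (\<xi> (i n') x - \<eta> x) + norm (\<xi> (i n') 0 - \<eta> 0))"
        by (intro order_trans[OF norm_Pair_le] add_mono norm_triangle_ineq4)
      also have "\<dots> \<le> (\<epsilon> n' + \<epsilon> n') + (\<epsilon> n' + \<epsilon> n')"
        by (intro add_mono close x) auto
      also have "\<dots> \<le> 4 * \<epsilon> n" using \<epsilon>_anti[OF base] by simp
      finally show "norm (integral {0..x} (?dec (w n')) - (Q x - Q 0)) \<le> 4 * \<epsilon> n" .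
    qed
  next
    case (mid f f')
    have eq: "?dec (\<lambda>x. (1/2) *\<^sub>R (f x + f' x)) = (\<lambda>t. (1/2) *\<^sub>R (?dec f t + ?dec f' t))"
      by (rule ext) (rule decode_midpoint)
    show ?case
      unfolding eq
    proof (intro conjI ballI)
      show "integrable MI (\<lambda>t. (1/2) *\<^sub>R (?dec f t + ?dec f' t))" using mid by simp
      fix x assume x: "x \<in> I2pi"
      have int: "?dec f integrable_on {0..x}" "?dec f' integrable_on {0..x}"
        using mid x by (auto intro!: integrable_on_subinterval[OF integrable_on_lebesgue_on[of I2pi]])
      have "integral {0..x} (\<lambda>t. (1/2) *\<^sub>R (?dec f t + ?dec f' t)) - (Q x - Q 0)
        = (1/2) *\<^sub>R ((integral {0..x} (?dec f) - (Q x - Q 0)) + (integral {0..x} (?dec f') - (Q x - Q 0)))"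
      proof -
        have I: "integral {0..x} (\<lambda>t. (1/2) *\<^sub>R (?dec f t + ?dec f' t)) = (1/2) *\<^sub>R (integral {0..x} (?dec f) + integral {0..x} (?dec f'))"
          by (simp only: integral_cmul Henstock_Kurzweil_Integration.integral_add[OF int])
        have "(a - q) + (b - q) = (a + b) - (q + q)" for a b q :: "(real ^ 2) \<times> (real ^ 2)"
          by (simp add: algebra_simps)
        then show ?thesis by (simp only: I scaleR_diff_right scaleR_half_double)
      qed
      also have "norm \<dots> \<le> (1/2) * (4 * \<epsilon> n + 4 * \<epsilon> n)"
        unfolding norm_scaleR using mid x by (intro mult_mono order_trans[OF norm_triangle_ineq] add_mono) auto
      finally show "norm (integral {0..x} (\<lambda>t. (1/2) *\<^sub>R (?dec f t + ?dec f' t)) - (Q x - Q 0)) \<le> 4 * \<epsilon> n" by simp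
    qed
  qed
  define Cd where "Cd = 2 + \<bar>\<delta>\<bar> / sqrt lam + 1 / sqrt lam"
  have Cd0: "0 \<le> Cd" using lam by (simp add: Cd_def)
  have dec_le: "norm (?dec f t) \<le> Cd * norm (f t)" if "t \<in> I2pi" for f t
    unfolding Cd_def by (rule norm_decode_le[OF lam T_unit[OF that]])
  have dec_meas: "?dec f \<in> borel_measurable MI" if f: "f \<in> borel_measurable MI" for f
  proof -
    have [measurable]: "(\<lambda>x. fst (f x)) \<in> borel_measurable MI" "(\<lambda>x. fst (snd (f x))) \<in> borel_measurable MI"
      "(\<lambda>x. snd (snd (f x))) \<in> borel_measurable MI"
      by (rule measurable_compose[OF f borel_measurable_continuous_onI], intro continuous_intros)+
    show ?thesis unfolding decode_def by (intro borel_measurable_Pair) measurable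
  qed
  have inI: "AE x in MI. x \<in> I2pi" by (auto intro: AE_I2)
  have dec_g_int: "integrable MI (?dec g)"
  proof (rule Bochner_Integration.integrable_bound)
    show "integrable MI (\<lambda>x. Cd * D x)" using D(1) by simp
    show "AE x in MI. norm (?dec g x) \<le> norm (Cd * D x)"
      using hg D(2) inI
    proof eventually_elim
      case (elim x)
      have "norm (g x) \<le> D x" by (rule LIMSEQ_le_const2[OF tendsto_norm[OF elim(1)]]) (use elim(2) in auto)
      then have "Cd * norm (g x) \<le> Cd * D x" by (rule mult_left_mono[OF _ Cd0])
      then have "norm (?dec g x) \<le> Cd * D x" using dec_le[OF elim(3), of g] by linarith
      then show ?case by simp
    qed
  qed (rule dec_meas[OF g(1)])
  have dec_h_int: "integrable MI (?dec (h j))" for j using hull[OF h] by blast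
  \<comment> \<open>The integrals of the decoded \<open>h j\<close> have two limits: the integral of
    decoded \<open>g\<close>, by dominated convergence, and the increment of \<open>Q\<close>, by
    the bound on the hulls.\<close>
  have prim: "primitive_on 0 (2*pi) Q (?dec g)"
    unfolding primitive_on_def
  proof (intro conjI ballI)
    show "?dec g absolutely_integrable_on I2pi" using dec_g_int by (simp add: integrable_lebesgue_on_iff)
    fix x assume x: "x \<in> I2pi"
    have "(\<lambda>j. LINT t|MI. indicator {0..x} t *\<^sub>R ?dec (h j) t) \<longlonglongrightarrow> (LINT t|MI. indicator {0..x} t *\<^sub>R ?dec g t)"
    proof (rule integral_dominated_convergence[where w="\<lambda>x. Cd * D x"])
      show "integrable MI (\<lambda>x. Cd * D x)" using D(1) by simp
      show "(\<lambda>t. indicator {0..x} t *\<^sub>R ?dec g t) \<in> borel_measurable MI"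
        using integral_initial_segment(2)[OF dec_g_int x] by simp
      show "(\<lambda>t. indicator {0..x} t *\<^sub>R ?dec (h j) t) \<in> borel_measurable MI" for j
        using integral_initial_segment(2)[OF dec_h_int x] by simp
      show "AE t in MI. (\<lambda>j. indicator {0..x} t *\<^sub>R ?dec (h j) t) \<longlonglongrightarrow> indicator {0..x} t *\<^sub>R ?dec g t"
        using hg
      proof eventually_elim
        case (elim t)
        show ?case unfolding decode_def
          by (intro tendsto_intros tendsto_Pair tendsto_fst tendsto_snd elim)
      qed
      show "AE t in MI. norm (indicator {0..x} t *\<^sub>R ?dec (h j) t) \<le> Cd * D t" for j
        using D(2) inI
      proof eventually_elim
        case (elim t)
        have "norm (indicator {0..x} t *\<^sub>R ?dec (h j) t) \<le> norm (?dec (h j) t)"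
          by (simp add: indicator_def)
        also have "\<dots> \<le> Cd * norm (h j t)" by (rule dec_le[OF elim(2)])
        also have "\<dots> \<le> Cd * D t" using elim(1) Cd0 by (intro mult_left_mono) auto
        finally show ?case .
      qed
    qed
    then have "(\<lambda>j. integral {0..x} (?dec (h j))) \<longlonglongrightarrow> integral {0..x} (?dec g)"
      unfolding integral_initial_segment(1)[OF dec_h_int x] integral_initial_segment(1)[OF dec_g_int x] .
    moreover have "(\<lambda>j. integral {0..x} (?dec (h j))) \<longlonglongrightarrow> Q x - Q 0"
    proof (rule LIM_zero_cancel, rule Lim_null_comparison[OF always_eventually[OF allI]])
      show "(\<lambda>j. 4 * \<epsilon> j) \<longlonglongrightarrow> 0" by (rule tendsto_mult_right_zero[OF \<epsilon>_lim])
      show "norm (integral {0..x} (?dec (h j)) - (Q x - Q 0)) \<le> 4 * \<epsilon> j" for j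
        using hull[OF h] x by blast
    qed
    ultimately have "integral {0..x} (?dec g) = Q x - Q 0" by (rule LIMSEQ_unique)
    then show "Q x = Q 0 + integral {0..x} (?dec g)" by simp
  qed
  define T' where "T' t = fst (?dec g t)" for t
  define \<eta>' where "\<eta>' t = snd (?dec g t)" for t
  have T: "primitive_on 0 (2*pi) T T'"
    using primitive_on_linear[OF bounded_linear_fst prim] by (simp add: Q_def T'_def[abs_def])
  have \<eta>: "primitive_on 0 (2*pi) \<eta> \<eta>'"
    using primitive_on_linear[OF bounded_linear_snd prim] by (simp add: Q_def \<eta>'_def[abs_def])
  have norm_fst_le': "norm (fst z) \<le> norm z" and norm_snd_le': "norm (snd z) \<le> norm z"
    for z :: "(real ^ 2) \<times> (real ^ 2)"
    using norm_fst_le[of "fst z" "snd z"] norm_snd_le[of "snd z" "fst z"] by simp_all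
  have T'2: "T' \<in> L2"
    by (rule L2_bounded[OF primitive_on_measurable(2)[OF T] g(2), of Cd])
       (auto simp: T'_def intro: order_trans[OF norm_fst_le' dec_le[of _ g]])
  have \<eta>'2: "\<eta>' \<in> L2"
    by (rule L2_bounded[OF primitive_on_measurable(2)[OF \<eta>] g(2), of Cd])
       (auto simp: \<eta>'_def intro: order_trans[OF norm_snd_le' dec_le[of _ g]])
  have csp': "constant_speed_pair A0 l T T' \<eta> \<eta>'"
    unfolding constant_speed_pair_def
    by (intro conjI ballI l T T'2 T_unit T_per T_closed \<eta> \<eta>'2 \<eta>_unit \<eta>_per area)

  \<comment> \<open>Energy of the limit\<close>
  have "bending \<delta> lam T T' \<eta>' \<le> (LINT x|MI. (norm (g x))\<^sup>2)"
  proof -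
    have a: "integrable MI (\<lambda>x. (T' x \<bullet> J (T x) + \<delta> * (\<eta>' x \<bullet> T x))\<^sup>2)"
      by (rule bending_density_integrable[OF T T'2 _ \<eta>'2]) (rule T_unit)
    have e: "integrable MI (\<lambda>x. (norm (\<eta>' x))\<^sup>2)" using \<eta>'2 by (simp add: L2_def)
    have "bending \<delta> lam T T' \<eta>' = (LINT x|MI. (T' x \<bullet> J (T x) + \<delta> * (\<eta>' x \<bullet> T x))\<^sup>2 + lam * (norm (\<eta>' x))\<^sup>2)"
      using a e by (simp add: bending_def)
    also have "\<dots> \<le> (LINT x|MI. (norm (g x))\<^sup>2)"
    proof (rule integral_mono)
      show "integrable MI (\<lambda>x. (T' x \<bullet> J (T x) + \<delta> * (\<eta>' x \<bullet> T x))\<^sup>2 + lam * (norm (\<eta>' x))\<^sup>2)" using a e by simp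
      fix x assume "x \<in> space MI"
      then have x: "x \<in> I2pi" by simp
      \<comment> \<open>Decoding returns \<open>g2\<close> as bending integrand and
        \<open>g3\<close> as sqrt lam times \<open>\<eta>'\<close>. The square of \<open>g1\<close>
        only increases the norm of \<open>g\<close>, so an inequality suffices.\<close>
      obtain g1 g2 g3 where gx: "g x = (g1, g2, g3)" by (cases "g x") auto
      have "J (T x) \<bullet> J (T x) = 1" using T_unit[OF x] by (simp add: J_inner norm_eq_1)
      then have "T' x \<bullet> J (T x) + \<delta> * (\<eta>' x \<bullet> T x) = g2"
        by (simp add: T'_def \<eta>'_def decode_def gx inner_add_left)
      moreover have "lam * (norm (\<eta>' x))\<^sup>2 = (norm g3)\<^sup>2"
        using lam by (simp add: \<eta>'_def decode_def gx power_divide)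
      ultimately show "(T' x \<bullet> J (T x) + \<delta> * (\<eta>' x \<bullet> T x))\<^sup>2 + lam * (norm (\<eta>' x))\<^sup>2 \<le> (norm (g x))\<^sup>2"
        by (simp add: gx norm_Pair)
    qed (rule g(2))
    finally show ?thesis .
  qed
  then have "bending \<delta> lam T T' \<eta>' \<le> 2 * l * (m - 2 * pi * l)" using g(3) by linarith
  then have "bending \<delta> lam T T' \<eta>' / (2 * l) + 2 * pi * l \<le> m"
    using l by (simp add: pos_divide_le_eq field_simps)
  then show thesis
    using that[OF csp'] m_le unfolding en_def by (meson order_trans)
qed

text \<open>In complex notation the curve is \<open>c e\<^sup>2\<^sup>i\<^sup>x + d e\<^sup>-\<^sup>i\<^sup>x\<close>; it has signed area \<open>\<pi> (2c\<^sup>2 - d\<^sup>2)\<close> and is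
  immersed unless \<open>d = 2c\<close>.\<close>

lemma admissible_nonempty: "\<exists>\<gamma> \<eta>. (\<gamma>, \<eta>) \<in> admissible A0"
proof -
  \<comment> \<open>c^2 = |A0|/pi + 1 makes the radicand of \<open>d\<close> positive for either
    sign of \<open>A0\<close>. It also excludes d = 2 c: that would mean 2 c^2 = - A0/pi, which is
    at most c^2 - 1.\<close>
  define c where "c = sqrt (\<bar>A0\<bar> / pi + 1)"
  define d where "d = sqrt (2 * c\<^sup>2 - A0 / pi)"
  have c2: "c\<^sup>2 = \<bar>A0\<bar> / pi + 1" and c: "c > 0" by (simp_all add: c_def add_nonneg_pos)
  have A: "A0 / pi \<le> \<bar>A0\<bar> / pi" "- (A0 / pi) \<le> \<bar>A0\<bar> / pi" "0 \<le> \<bar>A0\<bar> / pi" 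
    using divide_right_mono[of "- A0" "\<bar>A0\<bar>" pi] by (simp_all add: divide_right_mono)
  have d2: "d\<^sup>2 = 2 * c\<^sup>2 - A0 / pi" and d: "d \<ge> 0" using A by (simp_all add: d_def c2)
  have ne: "2 * c \<noteq> d"
  proof
    assume "2 * c = d"
    then have "4 * c\<^sup>2 = d\<^sup>2" by (simp add: power_mult_distrib flip: \<open>2 * c = d\<close>)
    then show False using d2 c2 A by linarith
  qed
  define \<gamma> :: "real \<Rightarrow> real ^ 2" where "\<gamma> x = vector [c * cos (2 * x) + d * cos x, c * sin (2 * x) - d * sin x]" for x
  define u :: "real \<Rightarrow> real ^ 2" where "u x = vector [- 2 * c * sin (2 * x) - d * sin x, 2 * c * cos (2 * x) - d * cos x]" for x
  define v :: "real \<Rightarrow> real ^ 2" where "v x = vector [- 4 * c * cos (2 * x) - d * cos x, - 4 * c * sin (2 * x) + d * sin x]" for x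
  have vec: "vector [p, q] = p *\<^sub>R axis 1 1 + q *\<^sub>R (axis 2 1 :: real ^ 2)" for p q :: real
    by (simp add: vec_eq_iff forall_2 axis_def)
  have vc: "continuous_on X v" for X unfolding v_def vec by (intro continuous_intros)
  have uc: "continuous_on X u" for X unfolding u_def vec by (intro continuous_intros)
  have \<gamma>: "primitive_on 0 (2*pi) \<gamma> u"
    by (rule primitive_on_vector_derivative[OF _ uc])
       (auto simp: \<gamma>_def[abs_def] u_def vec has_vector_derivative_def algebra_simps intro!: derivative_eq_intros)
  have u: "primitive_on 0 (2*pi) u v"
    by (rule primitive_on_vector_derivative[OF _ vc])
       (auto simp: v_def u_def[abs_def] vec has_vector_derivative_def algebra_simps intro!: derivative_eq_intros)
  define \<eta> :: "real \<Rightarrow> real ^ 2" where "\<eta> x = axis 1 1" for x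
  have per: "cos (2 * (2 * pi)) = 1" "sin (2 * (2 * pi)) = 0"
    using cos_int_2pin[of 2] sin_int_2pin[of 2] by (simp_all add: algebra_simps)
  have "\<gamma> \<in> Hper 2"
    unfolding Hper_2_iff
  proof (intro conjI exI)
    show "u 0 = u (2*pi)" "\<gamma> 0 = \<gamma> (2*pi)" by (simp_all add: \<gamma>_def u_def per)
  qed (fact \<gamma> u continuous_L2[OF vc])+
  moreover have "dx \<gamma> x \<noteq> 0" if "x \<in> I2pi" for x
  proof
    assume "dx \<gamma> x = 0"
    then have "u x = 0" using dx_eq(1)[OF \<gamma> uc that] by simp
    then have "- 2 * c * sin (2 * x) - d * sin x = 0" "2 * c * cos (2 * x) - d * cos x = 0"
      by (simp_all add: u_def vec_eq_iff forall_2)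
    then have "2 * c * sin (2 * x) = - d * sin x" "2 * c * cos (2 * x) = d * cos x" by simp_all
    then have "(2 * c * sin (2 * x))\<^sup>2 + (2 * c * cos (2 * x))\<^sup>2 = (d * sin x)\<^sup>2 + (d * cos x)\<^sup>2" by simp
    then have "(2 * c)\<^sup>2 * ((sin (2 * x))\<^sup>2 + (cos (2 * x))\<^sup>2) = d\<^sup>2 * ((sin x)\<^sup>2 + (cos x)\<^sup>2)"
      by (simp only: power_mult_distrib distrib_left)
    then have "(2 * c)\<^sup>2 = d\<^sup>2" by simp
    then have "2 * c = d" by (rule power2_eq_imp_eq) (use c d in auto)
    then show False using ne by simp
  qed
  ultimately have "\<gamma> \<in> H2imm" by (simp add: H2imm_def)
  moreover have "signed_area \<gamma> = A0"
  proof -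
    have "signed_area \<gamma> = - (1/2) * (LINT x|MI. \<gamma> x \<bullet> J (u x))"
      unfolding signed_area_def
    proof (intro arg_cong2[where f="(*)"] refl Bochner_Integration.integral_cong)
      show "\<gamma> x \<bullet> J (dx \<gamma> x) = \<gamma> x \<bullet> J (u x)" if "x \<in> space MI" for x
        using dx_eq(1)[OF \<gamma> uc, of x] that unfolding space_lebesgue_on by metis
    qed
    also have "(LINT x|MI. \<gamma> x \<bullet> J (u x)) = integral I2pi (\<lambda>x. \<gamma> x \<bullet> J (u x))"
      by (intro lebesgue_integral_eq_integral continuous_integrable_MI continuous_intros uc primitive_on_continuous[OF \<gamma>]) auto
    also have "\<dots> = integral I2pi (\<lambda>x. d\<^sup>2 - 2 * c\<^sup>2 - c * d * cos (3 * x))"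
    proof (rule integral_cong)
      fix x :: real
      have eq3: "cos (3 * x) = cos (2 * x) * cos x - sin (2 * x) * sin x"
        using cos_add[of "2 * x" x] by simp
      have "\<gamma> x \<bullet> J (u x) = d\<^sup>2 * ((sin x)\<^sup>2 + (cos x)\<^sup>2) - 2 * c\<^sup>2 * ((sin (2 * x))\<^sup>2 + (cos (2 * x))\<^sup>2) - c * d * cos (3 * x)"
      proof -
        have "(c * a + d * p) * - (2 * c * a - d * p) + (c * b - d * q) * (- 2 * c * b - d * q)
          = d\<^sup>2 * (q\<^sup>2 + p\<^sup>2) - 2 * c\<^sup>2 * (b\<^sup>2 + a\<^sup>2) - c * d * (a * p - b * q)" for a b p q :: real
          by (simp add: power2_eq_square algebra_simps)
        then show ?thesis unfolding eq3 \<gamma>_def u_def inner_real2 J_nth vector_2 .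
      qed
      then show "\<gamma> x \<bullet> J (u x) = d\<^sup>2 - 2 * c\<^sup>2 - c * d * cos (3 * x)" by simp
    qed
    also have "\<dots> = (d\<^sup>2 - 2 * c\<^sup>2) * (2 * pi)"
    proof (rule integral_unique)
      have "((\<lambda>x. d\<^sup>2 - 2 * c\<^sup>2 - c * d * cos (3 * x)) has_integral
         ((d\<^sup>2 - 2 * c\<^sup>2) * (2 * pi) - c * d / 3 * sin (3 * (2 * pi))) - ((d\<^sup>2 - 2 * c\<^sup>2) * 0 - c * d / 3 * sin (3 * 0))) I2pi"
        by (rule fundamental_theorem_of_calculus)
           (auto simp flip: has_real_derivative_iff_has_vector_derivative intro!: derivative_eq_intros)
      moreover have "sin (3 * (2 * pi)) = 0" using sin_int_2pin[of 3] by (simp add: algebra_simps)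
      ultimately show "((\<lambda>x. d\<^sup>2 - 2 * c\<^sup>2 - c * d * cos (3 * x)) has_integral (d\<^sup>2 - 2 * c\<^sup>2) * (2 * pi)) I2pi"
        by simp
    qed
    finally show ?thesis by (simp add: d2)
  qed
  moreover have "\<eta> \<in> Hper 1"
    unfolding Hper_1_iff
  proof (intro conjI exI)
    show "primitive_on 0 (2*pi) \<eta> (\<lambda>_. 0)" by (simp add: primitive_on_def \<eta>_def)
  qed (auto simp: \<eta>_def continuous_L2)
  ultimately have "(\<gamma>, \<eta>) \<in> admissible A0"
    by (simp add: admissible_def S_def \<eta>_def)
  then show ?thesis by blast
qed

theorem corollary3p3:
  fixes \<delta> lam A0 :: real
  assumes "lam > 0"
  shows "\<exists>(\<gamma>, \<eta>) \<in> admissible A0.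
           \<forall>(\<gamma>', \<eta>') \<in> admissible A0. E_LM \<delta> lam \<gamma> \<eta> \<le> E_LM \<delta> lam \<gamma>' \<eta>'"
proof -
  obtain \<gamma>0 \<eta>0 where "(\<gamma>0, \<eta>0) \<in> admissible A0" using admissible_nonempty by blast
  then obtain l0 T0 T0' \<xi>0 \<xi>0' where "constant_speed_pair A0 l0 T0 T0' \<xi>0 \<xi>0'"
    by (rule admissible_constant_speed)
  then obtain l T T' \<eta> \<eta>' where min: "constant_speed_pair A0 l T T' \<eta> \<eta>'"
    "\<And>k U U' \<xi> \<xi>'. constant_speed_pair A0 k U U' \<xi> \<xi>' \<Longrightarrow>
       bending \<delta> lam T T' \<eta>' / (2 * l) + 2 * pi * l \<le> bending \<delta> lam U U' \<xi>' / (2 * k) + 2 * pi * k"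
    by (rule constant_speed_minimizer[OF assms]) blast
  define \<gamma> where "\<gamma> x = l *\<^sub>R integral {0..x} T" for x
  note E = E_LM_constant_speed[OF min(1), folded \<gamma>_def]
  have "E_LM \<delta> lam \<gamma> \<eta> \<le> E_LM \<delta> lam \<gamma>' \<eta>1" if adm: "(\<gamma>', \<eta>1) \<in> admissible A0" for \<gamma>' \<eta>1
  proof -
    obtain k U U' \<xi> \<xi>' where "constant_speed_pair A0 k U U' \<xi> \<xi>'"
      "E_LM \<delta> lam \<gamma>' \<eta>1 = bending \<delta> lam U U' \<xi>' / (2 * k) + 2 * pi * k"
      using admissible_constant_speed[OF adm] by metis
    then show ?thesis using min(2) E(2) by metis
  qed
  then show ?thesis using E(1) by blast
qed

end
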